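(* Let $G=(V,E)$ be a digraph and let $t,t'\in B_n$ with $t\neq t'$. Write $H=H_{t,t'}$, $M=M_{t,t'}$, $L=L_{t,t'}$, $Y=Y_{t,t'}$, $Z=Z_{t,t'}$, $\omega=\omega_{t,t'}$, $\lambda=\lambda_{t,t'}$. Then the graph algebra $\mathbb{A}(G)$ satisfies the identity $t\approx t'$ if and only if all of the following conditions hold: (i) every nontrivial strongly connected component of $G$ is a whirl; (ii) there is no path from a nontrivial strongly connected component of $G$ to another one; (iii) $M_G$ divides $M$; (iv) $P_G<H$; (v) $E_G\le L+1$; (vi) $O_G\le Y+1$; (vii) $Z_G<Z$; (viii) $B_G<L$; (ix) $\omega_G(L+1,r)<\omega(r)$ for all $r\in\{1,\dots,L+1\}$; (x) if $E_G=L+1$, then $\lambda_G<\lambda$.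
   Context: Digraphs $G=(V,E)$ have $E\subseteq V\times V$, loops allowed, and may be infinite. A walk of length $k$ is a sequence $v_0\to v_1\to\dots\to v_k$ with $(v_{i-1},v_i)\in E$; a path is a walk with distinct vertices. A strongly connected component (SCC) is trivial if it consists of a single vertex without a loop, nontrivial otherwise. For $m\ge1$, an $m$-whirl is a digraph whose vertex set is partitioned into nonempty blocks $B_0,\dots,B_{m-1}$ (indices mod $m$) with edge set exactly $\bigcup_i B_i\times B_{i+1}$; $B_{i-1}$ is the predecessor block of $B_i$. A whirl is an $m$-whirl for some $m$. Comparisons involve the extended integers with $-\infty<$ every integer $<\infty$. Graph algebra: $\mathbb{A}(G)$ is the groupoid on $V\cup\{\infty\}$ ($\infty\notin V$) with $xy=x$ if $x,y\in V$ and $(x,y)\in E$, and $xy=\infty$ otherwise; it satisfies $t\approx t'$ if $t,t'$ induce the same term operation on it. Bracketings: $B_n$ is the set of binary terms in which $x_1,\dots,x_n$ each occur once, in this order. For a bracketing $t$, the tree $G(t)$ is defined recursively: $G(x_i)$ is the single vertex $x_i$; if $t=t_1t_2$, then $G(t)$ is $G(t_1)\cup G(t_2)$ plus an edge from the leftmost variable of $t_1$ to the leftmost variable of $t_2$; it is rooted at $x_1$ with edges directed away from the root. For a rooted tree $T$: $d_T(x)$ is the depth of $x$, $h(T)$ the height, $T_x$ the rooted induced subtree consisting of $x$ and all its descendants (equality $T_x=T'_x$ means equal vertex and edge sets). Parameters of $t\ne t'$, with $T=G(t)$, $T'=G(t')$, $X_n=\{x_1,\dots,x_n\}$: $H_{t,t'}=\min(h(T),h(T'))$;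 $M_{t,t'}=\gcd\{|d_T(x)-d_{T'}(x)|:x\in X_n\}$; $L_{t,t'}$ is the largest $m$ such that for all $x$, $d_T(x)\le m$ or $d_{T'}(x)\le m$ implies $d_T(x)=d_{T'}(x)$; $Y_{t,t'}$ is the largest $m$ such that for all $x$, $h(T_x)\le m$ or $h(T'_x)\le m$ implies $T_x=T'_x$; $Z_{t,t'}$ is the smallest $m\ge0$ such that some $x$ has $T_x=T'_x$, $h(T_x)=m$, and different parents in $T$ and $T'$. Let $\Delta=\{x:T_x\ne T'_x\}$, $\Omega=\{(d_T(x),h(T_x)),(d_{T'}(x),h(T'_x)):x\in\Delta\}$, $\xi=\min\{d+h:(d,h)\in\Omega\}$, and for integers $r\ge0$ let $\omega_{t,t'}(r)=\min\{d+h:(d,h)\in\Omega,\ d\le r\}$ if $r<\xi$ and $\omega_{t,t'}(r)=\xi$ if $r\ge\xi$. Let $\Lambda=\{x:d_T(x)\ne d_{T'}(x),\ L_{t,t'}+1\in\{d_T(x),d_{T'}(x)\}\}$ and $\lambda_{t,t'}=\min\{\max(h(T_x),h(T'_x)):x\in\Lambda\}$. Parameters of $G$: $M_G$ is the lcm of all $m$ such that some SCC of $G$ is an $m$-whirl ($1$ if none, $\infty$ if unbounded). A walk is pleasant if all its vertices lie in trivial SCCs. For a nontrivial SCC $K$, an entryway to $K$ is a path $v_0\to\dots\to v_\ell$ with $v_0\to\dots\to v_{\ell-1}$ pleasant and $v_\ell\in K$; an outlet from $K$ is a path $v_0\to\dots\to v_\ell$ with $v_0\in K$ and $v_1\to\dots\to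 v_\ell$ pleasant. $P_G,E_G,O_G$ are the maximal lengths of a pleasant path, entryway, outlet respectively ($\infty$ if unbounded, $-\infty$ if none exists). $Z_G$ is the largest $m\ge0$ such that some SCC $K$ that is a whirl has a block containing vertices $u,w$, there is a walk $u\to v_0\to\dots\to v_m$, and $(w,v_0)\notin E$. $B_G$ is the largest $m$ such that there are a walk $v_0\to\dots\to v_m$ and edges $v_m\to v_{m+1}$, $v_m\to v'_{m+1}$ with $v_{m+1},v'_{m+1}$ in distinct nontrivial SCCs. For $\ell\ge r\ge1$, $\omega_G(\ell,r)$ is the largest $m$ such that there are a walk $v_0\to\dots\to v_\ell$ with $v_\ell$ in a nontrivial SCC and a walk $v_{r-1}\to v'_r\to v'_{r+1}\to\dots\to v'_m$ with $v'_\ell$ in a trivial SCC. $\lambda_G$ is the largest $m$ such that there are an entryway $u_0\to\dots\to u_{E_G}$ to a nontrivial SCC $K$, a vertex $w\in K$ with $(w,u_{E_G})\in E$, and a walk $v_0\to\dots\to v_m$ such that exactly one of $(w,v_0)$, $(u_{E_G-1},v_0)$ is an edge. For $Z_G,B_G,\omega_G,\lambda_G$: the value is $\infty$ if there is no finite bound and $-\infty$ if no such $m$ exists. *)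

theory Defs
  imports Main "HOL-Library.Extended_Real" "HOL-Library.Extended_Nat"
begin

datatype bterm = Var nat | App bterm bterm

fun leaves :: "bterm \<Rightarrow> nat list" where
  "leaves (Var i) = [i]"
| "leaves (App a b) = leaves a @ leaves b"

definition bracketings :: "nat \<Rightarrow> bterm set" where
  "bracketings n = {t. leaves t = [1..<Suc n]}"

fun lmv :: "bterm \<Rightarrow> nat" where
  "lmv (Var i) = i"
| "lmv (App a b) = lmv a"

text \<open>Edge set of the tree G(t) (vertex set X_n, root x_1).\<close>
fun tedges :: "bterm \<Rightarrow> (nat \<times> nat) set" where
  "tedges (Var i) = {}"
| "tedges (App a b) = tedges a \<union> tedges b \<union> {(lmv a, lmv b)}"

text \<open>Rooted-tree notions for a tree given by its edge set (edges directed away from root).\<close>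
definition depth :: "(nat \<times> nat) set \<Rightarrow> nat \<Rightarrow> nat \<Rightarrow> nat" where
  "depth T r x = (LEAST k. (r, x) \<in> T ^^ k)"

definition descs :: "(nat \<times> nat) set \<Rightarrow> nat \<Rightarrow> nat set" where
  "descs T x = {y. (x, y) \<in> T\<^sup>*}"

definition height :: "(nat \<times> nat) set \<Rightarrow> nat \<Rightarrow> nat" where
  "height T x = Max {k. \<exists>y. (x, y) \<in> T ^^ k}"

definition subtree_eq :: "(nat \<times> nat) set \<Rightarrow> (nat \<times> nat) set \<Rightarrow> nat \<Rightarrow> bool" where
  "subtree_eq T T' x \<longleftrightarrow> descs T x = descs T' x \<and> Restr T (descs T x) = Restr T' (descs T' x)"

definition parents :: "(nat \<times> nat) set \<Rightarrow> nat \<Rightarrow> nat set" where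
  "parents T x = {p. (p, x) \<in> T}"

definition tt_H :: "bterm \<Rightarrow> bterm \<Rightarrow> ereal" where
  "tt_H t t' = ereal (real (min (height (tedges t) 1) (height (tedges t') 1)))"

definition tt_M :: "nat \<Rightarrow> bterm \<Rightarrow> bterm \<Rightarrow> nat" where
  "tt_M n t t' = Gcd {nat \<bar>int (depth (tedges t) 1 x) - int (depth (tedges t') 1 x)\<bar> | x. x \<in> {1..n}}"

definition tt_L :: "nat \<Rightarrow> bterm \<Rightarrow> bterm \<Rightarrow> ereal" where
  "tt_L n t t' = Sup {ereal (real_of_int m) | m :: int. \<forall>x\<in>{1..n}.
      (int (depth (tedges t) 1 x) \<le> m \<or> int (depth (tedges t') 1 x) \<le> m)
        \<longrightarrow> depth (tedges t) 1 x = depth (tedges t') 1 x}"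

definition tt_Y :: "nat \<Rightarrow> bterm \<Rightarrow> bterm \<Rightarrow> ereal" where
  "tt_Y n t t' = Sup {ereal (real_of_int m) | m :: int. \<forall>x\<in>{1..n}.
      (int (height (tedges t) x) \<le> m \<or> int (height (tedges t') x) \<le> m)
        \<longrightarrow> subtree_eq (tedges t) (tedges t') x}"

definition tt_Z :: "nat \<Rightarrow> bterm \<Rightarrow> bterm \<Rightarrow> ereal" where
  "tt_Z n t t' = Inf {ereal (real m) | m :: nat. \<exists>x\<in>{1..n}.
      subtree_eq (tedges t) (tedges t') x \<and> height (tedges t) x = m
      \<and> parents (tedges t) x \<noteq> parents (tedges t') x}"

definition tt_Delta :: "nat \<Rightarrow> bterm \<Rightarrow> bterm \<Rightarrow> nat set" where
  "tt_Delta n t t' = {x \<in> {1..n}. \<not> subtree_eq (tedges t) (tedges t') x}"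

definition tt_Omega :: "nat \<Rightarrow> bterm \<Rightarrow> bterm \<Rightarrow> (nat \<times> nat) set" where
  "tt_Omega n t t' =
     {(depth (tedges t) 1 x, height (tedges t) x) | x. x \<in> tt_Delta n t t'}
   \<union> {(depth (tedges t') 1 x, height (tedges t') x) | x. x \<in> tt_Delta n t t'}"

definition tt_xi :: "nat \<Rightarrow> bterm \<Rightarrow> bterm \<Rightarrow> ereal" where
  "tt_xi n t t' = Inf {ereal (real (d + h)) | d h. (d, h) \<in> tt_Omega n t t'}"

definition tt_omega :: "nat \<Rightarrow> bterm \<Rightarrow> bterm \<Rightarrow> nat \<Rightarrow> ereal" where
  "tt_omega n t t' r =
     (if ereal (real r) < tt_xi n t t'
      then Inf {ereal (real (d + h)) | d h. (d, h) \<in> tt_Omega n t t' \<and> d \<le> r}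
      else tt_xi n t t')"

definition tt_Lambda :: "nat \<Rightarrow> bterm \<Rightarrow> bterm \<Rightarrow> nat set" where
  "tt_Lambda n t t' = {x \<in> {1..n}. depth (tedges t) 1 x \<noteq> depth (tedges t') 1 x \<and>
      (tt_L n t t' + 1 = ereal (real (depth (tedges t) 1 x))
       \<or> tt_L n t t' + 1 = ereal (real (depth (tedges t') 1 x)))}"

definition tt_lambda :: "nat \<Rightarrow> bterm \<Rightarrow> bterm \<Rightarrow> ereal" where
  "tt_lambda n t t' = Inf {ereal (real (max (height (tedges t) x) (height (tedges t') x))) | x.
      x \<in> tt_Lambda n t t'}"

text \<open>Carrier V \<union> {\<infinity>}, represented as 'v option with None = \<infinity>.\<close>
definition ga_mult :: "'v set \<Rightarrow> ('v \<times> 'v) set \<Rightarrow> 'v option \<Rightarrow> 'v option \<Rightarrow> 'v option" where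
  "ga_mult V E a b = (case (a, b) of
      (Some x, Some y) \<Rightarrow> if x \<in> V \<and> y \<in> V \<and> (x, y) \<in> E then Some x else None
    | _ \<Rightarrow> None)"

fun ga_eval :: "'v set \<Rightarrow> ('v \<times> 'v) set \<Rightarrow> (nat \<Rightarrow> 'v option) \<Rightarrow> bterm \<Rightarrow> 'v option" where
  "ga_eval V E f (Var i) = f i"
| "ga_eval V E f (App a b) = ga_mult V E (ga_eval V E f a) (ga_eval V E f b)"

definition ga_satisfies :: "'v set \<Rightarrow> ('v \<times> 'v) set \<Rightarrow> bterm \<Rightarrow> bterm \<Rightarrow> bool" where
  "ga_satisfies V E t t' \<longleftrightarrow>
     (\<forall>f. (\<forall>i. f i \<in> insert None (Some ` V)) \<longrightarrow> ga_eval V E f t = ga_eval V E f t')"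

definition walk :: "'v set \<Rightarrow> ('v \<times> 'v) set \<Rightarrow> 'v list \<Rightarrow> bool" where
  "walk V E p \<longleftrightarrow> p \<noteq> [] \<and> set p \<subseteq> V \<and> (\<forall>i. Suc i < length p \<longrightarrow> (p ! i, p ! Suc i) \<in> E)"

definition wlen :: "'v list \<Rightarrow> nat" where
  "wlen p = length p - 1"

definition is_path :: "'v set \<Rightarrow> ('v \<times> 'v) set \<Rightarrow> 'v list \<Rightarrow> bool" where
  "is_path V E p \<longleftrightarrow> walk V E p \<and> distinct p"

definition scc_of :: "'v set \<Rightarrow> ('v \<times> 'v) set \<Rightarrow> 'v \<Rightarrow> 'v set" where
  "scc_of V E u = {v \<in> V. (u, v) \<in> E\<^sup>* \<and> (v, u) \<in> E\<^sup>*}"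

definition is_scc :: "'v set \<Rightarrow> ('v \<times> 'v) set \<Rightarrow> 'v set \<Rightarrow> bool" where
  "is_scc V E K \<longleftrightarrow> (\<exists>u\<in>V. K = scc_of V E u)"

definition trivial_comp :: "('v \<times> 'v) set \<Rightarrow> 'v set \<Rightarrow> bool" where
  "trivial_comp E K \<longleftrightarrow> (\<exists>v. K = {v} \<and> (v, v) \<notin> E)"

definition nontrivial_scc :: "'v set \<Rightarrow> ('v \<times> 'v) set \<Rightarrow> 'v set \<Rightarrow> bool" where
  "nontrivial_scc V E K \<longleftrightarrow> is_scc V E K \<and> \<not> trivial_comp E K"

definition in_trivial :: "'v set \<Rightarrow> ('v \<times> 'v) set \<Rightarrow> 'v \<Rightarrow> bool" where
  "in_trivial V E v \<longleftrightarrow> v \<in> V \<and> trivial_comp E (scc_of V E v)"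

definition in_nontrivial :: "'v set \<Rightarrow> ('v \<times> 'v) set \<Rightarrow> 'v \<Rightarrow> bool" where
  "in_nontrivial V E v \<longleftrightarrow> v \<in> V \<and> \<not> trivial_comp E (scc_of V E v)"

definition is_whirl :: "('v \<times> 'v) set \<Rightarrow> 'v set \<Rightarrow> nat \<Rightarrow> (nat \<Rightarrow> 'v set) \<Rightarrow> bool" where
  "is_whirl E K m B \<longleftrightarrow> m \<ge> 1 \<and> (\<forall>i<m. B i \<noteq> {}) \<and>
     (\<forall>i<m. \<forall>j<m. i \<noteq> j \<longrightarrow> B i \<inter> B j = {}) \<and> (\<Union>i<m. B i) = K \<and>
     Restr E K = (\<Union>i<m. B i \<times> B (Suc i mod m))"

definition whirl :: "('v \<times> 'v) set \<Rightarrow> 'v set \<Rightarrow> bool" where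
  "whirl E K \<longleftrightarrow> (\<exists>m B. is_whirl E K m B)"

definition pleasant :: "'v set \<Rightarrow> ('v \<times> 'v) set \<Rightarrow> 'v list \<Rightarrow> bool" where
  "pleasant V E p \<longleftrightarrow> (\<forall>v\<in>set p. in_trivial V E v)"

definition entryway :: "'v set \<Rightarrow> ('v \<times> 'v) set \<Rightarrow> 'v set \<Rightarrow> 'v list \<Rightarrow> bool" where
  "entryway V E K p \<longleftrightarrow> nontrivial_scc V E K \<and> is_path V E p \<and>
     pleasant V E (butlast p) \<and> last p \<in> K"

definition outlet :: "'v set \<Rightarrow> ('v \<times> 'v) set \<Rightarrow> 'v set \<Rightarrow> 'v list \<Rightarrow> bool" where
  "outlet V E K p \<longleftrightarrow> nontrivial_scc V E K \<and> is_path V E p \<and>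
     hd p \<in> K \<and> pleasant V E (tl p)"

section \<open>Parameters of a digraph (Sup {} = -\<infinity>, unbounded = \<infinity>)\<close>

definition graph_M :: "'v set \<Rightarrow> ('v \<times> 'v) set \<Rightarrow> enat" where
  "graph_M V E = (let W = {m. \<exists>K B. is_scc V E K \<and> is_whirl E K m B} in
     if finite W then enat (Lcm W) else \<infinity>)"

definition graph_P :: "'v set \<Rightarrow> ('v \<times> 'v) set \<Rightarrow> ereal" where
  "graph_P V E = Sup {ereal (real (wlen p)) | p. is_path V E p \<and> pleasant V E p}"

definition graph_E :: "'v set \<Rightarrow> ('v \<times> 'v) set \<Rightarrow> ereal" where
  "graph_E V E = Sup {ereal (real (wlen p)) | p K. entryway V E K p}"

definition graph_O :: "'v set \<Rightarrow> ('v \<times> 'v) set \<Rightarrow> ereal" where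
  "graph_O V E = Sup {ereal (real (wlen p)) | p K. outlet V E K p}"

definition graph_Z :: "'v set \<Rightarrow> ('v \<times> 'v) set \<Rightarrow> ereal" where
  "graph_Z V E = Sup {ereal (real m) | m :: nat. \<exists>K k B i u w vs.
      is_scc V E K \<and> is_whirl E K k B \<and> i < k \<and> u \<in> B i \<and> w \<in> B i \<and>
      walk V E (u # vs) \<and> length vs = m + 1 \<and> (w, hd vs) \<notin> E}"

definition graph_B :: "'v set \<Rightarrow> ('v \<times> 'v) set \<Rightarrow> ereal" where
  "graph_B V E = Sup {ereal (real (wlen p)) | p. \<exists>a b K K'. walk V E p \<and>
      (last p, a) \<in> E \<and> (last p, b) \<in> E \<and> nontrivial_scc V E K \<and> nontrivial_scc V E K' \<and>
      K \<noteq> K' \<and> a \<in> K \<and> b \<in> K'}"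

text \<open>omega_G(l,r) for l \<ge> r \<ge> 1. The walk p is v_0..v_l; the walk q is
  v_(r-1), v'_r, ..., v'_m, so q ! j = v'_(r-1+j) for j \<ge> 1.\<close>
definition graph_omega :: "'v set \<Rightarrow> ('v \<times> 'v) set \<Rightarrow> nat \<Rightarrow> nat \<Rightarrow> ereal" where
  "graph_omega V E l r = Sup {ereal (real m) | m :: nat. \<exists>p q.
      walk V E p \<and> length p = l + 1 \<and> in_nontrivial V E (last p) \<and>
      walk V E q \<and> hd q = p ! (r - 1) \<and> l \<le> m \<and> length q = m - r + 2 \<and>
      in_trivial V E (q ! (l - r + 1))}"

text \<open>lambda_G: entryway u_0..u_(E_G) (of maximal length E_G, with E_G \<ge> 1 so that
  u_(E_G - 1) exists), w in K with (w, u_(E_G)) an edge, walk v_0..v_m.\<close>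
definition graph_lambda :: "'v set \<Rightarrow> ('v \<times> 'v) set \<Rightarrow> ereal" where
  "graph_lambda V E = Sup {ereal (real m) | m :: nat. \<exists>K p w vs.
      entryway V E K p \<and> ereal (real (wlen p)) = graph_E V E \<and> length p \<ge> 2 \<and>
      w \<in> K \<and> (w, last p) \<in> E \<and> walk V E vs \<and> length vs = m + 1 \<and>
      (((w, hd vs) \<in> E) \<noteq> ((p ! (length p - 2), hd vs) \<in> E))}"

end

theory Submission
  imports Defs
begin

text \<open>
  A graph algebra satisfies \<open>t \<approx> t'\<close> iff the trees \<open>T = G(t)\<close> and \<open>T' = G(t')\<close> have the same
  homomorphisms into \<open>G\<close>. The vertices of such a tree are numbered in depth-first order, so that the
  depth function determines the tree, and the two trees agree up to depth \<open>L\<close>.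

  Sufficiency: let \<open>\<phi>\<close> be a homomorphism on \<open>T\<close> and \<open>p' \<rightarrow> x\<close> an edge of \<open>T'\<close> only. Below a vertex
  mapped into a nontrivial component \<open>K\<close>, the whirl structure and the periods fix the block of every
  vertex in \<open>K\<close>, the branches leaving \<open>K\<close> are too low to differ between the trees (vi), and they may
  be attached anywhere in the right block (vii). By (iv), (v) and (ix) the common ancestor of \<open>x\<close> at
  depth \<open>L\<close> lies below such a vertex or has a child mapped into some \<open>K\<close>; in the latter case (x) allows
  to replace its image by a vertex of \<open>K\<close>.

  Necessity: a violation of a condition yields a homomorphism on one tree that follows a walk of \<open>G\<close>
  by depth, or follows one walk on a subtree and another one elsewhere; being a homomorphism on the
  other tree as well, it forces depths or subtrees to coincide that do not.
\<close>

section \<open>The trees of bracketings\<close>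

text \<open>That a homomorphism on one tree is also one on the other gives one-sided information
  only: edges of \<open>T'\<close> are mapped to edges of \<open>G\<close>. Two devices extract
  equalities from it. Along nonrecurrent images an edge of \<open>T'\<close> must increase the depth
  in \<open>T\<close>; hence heights in \<open>T'\<close> are no larger, the height bound carries
  over, and the argument can be repeated with the trees exchanged (\<open>shrinks\<close>). Where
  walks extend to both sides without end, they can be laid over a tree with any shift; the first
  vertex whose depths differ then yields one fixed jump on all such walks, from which (i) and (ii)
  follow (\<open>jump\<close>). These and (iii) are derived before the remaining conditions, some of
  which rely on them. All conditions are symmetric in the trees, so each argument is given for one
  direction and instantiated twice. Since \<open>G\<close> may be infinite, no longest walk of
  \<open>G\<close> is ever chosen: the conditions speak about single walks, and suprema enter only
  in the last section. Distinctness of the vertices of paths can be ignored, as a repeated vertex of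
  a walk is recurrent.\<close>

definition dep :: "(nat \<times> nat) set \<Rightarrow> nat \<Rightarrow> nat" where
  "dep T x = depth T 1 x"

locale dfs_tree =
  fixes n :: nat and T :: "(nat \<times> nat) set"
  assumes edgeD: "(p, x) \<in> T \<Longrightarrow> 1 \<le> p \<and> p < x \<and> x \<le> n"
    and parent_ex: "1 < x \<Longrightarrow> x \<le> n \<Longrightarrow> \<exists>p. (p, x) \<in> T"
    and parent_unique: "(p, x) \<in> T \<Longrightarrow> (q, x) \<in> T \<Longrightarrow> p = q"
    and noncrossing: "(p, x) \<in> T \<Longrightarrow> (q, y) \<in> T \<Longrightarrow> p < y \<Longrightarrow> y < x \<Longrightarrow> p \<le> q"
begin

lemma relpow_less: "(a, x) \<in> T ^^ k \<Longrightarrow> a + k \<le> x"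
proof (induction k arbitrary: x)
  case (Suc k)
  then obtain y where y: "(a, y) \<in> T ^^ k" "(y, x) \<in> T" by auto
  then show ?case using Suc.IH[OF y(1)] edgeD[OF y(2)] by linarith
qed auto

lemma relpow_unique: "(a, x) \<in> T ^^ k \<Longrightarrow> (a, x) \<in> T ^^ l \<Longrightarrow> k = l"
proof (induction k arbitrary: l x)
  case 0
  then show ?case using relpow_less[of a x l] by auto
next
  case (Suc k)
  then obtain y where y: "(a, y) \<in> T ^^ k" "(y, x) \<in> T" by auto
  have "l \<noteq> 0" using Suc.prems relpow_less[of a x "Suc k"] by (cases l) auto
  then obtain l' where l': "l = Suc l'" by (cases l) auto
  then obtain z where z: "(a, z) \<in> T ^^ l'" "(z, x) \<in> T" using Suc.prems by auto
  then have "z = y" using y parent_unique by blast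
  then show ?case using Suc.IH[OF y(1)] z l' by blast
qed

lemma root_relpow: "1 \<le> x \<Longrightarrow> x \<le> n \<Longrightarrow> \<exists>k. (1, x) \<in> T ^^ k"
proof (induction x rule: less_induct)
  case (less x)
  show ?case
  proof (cases "x = 1")
    case True
    then show ?thesis by (auto intro!: exI[of _ 0])
  next
    case False
    then obtain p where p: "(p, x) \<in> T" using parent_ex[of x] less.prems by auto
    then obtain k where "(1, p) \<in> T ^^ k" using less.IH[of p] edgeD[OF p] by auto
    then show ?thesis using p by (intro exI[of _ "Suc k"]) auto
  qed
qed

lemma dep_eqI: "(1, x) \<in> T ^^ k \<Longrightarrow> dep T x = k"
  unfolding dep_def depth_def by (rule Least_equality) (auto dest: relpow_unique)

lemma dep_relpow: "1 \<le> x \<Longrightarrow> x \<le> n \<Longrightarrow> (1, x) \<in> T ^^ dep T x"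
  using root_relpow dep_eqI by blast

lemma dep_root [simp]: "dep T 1 = 0" "dep T (Suc 0) = 0"
  using dep_eqI[of 1 0] by auto

lemma dep_edge: "(p, x) \<in> T \<Longrightarrow> dep T x = Suc (dep T p)"
  using dep_relpow[of p] edgeD[of p x] by (intro dep_eqI) auto

lemma dep_relpow_add: "(a, x) \<in> T ^^ k \<Longrightarrow> dep T x = dep T a + k"
  by (induction k arbitrary: x) (auto dest: dep_edge)

lemma dep_pos: "1 < x \<Longrightarrow> x \<le> n \<Longrightarrow> 0 < dep T x"
  using parent_ex[of x] dep_edge by force

text \<open>Climb from \<open>y\<close> through its parents: by noncrossing none of them precedes
  \<open>p\<close>, so the climb arrives at \<open>p\<close> through a child of \<open>p\<close>,
  which has the depth of \<open>x\<close>.\<close>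

lemma dep_between: "(p, x) \<in> T \<Longrightarrow> p < y \<Longrightarrow> y < x \<Longrightarrow> dep T x \<le> dep T y"
proof (induction y rule: less_induct)
  case (less y)
  obtain q where q: "(q, y) \<in> T"
    using parent_ex[of y] edgeD[OF less.prems(1)] less.prems by auto
  have "p \<le> q" using noncrossing[OF less.prems(1) q] less.prems by auto
  show ?case
  proof (cases "q = p")
    case True
    then show ?thesis using dep_edge[OF q] dep_edge[OF less.prems(1)] by auto
  next
    case False
    then have "dep T x \<le> dep T q" using less.IH[of q] less.prems edgeD[OF q] \<open>p \<le> q\<close> by auto
    then show ?thesis using dep_edge[OF q] by auto
  qed
qed

text \<open>In depth-first order the parent of \<open>x\<close> is the last earlier vertex of
  smaller depth. This reduces comparing the edges of two trees to comparing depths.\<close>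

lemma edge_iff: "(p, x) \<in> T \<longleftrightarrow> 1 \<le> p \<and> p < x \<and> x \<le> n \<and> dep T p < dep T x \<and>
    (\<forall>y. p < y \<and> y < x \<longrightarrow> dep T x \<le> dep T y)" (is "?l = ?r")
proof
  assume ?l
  then show ?r using edgeD[of p x] dep_between[of p x] dep_edge[of p x] by auto
next
  assume r: ?r
  then obtain q where q: "(q, x) \<in> T" using parent_ex[of x] by auto
  have "\<not> q < p" using r dep_between[OF q, of p] by auto
  moreover have "\<not> p < q" using r edgeD[OF q] dep_edge[OF q] by force
  ultimately have "q = p" by simp
  then show ?l using q by simp
qed

lemma self_descs [simp]: "x \<in> descs T x"
  by (simp add: descs_def)

lemma descs_edge: "p \<in> descs T x \<Longrightarrow> (p, y) \<in> T \<Longrightarrow> y \<in> descs T x"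
  by (auto simp: descs_def)

lemma descs_trans: "y \<in> descs T x \<Longrightarrow> z \<in> descs T y \<Longrightarrow> z \<in> descs T x"
  by (auto simp: descs_def)

lemma descs_parent: "y \<in> descs T x \<Longrightarrow> y \<noteq> x \<Longrightarrow> (p, y) \<in> T \<Longrightarrow> p \<in> descs T x"
  unfolding descs_def by (erule CollectE, erule rtranclE) (auto dest: parent_unique)

lemma descs_le: "y \<in> descs T x \<Longrightarrow> x \<le> y"
  unfolding descs_def by (auto dest: relpow_less dest!: rtrancl_imp_relpow)

lemma descs_range: "y \<in> descs T x \<Longrightarrow> 1 \<le> x \<Longrightarrow> x \<le> n \<Longrightarrow> 1 \<le> y \<and> y \<le> n"
  unfolding descs_def by (erule CollectE, erule rtranclE) (auto dest: edgeD)

lemma descs_dep: "y \<in> descs T x \<Longrightarrow> dep T x \<le> dep T y"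
  unfolding descs_def by (auto dest: dep_relpow_add dest!: rtrancl_imp_relpow)

lemma descs_dep_less: "y \<in> descs T x \<Longrightarrow> y \<noteq> x \<Longrightarrow> dep T x < dep T y"
proof -
  assume "y \<in> descs T x" "y \<noteq> x"
  then obtain k where "(x, y) \<in> T ^^ k" "k \<noteq> 0"
    unfolding descs_def using rtrancl_imp_relpow by (metis mem_Collect_eq relpow_0_E)
  then show ?thesis using dep_relpow_add[of x y k] by simp
qed

lemma descs_interval:
  assumes "z \<in> descs T x" "x < y" "y \<le> z"
  shows "dep T x < dep T y"
proof -
  have "(x, z) \<in> T\<^sup>*" using assms by (simp add: descs_def)
  then show ?thesis using assms(2,3)
  proof (induction)
    case base
    then show ?case by simp
  next
    case (step w z)
    have w: "w \<in> descs T x" using step by (simp add: descs_def)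
    show ?case
    proof (cases "y \<le> w")
      case True
      then show ?thesis using step by auto
    next
      case False
      then have "dep T z \<le> dep T y" using dep_between[OF step(2)] step by (cases "y = z") auto
      then show ?thesis using dep_edge[OF step(2)] descs_dep[OF w] by auto
    qed
  qed
qed

text \<open>Descendants of \<open>x\<close> are numbered consecutively: they form the interval from
  \<open>x\<close> up to the next vertex that is not deeper than \<open>x\<close>.\<close>

lemma descs_iff:
  assumes "1 \<le> x" "y \<le> n"
  shows "y \<in> descs T x \<longleftrightarrow> x \<le> y \<and> (\<forall>z. x < z \<and> z \<le> y \<longrightarrow> dep T x < dep T z)"
    (is "?l = ?r")
proof
  assume ?l
  then show ?r using descs_interval descs_le by blast
next
  assume ?r
  then show ?l using assms(2)
  proof (induction y rule: less_induct)
    case (less y)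
    show ?case
    proof (cases "y = x")
      case True
      then show ?thesis by simp
    next
      case False
      then obtain p where p: "(p, y) \<in> T" using parent_ex[of y] less.prems assms by auto
      have "x \<le> p"
      proof (rule ccontr)
        assume "\<not> x \<le> p"
        then have "dep T y \<le> dep T x" using dep_between[OF p, of x] False less.prems by auto
        moreover have "dep T x < dep T y" using less.prems False by auto
        ultimately show False by simp
      qed
      then have "p \<in> descs T x" using less.IH[of p] edgeD[OF p] less.prems by auto
      then show ?thesis using descs_edge p by blast
    qed
  qed
qed

lemma descs_root: "1 \<le> x \<Longrightarrow> x \<le> n \<Longrightarrow> x \<in> descs T 1"
  using root_relpow relpow_imp_rtrancl unfolding descs_def by blast

lemma descs_linear:
  assumes "z \<in> descs T x" "z \<in> descs T y" "x \<le> y" "1 \<le> x" "z \<le> n"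
  shows "y \<in> descs T x"
  using assms descs_le[OF assms(2)] by (subst descs_iff) (auto simp: descs_iff)

lemma ancestor_at_depth:
  assumes "1 \<le> x" "x \<le> n" "l \<le> dep T x"
  shows "\<exists>y. 1 \<le> y \<and> y \<le> n \<and> dep T y = l \<and> x \<in> descs T y"
  using assms
proof (induction x rule: less_induct)
  case (less x)
  show ?case
  proof (cases "l = dep T x")
    case True
    then show ?thesis using less.prems by (intro exI[of _ x]) auto
  next
    case False
    then have "x \<noteq> 1" using less.prems by auto
    then obtain p where p: "(p, x) \<in> T" using parent_ex[of x] less.prems by auto
    have "l \<le> dep T p" using dep_edge[OF p] less.prems False by auto
    then obtain y where "1 \<le> y" "y \<le> n" "dep T y = l" "p \<in> descs T y"
      using less.IH[of p] edgeD[OF p] by auto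
    then show ?thesis using p descs_edge by blast
  qed
qed

lemma height_set:
  assumes "1 \<le> x" "x \<le> n"
  shows "finite {k. \<exists>y. (x, y) \<in> T ^^ k}" and "0 \<in> {k. \<exists>y. (x, y) \<in> T ^^ k}"
proof -
  have "k \<le> n" if "(x, y) \<in> T ^^ k" for k y
  proof -
    have "y \<in> descs T x" using that by (simp add: descs_def relpow_imp_rtrancl)
    then show ?thesis using relpow_less[OF that] descs_range[of y x] assms by linarith
  qed
  then show "finite {k. \<exists>y. (x, y) \<in> T ^^ k}" by (auto intro: finite_subset[of _ "{..n}"])
qed auto

lemma dep_le_height:
  assumes "y \<in> descs T x" "1 \<le> x" "x \<le> n"
  shows "dep T y \<le> dep T x + height T x"
proof -
  obtain k where k: "(x, y) \<in> T ^^ k"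
    using assms(1) rtrancl_imp_relpow unfolding descs_def by blast
  then have "k \<le> height T x"
    unfolding height_def using height_set[OF assms(2,3)] by (intro Max_ge) auto
  then show ?thesis using dep_relpow_add[OF k] by simp
qed

lemma height_attained:
  assumes "1 \<le> x" "x \<le> n"
  shows "\<exists>y. (x, y) \<in> T ^^ height T x"
  using Max_in[OF height_set(1)[OF assms]] height_set(2)[OF assms]
  unfolding height_def by blast

lemma height_pos: "2 \<le> n \<Longrightarrow> 0 < height T 1"
  using dep_le_height[of n 1] descs_root[of n] dep_pos[of n] by simp

end

lemma dfs_tree_dep_eqI:
  assumes "dfs_tree n T" "dfs_tree n T'" "\<And>x. 1 \<le> x \<Longrightarrow> x \<le> n \<Longrightarrow> dep T x = dep T' x"
  shows "T = T'"
proof -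
  interpret A: dfs_tree n T by fact
  interpret B: dfs_tree n T' by fact
  have "(p, x) \<in> T \<longleftrightarrow> (p, x) \<in> T'" for p x
  proof (cases "1 \<le> p \<and> p < x \<and> x \<le> n")
    case True
    then have "dep T p = dep T' p" "dep T x = dep T' x"
      "\<And>y. p < y \<and> y < x \<Longrightarrow> dep T y = dep T' y" using assms(3) by auto
    then show ?thesis unfolding A.edge_iff B.edge_iff by simp
  qed (auto dest: A.edgeD B.edgeD)
  then show ?thesis by auto
qed

lemma subtree_eq_sym: "subtree_eq T T' x \<longleftrightarrow> subtree_eq T' T x"
  by (auto simp: subtree_eq_def)

text \<open>\<open>subtree_eq\<close> compares only edges inside the set of descendants. In the
  second part \<open>z\<close> is arbitrary, because an edge of either tree that starts at a
  descendant also ends at one.\<close>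

lemma subtree_eqD:
  assumes "subtree_eq T T' x"
  shows "descs T x = descs T' x"
    and "y \<in> descs T x \<Longrightarrow> (y, z) \<in> T \<longleftrightarrow> (y, z) \<in> T'"
proof -
  show *: "descs T x = descs T' x" using assms by (simp add: subtree_eq_def)
  assume y: "y \<in> descs T x"
  have "z \<in> descs T x" if "(y, z) \<in> T \<or> (y, z) \<in> T'"
  proof -
    have "(x, y) \<in> T\<^sup>*" "(x, y) \<in> T'\<^sup>*" using y * unfolding descs_def by auto
    then have "z \<in> descs T x \<or> z \<in> descs T' x"
      using that unfolding descs_def by (blast intro: rtrancl_into_rtrancl)
    then show ?thesis using * by simp
  qed
  moreover have "(y, z) \<in> Restr T (descs T x) \<longleftrightarrow> (y, z) \<in> Restr T' (descs T x)"
    using assms unfolding subtree_eq_def by auto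
  ultimately show "(y, z) \<in> T \<longleftrightarrow> (y, z) \<in> T'" using y by blast
qed

lemma relpow_subtree_eq:
  assumes "subtree_eq T T' x"
  shows "(x, y) \<in> T ^^ k \<longleftrightarrow> (x, y) \<in> T' ^^ k"
proof (induction k arbitrary: y)
  case (Suc k)
  have "(z, y) \<in> T \<longleftrightarrow> (z, y) \<in> T'" if "(x, z) \<in> T ^^ k" for z
    using subtree_eqD(2)[OF assms, of z y] that by (simp add: descs_def relpow_imp_rtrancl)
  then show ?case using Suc by auto
qed auto

lemma height_subtree_eq: "subtree_eq T T' x \<Longrightarrow> height T x = height T' x"
  unfolding height_def by (simp add: relpow_subtree_eq)

section \<open>Edge sets of bracketings\<close>

lemma tedges_leaves: "(p, x) \<in> tedges t \<Longrightarrow> p \<in> set (leaves t) \<and> x \<in> set (leaves t)"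
proof (induction t)
  case (App a b)
  have "lmv s \<in> set (leaves s)" for s by (induction s) auto
  then show ?case using App by auto
qed auto

lemma lmv_leaves: "lmv t = hd (leaves t)"
proof -
  have "leaves t \<noteq> [] \<and> lmv t = hd (leaves t)" by (induction t) auto
  then show ?thesis by simp
qed

lemma leaves_nonempty [simp]: "leaves t \<noteq> []"
  by (induction t) auto

lemma leaves_App_upt:
  assumes "leaves (App s u) = [a..<b]"
  obtains c where "a < c" "c < b" "leaves s = [a..<c]" "leaves u = [c..<b]"
proof -
  have len: "length (leaves s) + length (leaves u) = b - a"
    using arg_cong[OF assms, of length] by simp
  have pos: "0 < length (leaves s)" "0 < length (leaves u)" by auto
  let ?c = "a + length (leaves s)"
  have c: "a < ?c" "?c < b" using len pos by linarith+
  have "leaves s = take (length (leaves s)) [a..<b]"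
    using assms by (metis append_eq_conv_conj leaves.simps(2))
  then have s: "leaves s = [a..<?c]" using c by simp
  have "leaves u = drop (length (leaves s)) [a..<b]"
    using assms by (metis append_eq_conv_conj leaves.simps(2))
  then have "leaves u = [?c..<b]" by simp
  then show ?thesis using that[of ?c] s c by auto
qed

text \<open>The axioms of \<open>dfs_tree\<close> for an arbitrary interval of leaves, as the right
  factor of a product does not start at 1. The two factors occupy adjacent intervals, and the only
  edge between them joins their first leaves.\<close>

lemma tedges_dfs:
  assumes "leaves t = [a..<b]"
  shows "(\<forall>p x. (p, x) \<in> tedges t \<longrightarrow> a \<le> p \<and> p < x \<and> x < b) \<and>
    (\<forall>x. a < x \<and> x < b \<longrightarrow> (\<exists>!p. (p, x) \<in> tedges t)) \<and>
    (\<forall>p x q y. (p, x) \<in> tedges t \<longrightarrow> (q, y) \<in> tedges t \<longrightarrow> p < y \<longrightarrow> y < x \<longrightarrow> p \<le> q)"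
  using assms
proof (induction t arbitrary: a b)
  case (Var i)
  then have "b = Suc a" by (cases "a < b") (auto simp: upt_rec split: if_splits)
  then show ?case by auto
next
  case (App s u)
  obtain c where c: "a < c" "c < b" "leaves s = [a..<c]" "leaves u = [c..<b]"
    using leaves_App_upt[OF App.prems] by blast
  have lmv: "lmv s = a" "lmv u = c" using c by (auto simp: lmv_leaves)
  note IHs = App.IH(1)[OF c(3)] and IHu = App.IH(2)[OF c(4)]
  have s1: "a \<le> p \<and> p < x \<and> x < c" if "(p, x) \<in> tedges s" for p x using IHs that by blast
  have u1: "c \<le> p \<and> p < x \<and> x < b" if "(p, x) \<in> tedges u" for p x using IHu that by blast
  have E: "(p, x) \<in> tedges (App s u) \<longleftrightarrow>
      (p, x) \<in> tedges s \<or> (p, x) \<in> tedges u \<or> (p = a \<and> x = c)" for p x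
    using lmv by auto
  have 1: "a \<le> p \<and> p < x \<and> x < b" if "(p, x) \<in> tedges (App s u)" for p x
    using that c s1[of p x] u1[of p x] unfolding E by auto
  have 2: "\<exists>!p. (p, x) \<in> tedges (App s u)" if x: "a < x" "x < b" for x
  proof -
    consider "x < c" | "x = c" | "c < x" by linarith
    then show ?thesis
    proof cases
      case 1
      then have "(p, x) \<in> tedges (App s u) \<longleftrightarrow> (p, x) \<in> tedges s" for p
        unfolding E using u1[of p x] by auto
      then show ?thesis using IHs x 1 by auto
    next
      case 2
      then have "(p, x) \<in> tedges (App s u) \<longleftrightarrow> p = a" for p
        unfolding E using u1[of p x] s1[of p x] by auto
      then show ?thesis by auto
    next
      case 3
      then have "(p, x) \<in> tedges (App s u) \<longleftrightarrow> (p, x) \<in> tedges u" for p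
        unfolding E using s1[of p x] by auto
      then show ?thesis using IHu x 3 by auto
    qed
  qed
  have 3: "p \<le> q"
    if "(p, x) \<in> tedges (App s u)" "(q, y) \<in> tedges (App s u)" "p < y" "y < x" for p x q y
  proof -
    have I: "p \<le> q" if "(p, x) \<in> tedges s" "(q, y) \<in> tedges s" using IHs that \<open>p < y\<close> \<open>y < x\<close> by blast
    have J: "p \<le> q" if "(p, x) \<in> tedges u" "(q, y) \<in> tedges u" using IHu that \<open>p < y\<close> \<open>y < x\<close> by blast
    show ?thesis
      using that I J s1[of p x] s1[of q y] u1[of p x] u1[of q y] c(1) unfolding E by fastforce
  qed
  show ?case using 1 2 3 by blast
qed

lemma bracketing_dfs_tree:
  assumes "t \<in> bracketings n"
  shows "dfs_tree n (tedges t)"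
proof -
  have "leaves t = [1..<Suc n]" using assms by (simp add: bracketings_def)
  note * = tedges_dfs[OF this]
  show ?thesis
  proof
    show "1 \<le> p \<and> p < x \<and> x \<le> n" if "(p, x) \<in> tedges t" for p x
      using * that by (simp add: less_Suc_eq_le)
    show "\<exists>p. (p, x) \<in> tedges t" if "1 < x" "x \<le> n" for x
      using * that by (metis less_Suc_eq_le)
    show "p = q" if "(p, x) \<in> tedges t" "(q, x) \<in> tedges t" for p q x
    proof -
      have "1 < x" "x < Suc n" using * that(1) by fastforce+
      then show ?thesis using * that by blast
    qed
    show "p \<le> q" if "(p, x) \<in> tedges t" "(q, y) \<in> tedges t" "p < y" "y < x" for p q x y
      using * that by blast
  qed
qed

text \<open>The split point of the outermost product can be recovered as the largest child of the
  first variable; the position relative to it tells to which factor an edge belongs.\<close>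

lemma tedges_inj:
  assumes "leaves t = [a..<b]" "leaves t' = [a..<b]" "tedges t = tedges t'"
  shows "t = t'"
  using assms
proof (induction t arbitrary: t' a b)
  case prems: (Var i)
  show ?case
  proof (cases t')
    case (Var j)
    have "[i] = [j]" using prems Var by (metis leaves.simps(1))
    then show ?thesis using Var by simp
  next
    case (App s u)
    have "length (leaves s) + length (leaves u) = 1"
      using App prems by (metis One_nat_def leaves.simps length_append length_Cons list.size(3))
    moreover have "0 < length (leaves s)" "0 < length (leaves u)" by auto
    ultimately show ?thesis by linarith
  qed
next
  case (App s u)
  obtain c where c: "a < c" "c < b" "leaves s = [a..<c]" "leaves u = [c..<b]"
    using leaves_App_upt[OF App.prems(1)] by blast
  show ?case
  proof (cases t')
    case (Var i)
    then show ?thesis using App.prems(3) by auto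
  next
    case t': (App s' u')
    obtain c' where c': "a < c'" "c' < b" "leaves s' = [a..<c']" "leaves u' = [c'..<b]"
      using leaves_App_upt[of s' u' a b] App.prems(2) t' by blast
    have lmv: "lmv s = a" "lmv u = c" "lmv s' = a" "lmv u' = c'" using c c' by (auto simp: lmv_leaves)
    have R: "a \<le> p \<and> p < x \<and> x < c" if "(p, x) \<in> tedges s" for p x using tedges_dfs[OF c(3)] that by blast
    have R': "a \<le> p \<and> p < x \<and> x < c'" if "(p, x) \<in> tedges s'" for p x using tedges_dfs[OF c'(3)] that by blast
    have U: "c \<le> p \<and> p < x \<and> x < b" if "(p, x) \<in> tedges u" for p x using tedges_dfs[OF c(4)] that by blast
    have U': "c' \<le> p \<and> p < x \<and> x < b" if "(p, x) \<in> tedges u'" for p x using tedges_dfs[OF c'(4)] that by blast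
    have eq: "tedges s \<union> tedges u \<union> {(a, c)} = tedges s' \<union> tedges u' \<union> {(a, c')}"
      using App.prems(3) t' lmv by simp
    have "(a, c) \<in> tedges s' \<union> tedges u' \<union> {(a, c')}" using eq by blast
    then have "c \<le> c'" using R'[of a c] U'[of a c] c' by force
    moreover have "(a, c') \<in> tedges s \<union> tedges u \<union> {(a, c)}" using eq by blast
    then have "c' \<le> c" using R[of a c'] U[of a c'] c by force
    ultimately have cc: "c' = c" by simp
    have S: "(p, x) \<in> tedges s \<longleftrightarrow> (p, x) \<in> tedges s'" for p x
    proof -
      have "(p, x) \<in> tedges s \<longleftrightarrow> (p, x) \<in> tedges s \<union> tedges u \<union> {(a, c)} \<and> x < c"
        using R[of p x] U[of p x] by (simp, linarith)
      moreover have "(p, x) \<in> tedges s' \<longleftrightarrow> (p, x) \<in> tedges s' \<union> tedges u' \<union> {(a, c')} \<and> x < c"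
        using R'[of p x] U'[of p x] cc by (simp, linarith)
      ultimately show ?thesis unfolding eq by blast
    qed
    then have "tedges s = tedges s'" by (intro subset_antisym subrelI) (simp_all only:)
    moreover have "(p, x) \<in> tedges u \<longleftrightarrow> (p, x) \<in> tedges u'" for p x
    proof -
      have "(p, x) \<in> tedges u \<longleftrightarrow> (p, x) \<in> tedges s \<union> tedges u \<union> {(a, c)} \<and> c \<le> p"
        using R[of p x] U[of p x] c by (simp, linarith)
      moreover have "(p, x) \<in> tedges u' \<longleftrightarrow> (p, x) \<in> tedges s' \<union> tedges u' \<union> {(a, c')} \<and> c \<le> p"
        using R'[of p x] U'[of p x] cc c by (simp, linarith)
      ultimately show ?thesis unfolding eq by blast
    qed
    then have "tedges u = tedges u'" by (intro subset_antisym subrelI) (simp_all only:)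
    ultimately have "s = s'" "u = u'" using App.IH c c' cc by blast+
    then show ?thesis using t' by simp
  qed
qed

section \<open>Walks, whirls and tree homomorphisms\<close>

definition hom :: "('v \<times> 'v) set \<Rightarrow> (nat \<times> nat) set \<Rightarrow> (nat \<Rightarrow> 'v) \<Rightarrow> bool" where
  "hom E T \<phi> \<longleftrightarrow> (\<forall>(p, x)\<in>T. (\<phi> p, \<phi> x) \<in> E)"

definition walkf :: "('v \<times> 'v) set \<Rightarrow> nat \<Rightarrow> (nat \<Rightarrow> 'v) \<Rightarrow> bool" where
  "walkf E k v \<longleftrightarrow> (\<forall>i<k. (v i, v (Suc i)) \<in> E)"

text \<open>Recurrent vertices: these are exactly the vertices of nontrivial components, see
  \<open>trivial_iff\<close>.\<close>

abbreviation cyc :: "('v \<times> 'v) set \<Rightarrow> 'v \<Rightarrow> bool" where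
  "cyc E v \<equiv> (v, v) \<in> E\<^sup>+"

definition cls :: "('v \<times> 'v) set \<Rightarrow> 'v \<Rightarrow> 'v set" where
  "cls E u = {v. (u, v) \<in> E\<^sup>* \<and> (v, u) \<in> E\<^sup>*}"

text \<open>Distinctness is implied: a repeated vertex is recurrent, but only the last position may
  be. The same holds for \<open>outlet_walk\<close> with its first position.\<close>

definition entry_walk :: "('v \<times> 'v) set \<Rightarrow> nat \<Rightarrow> (nat \<Rightarrow> 'v) \<Rightarrow> bool" where
  "entry_walk E k v \<longleftrightarrow> walkf E k v \<and> (\<forall>i<k. \<not> cyc E (v i)) \<and> cyc E (v k)"

definition outlet_walk :: "('v \<times> 'v) set \<Rightarrow> nat \<Rightarrow> (nat \<Rightarrow> 'v) \<Rightarrow> bool" where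
  "outlet_walk E k v \<longleftrightarrow> walkf E k v \<and> cyc E (v 0) \<and> (\<forall>i. 0 < i \<and> i \<le> k \<longrightarrow> \<not> cyc E (v i))"

text \<open>A block structure of a whirl, encoded by residues modulo \<open>m\<close>: the block \<open>B\<^sub>i\<close> consists
  of the vertices whose colour is congruent to \<open>i\<close>.\<close>
definition whirl_coloring :: "('v \<times> 'v) set \<Rightarrow> 'v set \<Rightarrow> nat \<Rightarrow> ('v \<Rightarrow> int) \<Rightarrow> bool" where
  "whirl_coloring E K m c \<longleftrightarrow> 1 \<le> m \<and>
     (\<forall>a\<in>K. \<forall>b\<in>K. (a, b) \<in> E \<longleftrightarrow> int m dvd c b - c a - 1) \<and>
     (\<forall>i. \<exists>a\<in>K. int m dvd c a - i)"

lemma walkf_rtrancl: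
  assumes "walkf E k v" "i \<le> j" "j \<le> k"
  shows "(v i, v j) \<in> E\<^sup>*"
  using assms(2,3)
proof (induction j rule: dec_induct)
  case (step j)
  then show ?case using assms(1) unfolding walkf_def by (meson Suc_le_eq Suc_leD rtrancl.simps)
qed auto

lemma walkf_trancl:
  assumes "walkf E k v" "i < j" "j \<le> k"
  shows "(v i, v j) \<in> E\<^sup>+"
proof -
  have "(v i, v (Suc i)) \<in> E" using assms unfolding walkf_def by auto
  moreover have "(v (Suc i), v j) \<in> E\<^sup>*" using walkf_rtrancl[OF assms(1), of "Suc i" j] assms by auto
  ultimately show ?thesis by auto
qed

lemma cyc_cls: "cyc E u \<Longrightarrow> v \<in> cls E u \<Longrightarrow> cyc E v"
  unfolding cls_def mem_Collect_eq by (meson rtrancl_trancl_trancl trancl_rtrancl_trancl)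

lemma self_cls [simp]: "u \<in> cls E u"
  by (simp add: cls_def)

lemma cycI: "(a, b) \<in> E \<Longrightarrow> (b, a) \<in> E\<^sup>* \<Longrightarrow> cyc E a" "(a, b) \<in> E \<Longrightarrow> (b, a) \<in> E\<^sup>* \<Longrightarrow> cyc E b"
  by auto

lemma cyc_predecessor:
  assumes "cyc E u"
  shows "\<exists>w\<in>cls E u. (w, u) \<in> E"
proof -
  obtain w where "(u, w) \<in> E\<^sup>*" "(w, u) \<in> E" using tranclD2[OF assms] by blast
  then show ?thesis unfolding cls_def by blast
qed

lemma infinite_walk:
  assumes "\<And>x. P x \<Longrightarrow> \<exists>y. P y \<and> (x, y) \<in> E" "P a"
  obtains f :: "nat \<Rightarrow> 'v" where "f 0 = a" "\<And>i. P (f i)" "\<And>i. (f i, f (Suc i)) \<in> E"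
proof -
  have "\<exists>f. f 0 = a \<and> (\<forall>i. P (f i) \<and> (f i, f (Suc i)) \<in> E)"
    using dependent_nat_choice[of "\<lambda>n x. P x \<and> (n = 0 \<longrightarrow> x = a)" "\<lambda>_ x y. (x, y) \<in> E"] assms by auto
  then show ?thesis using that by blast
qed

lemma rtrancl_cyc_step:
  assumes "cyc E v" "(x, v) \<in> E\<^sup>*"
  shows "\<exists>y. (y, v) \<in> E\<^sup>* \<and> (x, y) \<in> E"
  using assms by (meson rtrancl_trancl_trancl tranclD)

text \<open>Every vertex of a nontrivial class has a successor in the class, so a walk that has
  reached the class can be prolonged to whatever length a tree demands.\<close>

lemma cyc_forward_walk:
  assumes "cyc E v" "a \<in> cls E v"
  obtains f where "f 0 = a" "\<And>i. f i \<in> cls E v" "\<And>i. (f i, f (Suc i)) \<in> E"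
proof -
  have "\<exists>y. y \<in> cls E v \<and> (x, y) \<in> E" if "x \<in> cls E v" for x
    using rtrancl_cyc_step[OF assms(1), of x] that unfolding cls_def
    by (auto intro: rtrancl_into_rtrancl)
  then show ?thesis using infinite_walk[of "\<lambda>x. x \<in> cls E v" E a] assms(2) that by blast
qed

lemma first_cyc:
  assumes "(a, s) \<in> E\<^sup>*" "cyc E s"
  shows "\<exists>k v. entry_walk E k v \<and> v 0 = a"
  using assms(1)
proof (induction rule: converse_rtrancl_induct)
  case base
  show ?case using assms(2) by (intro exI[of _ 0] exI[of _ "\<lambda>_. s"]) (auto simp: entry_walk_def walkf_def)
next
  case (step y z)
  then obtain k v where v: "entry_walk E k v" "v 0 = z" by blast
  show ?case
  proof (cases "cyc E y")
    case True
    then show ?thesis by (intro exI[of _ 0] exI[of _ "\<lambda>_. y"]) (auto simp: entry_walk_def walkf_def)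
  next
    case False
    then have "entry_walk E (Suc k) (case_nat y v)"
      using v step(1) unfolding entry_walk_def walkf_def
      by (auto split: nat.splits simp: less_Suc_eq_0_disj)
    then show ?thesis by (intro exI[of _ "Suc k"] exI[of _ "case_nat y v"]) auto
  qed
qed

lemma walkf_append:
  assumes "walkf E j v" "walkf E k w" "v j = w 0"
  shows "walkf E (j + k) (\<lambda>i. if i \<le> j then v i else w (i - j))"
  unfolding walkf_def
proof (intro allI impI)
  fix i assume i: "i < j + k"
  show "((if i \<le> j then v i else w (i - j)), (if Suc i \<le> j then v (Suc i) else w (Suc i - j))) \<in> E"
  proof -
    consider "i < j" | "i = j" | "j < i" by linarith
    then show ?thesis
    proof cases
      case 1
      then show ?thesis using assms unfolding walkf_def by simp
    next
      case 2
      then show ?thesis using assms i unfolding walkf_def by simp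
    next
      case 3
      then have "(w (i - j), w (Suc (i - j))) \<in> E" using assms i unfolding walkf_def by auto
      then show ?thesis using 3 by (simp add: Suc_diff_le)
    qed
  qed
qed

text \<open>\<open>first_cyc\<close> stops the continuation at its first recurrent vertex, and the
  added part is nonempty because \<open>v j\<close> is not recurrent. With \<open>j = L + 1\<close>
  the result contradicts (v).\<close>

lemma entry_walk_extend:
  assumes "walkf E j v" "\<forall>i\<le>j. \<not> cyc E (v i)" "(v j, s) \<in> E\<^sup>*" "cyc E s"
  shows "\<exists>k w. j < k \<and> entry_walk E k w"
proof -
  obtain k w where w: "entry_walk E k w" "w 0 = v j" using first_cyc[OF assms(3,4)] by blast
  have "k \<noteq> 0" using w assms(2) unfolding entry_walk_def by (cases k) auto
  let ?u = "\<lambda>i. if i \<le> j then v i else w (i - j)"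
  have "entry_walk E (j + k) ?u"
    using walkf_append[OF assms(1), of k w] w assms(2) \<open>k \<noteq> 0\<close> unfolding entry_walk_def by auto
  then show ?thesis using \<open>k \<noteq> 0\<close> by (intro exI[of _ "j + k"]) auto
qed

context dfs_tree
begin

lemma hom_relpow_walk:
  assumes "(x, y) \<in> T ^^ k" "\<And>p z. p \<in> descs T x \<Longrightarrow> (p, z) \<in> T \<Longrightarrow> (\<phi> p, \<phi> z) \<in> E"
  shows "\<exists>v. v 0 = \<phi> x \<and> v k = \<phi> y \<and> walkf E k v \<and> (\<forall>i\<le>k. v i \<in> \<phi> ` descs T x)"
  using assms(1)
proof (induction k arbitrary: y)
  case 0
  then show ?case by (intro exI[of _ "\<lambda>_. \<phi> x"]) (auto simp: walkf_def)
next
  case (Suc k)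
  then obtain z where z: "(x, z) \<in> T ^^ k" "(z, y) \<in> T" by auto
  then obtain v where v: "v 0 = \<phi> x" "v k = \<phi> z" "walkf E k v" "\<forall>i\<le>k. v i \<in> \<phi> ` descs T x"
    using Suc.IH by blast
  have zd: "z \<in> descs T x" using z by (simp add: descs_def relpow_imp_rtrancl)
  then have "(\<phi> z, \<phi> y) \<in> E" "y \<in> descs T x" using assms(2) z descs_edge by blast+
  then show ?case using v
    by (intro exI[of _ "v(Suc k := \<phi> y)"]) (auto simp: walkf_def less_Suc_eq le_Suc_eq)
qed

lemma hom_height_walk:
  assumes "1 \<le> x" "x \<le> n" "\<And>p z. p \<in> descs T x \<Longrightarrow> (p, z) \<in> T \<Longrightarrow> (\<phi> p, \<phi> z) \<in> E"
  shows "\<exists>v. v 0 = \<phi> x \<and> walkf E (height T x) v \<and> (\<forall>i\<le>height T x. v i \<in> \<phi> ` descs T x)"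
proof -
  obtain y where "(x, y) \<in> T ^^ height T x" using height_attained[OF assms(1,2)] by blast
  from hom_relpow_walk[OF this, of \<phi> E] assms(3) show ?thesis by blast
qed

end

section \<open>Two trees and the depth up to which they agree\<close>

locale tree_pair = A: dfs_tree n T + B: dfs_tree n T' for n T T' +
  fixes L :: nat
  assumes agree: "1 \<le> x \<Longrightarrow> x \<le> n \<Longrightarrow> dep T x \<le> L \<or> dep T' x \<le> L \<Longrightarrow> dep T x = dep T' x"
    and differ: "\<exists>x. 1 \<le> x \<and> x \<le> n \<and> dep T x \<noteq> dep T' x \<and> (dep T x = Suc L \<or> dep T' x = Suc L)"

lemma tree_pair_sym: "tree_pair n T T' L \<Longrightarrow> tree_pair n T' T L"
proof -
  assume "tree_pair n T T' L"
  then interpret tree_pair n T T' L .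
  show ?thesis
  proof
    show "dep T' x = dep T x" if "1 \<le> x" "x \<le> n" "dep T' x \<le> L \<or> dep T x \<le> L" for x
      using agree[of x] that by auto
    show "\<exists>x. 1 \<le> x \<and> x \<le> n \<and> dep T' x \<noteq> dep T x \<and> (dep T' x = Suc L \<or> dep T x = Suc L)"
      using differ by metis
  qed
qed

context tree_pair
begin

lemma deep_iff: "1 \<le> x \<Longrightarrow> x \<le> n \<Longrightarrow> L < dep T x \<longleftrightarrow> L < dep T' x"
  using agree[of x] by linarith

lemma shallow_edge:
  assumes "(p, x) \<in> T" "dep T x \<le> L"
  shows "(p, x) \<in> T'"
proof -
  have x: "1 \<le> p" "p < x" "x \<le> n" using A.edgeD[OF assms(1)] by auto
  have dx: "dep T' x = dep T x" using agree[of x] assms x by auto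
  have dp: "dep T' p = dep T p" using agree[of p] assms x A.dep_edge[OF assms(1)] by auto
  have "dep T' x \<le> dep T' y" if "p < y" "y < x" for y
  proof (rule ccontr)
    assume *: "\<not> ?thesis"
    then have "dep T y = dep T' y" using agree[of y] that x dx assms by auto
    then show False using A.dep_between[OF assms(1) that] * dx by auto
  qed
  then show ?thesis unfolding B.edge_iff using x dx dp A.dep_edge[OF assms(1)] by auto
qed

text \<open>One level below the range of agreement: the vertices numbered between \<open>p\<close>
  and \<open>x\<close> are deeper than \<open>L\<close> in \<open>T\<close>, hence in
  \<open>T'\<close>, and \<open>edge_iff\<close> asks for nothing more.\<close>

lemma same_parent:
  assumes "(p, x) \<in> T" "dep T x = Suc L" "dep T' x = Suc L"
  shows "(p, x) \<in> T'"
proof -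
  have x: "1 \<le> p" "p < x" "x \<le> n" using A.edgeD[OF assms(1)] by auto
  have dp: "dep T' p = dep T p" using agree[of p] assms x A.dep_edge[OF assms(1)] by auto
  have "dep T' x \<le> dep T' y" if "p < y" "y < x" for y
    using A.dep_between[OF assms(1) that] deep_iff[of y] that x assms by auto
  then show ?thesis unfolding B.edge_iff using x dp assms A.dep_edge[OF assms(1)] by auto
qed

text \<open>By \<open>descs_iff\<close> membership only depends on which vertices are deeper than
  \<open>x\<close>, and for a threshold of at most \<open>L\<close> both trees give the same
  answer.\<close>

lemma shallow_descs:
  assumes "1 \<le> x" "x \<le> n" "dep T x \<le> L"
  shows "descs T x = descs T' x"
proof -
  have dx: "dep T' x = dep T x" using agree[of x] assms by auto
  have "y \<in> descs T x \<longleftrightarrow> y \<in> descs T' x" if "1 \<le> y" "y \<le> n" for y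
  proof -
    have "dep T x < dep T z \<longleftrightarrow> dep T' x < dep T' z" if "x < z" "z \<le> y" for z
    proof -
      have "dep T z \<le> L \<or> dep T' z \<le> L \<Longrightarrow> dep T z = dep T' z"
        using agree[of z] that \<open>y \<le> n\<close> assms(1) by simp
      then show ?thesis using assms(3) unfolding dx by linarith
    qed
    then show ?thesis using A.descs_iff[of x y] B.descs_iff[of x y] assms that by auto
  qed
  then show ?thesis using A.descs_range B.descs_range assms by blast
qed

lemma different_parents_deep:
  assumes "(p, x) \<in> T" "(p', x) \<in> T'" "p \<noteq> p'"
  shows "L < dep T x" "L < dep T' x"
proof -
  show *: "L < dep T x"
    using shallow_edge[OF assms(1)] assms B.parent_unique[OF assms(2)] by (metis not_less)
  show "L < dep T' x" using * deep_iff[of x] A.edgeD[OF assms(1)] by auto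
qed

end

text \<open>The conditions (i)--(x) for walks given as functions, with \<open>L\<close> in the role of
  \<open>L\<^sub>t\<^sub>,\<^sub>t\<^sub>'\<close>. Condition (viii), \<open>cond_B\<close>, is kept out of \<open>conds\<close>: it follows from (ii), (v) and (x).\<close>
definition cond_whirl :: "('v \<times> 'v) set \<Rightarrow> bool" where
  "cond_whirl E \<longleftrightarrow> (\<forall>u. cyc E u \<longrightarrow> (\<exists>m c. whirl_coloring E (cls E u) m c))"

definition cond_sep :: "('v \<times> 'v) set \<Rightarrow> bool" where
  "cond_sep E \<longleftrightarrow> (\<forall>u v. cyc E u \<longrightarrow> cyc E v \<longrightarrow> (u, v) \<in> E\<^sup>* \<longrightarrow> (v, u) \<in> E\<^sup>*)"

definition cond_M :: "('v \<times> 'v) set \<Rightarrow> nat \<Rightarrow> (nat \<times> nat) set \<Rightarrow> (nat \<times> nat) set \<Rightarrow> bool" where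
  "cond_M E n T T' \<longleftrightarrow> (\<forall>u m c x. cyc E u \<longrightarrow> whirl_coloring E (cls E u) m c \<longrightarrow> 1 \<le> x \<longrightarrow> x \<le> n \<longrightarrow>
     int m dvd int (dep T x) - int (dep T' x))"

definition cond_P :: "('v \<times> 'v) set \<Rightarrow> (nat \<times> nat) set \<Rightarrow> (nat \<times> nat) set \<Rightarrow> bool" where
  "cond_P E T T' \<longleftrightarrow> (\<forall>k v. walkf E k v \<longrightarrow> (\<forall>i\<le>k. \<not> cyc E (v i)) \<longrightarrow> k < height T 1 \<and> k < height T' 1)"

definition cond_E :: "('v \<times> 'v) set \<Rightarrow> nat \<Rightarrow> bool" where
  "cond_E E L \<longleftrightarrow> (\<forall>k v. entry_walk E k v \<longrightarrow> k \<le> Suc L)"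

definition cond_O :: "('v \<times> 'v) set \<Rightarrow> nat \<Rightarrow> (nat \<times> nat) set \<Rightarrow> (nat \<times> nat) set \<Rightarrow> bool" where
  "cond_O E n T T' \<longleftrightarrow> (\<forall>k v x. outlet_walk E k v \<longrightarrow> 1 \<le> x \<longrightarrow> x \<le> n \<longrightarrow>
     height T x < k \<or> height T' x < k \<longrightarrow> subtree_eq T T' x)"

definition cond_Z :: "('v \<times> 'v) set \<Rightarrow> (nat \<times> nat) set \<Rightarrow> (nat \<times> nat) set \<Rightarrow> bool" where
  "cond_Z E T T' \<longleftrightarrow> (\<forall>u m c a b k v x p p'. cyc E u \<longrightarrow> whirl_coloring E (cls E u) m c \<longrightarrow>
     a \<in> cls E u \<longrightarrow> b \<in> cls E u \<longrightarrow> int m dvd c a - c b \<longrightarrow> (a, v 0) \<in> E \<longrightarrow> walkf E k v \<longrightarrow> (b, v 0) \<notin> E \<longrightarrow>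
     subtree_eq T T' x \<longrightarrow> (p, x) \<in> T \<longrightarrow> (p', x) \<in> T' \<longrightarrow> p \<noteq> p' \<longrightarrow> k < height T x)"

definition cond_B :: "('v \<times> 'v) set \<Rightarrow> nat \<Rightarrow> bool" where
  "cond_B E L \<longleftrightarrow> (\<forall>m v a b. walkf E m v \<longrightarrow> (v m, a) \<in> E \<longrightarrow> (v m, b) \<in> E \<longrightarrow> cyc E a \<longrightarrow> cyc E b \<longrightarrow>
     (a, b) \<notin> E\<^sup>* \<or> (b, a) \<notin> E\<^sup>* \<longrightarrow> m < L)"

definition cond_omega :: "('v \<times> 'v) set \<Rightarrow> nat \<Rightarrow> (nat \<times> nat) set \<Rightarrow> (nat \<times> nat) set \<Rightarrow> nat \<Rightarrow> bool" where
  "cond_omega E n T T' L \<longleftrightarrow> (\<forall>r m v v' x. 1 \<le> r \<longrightarrow> r \<le> Suc L \<longrightarrow> walkf E (Suc L) v \<longrightarrow> cyc E (v (Suc L)) \<longrightarrow>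
     Suc L \<le> m \<longrightarrow> v' (r - 1) = v (r - 1) \<longrightarrow> (\<forall>i. r - 1 \<le> i \<and> i < m \<longrightarrow> (v' i, v' (Suc i)) \<in> E) \<longrightarrow>
     \<not> cyc E (v' (Suc L)) \<longrightarrow> 1 \<le> x \<longrightarrow> x \<le> n \<longrightarrow> \<not> subtree_eq T T' x \<longrightarrow>
     (dep T x \<le> r \<longrightarrow> m < dep T x + height T x) \<and> (dep T' x \<le> r \<longrightarrow> m < dep T' x + height T' x))"

definition cond_lambda :: "('v \<times> 'v) set \<Rightarrow> nat \<Rightarrow> (nat \<times> nat) set \<Rightarrow> (nat \<times> nat) set \<Rightarrow> nat \<Rightarrow> bool" where
  "cond_lambda E n T T' L \<longleftrightarrow> (\<forall>u w k v x. entry_walk E (Suc L) u \<longrightarrow> w \<in> cls E (u (Suc L)) \<longrightarrow>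
     (w, u (Suc L)) \<in> E \<longrightarrow> walkf E k v \<longrightarrow> ((w, v 0) \<in> E) \<noteq> ((u L, v 0) \<in> E) \<longrightarrow> 1 \<le> x \<longrightarrow> x \<le> n \<longrightarrow>
     dep T x \<noteq> dep T' x \<longrightarrow> dep T x = Suc L \<or> dep T' x = Suc L \<longrightarrow> k < max (height T x) (height T' x))"

lemma cond_lambdaD:
  assumes "cond_lambda E n T T' L" "entry_walk E (Suc L) u" "w \<in> cls E (u (Suc L))" "(w, u (Suc L)) \<in> E"
    "walkf E k v" "((w, v 0) \<in> E) \<noteq> ((u L, v 0) \<in> E)" "1 \<le> x" "x \<le> n" "dep T x \<noteq> dep T' x"
    "dep T x = Suc L \<or> dep T' x = Suc L"
  shows "k < max (height T x) (height T' x)"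
  using assms unfolding cond_lambda_def by blast

definition conds :: "('v \<times> 'v) set \<Rightarrow> nat \<Rightarrow> (nat \<times> nat) set \<Rightarrow> (nat \<times> nat) set \<Rightarrow> nat \<Rightarrow> bool" where
  "conds E n T T' L \<longleftrightarrow> cond_whirl E \<and> cond_sep E \<and> cond_M E n T T' \<and> cond_P E T T' \<and> cond_E E L \<and>
     cond_O E n T T' \<and> cond_Z E T T' \<and> cond_omega E n T T' L \<and> cond_lambda E n T T' L"

text \<open>\<open>cond_Z\<close> mentions only the height in \<open>T\<close>; for a shared subtree
  it equals the height in \<open>T'\<close>.\<close>

lemma conds_sym: "conds E n T T' L \<Longrightarrow> conds E n T' T L"
proof -
  assume c: "conds E n T T' L"
  have "cond_M E n T' T" using c unfolding conds_def cond_M_def by (metis dvd_diff_commute)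
  moreover have "cond_P E T' T" using c unfolding conds_def cond_P_def by blast
  moreover have "cond_O E n T' T" using c subtree_eq_sym unfolding conds_def cond_O_def by metis
  moreover have "cond_Z E T' T"
    using c subtree_eq_sym height_subtree_eq unfolding conds_def cond_Z_def by metis
  moreover have "cond_omega E n T' T L"
    using c subtree_eq_sym unfolding conds_def cond_omega_def by metis
  moreover have "cond_lambda E n T' T L"
    using c max.commute unfolding conds_def cond_lambda_def by metis
  ultimately show ?thesis using c unfolding conds_def by blast
qed

section \<open>Sufficiency\<close>

context dfs_tree
begin

lemma root_path:
  assumes "1 \<le> y" "y \<le> n"
  shows "\<exists>f. f 0 = 1 \<and> f (dep T y) = y \<and> (\<forall>i<dep T y. (f i, f (Suc i)) \<in> T) \<and>
    (\<forall>i\<le>dep T y. y \<in> descs T (f i) \<and> dep T (f i) = i \<and> 1 \<le> f i \<and> f i \<le> n)"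
  using assms
proof (induction y rule: less_induct)
  case (less y)
  show ?case
  proof (cases "y = 1")
    case True
    then show ?thesis using less.prems by (intro exI[of _ "\<lambda>_. 1"]) auto
  next
    case False
    then obtain p where p: "(p, y) \<in> T" using parent_ex[of y] less.prems by auto
    then obtain f where f: "f 0 = 1" "f (dep T p) = p" "\<forall>i<dep T p. (f i, f (Suc i)) \<in> T"
      "\<forall>i\<le>dep T p. p \<in> descs T (f i) \<and> dep T (f i) = i \<and> 1 \<le> f i \<and> f i \<le> n"
      using less.IH[of p] edgeD[OF p] by auto
    have d: "dep T y = Suc (dep T p)" using dep_edge[OF p] .
    let ?g = "f(dep T y := y)"
    have "\<forall>i<dep T y. (?g i, ?g (Suc i)) \<in> T" using f p unfolding d by (auto simp: less_Suc_eq)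
    moreover have "\<forall>i\<le>dep T y. y \<in> descs T (?g i) \<and> dep T (?g i) = i \<and> 1 \<le> ?g i \<and> ?g i \<le> n"
      using f(4) p descs_edge less.prems unfolding d by (auto simp: le_Suc_eq d)
    ultimately show ?thesis using f(1) d by (intro exI[of _ ?g]) auto
  qed
qed

lemma descs_same_dep:
  assumes "z \<in> descs T x" "z \<in> descs T y" "dep T x = dep T y" "1 \<le> x" "1 \<le> y" "z \<le> n"
  shows "x = y"
proof (rule ccontr)
  assume "x \<noteq> y"
  then show False
    using descs_linear[OF assms(1,2)] descs_linear[OF assms(2,1)] descs_dep_less[of x y]
      descs_dep_less[of y x] assms by (metis less_irrefl nat_le_linear)
qed

end

context tree_pair
begin

text \<open>Stated for a set \<open>D\<close> with top \<open>z\<close> instead of all descendants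
  of \<open>z\<close>, since the last case of \<open>hom_transfer\<close> discards some branches at
  \<open>z\<close>. For the same reason \<open>down\<close> exempts the children of
  \<open>z\<close>.\<close>

lemma transfer_below_cyc:
  assumes conds: "cond_whirl E" "cond_sep E" "cond_M E n T T'" "cond_O E n T T'" "cond_Z E T T'"
    and D: "z \<in> D" "1 \<le> z" "\<And>x. x \<in> D \<Longrightarrow> z \<le> x \<and> x \<le> n"
    and up: "\<And>p x. (p, x) \<in> T \<Longrightarrow> x \<in> D \<Longrightarrow> x \<noteq> z \<Longrightarrow> p \<in> D"
    and up': "\<And>p x. (p, x) \<in> T' \<Longrightarrow> x \<in> D \<Longrightarrow> x \<noteq> z \<Longrightarrow> p \<in> D"
    and down: "\<And>p x. (p, x) \<in> T \<Longrightarrow> p \<in> D \<Longrightarrow> p \<noteq> z \<Longrightarrow> x \<in> D"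
    and hom: "\<And>p x. (p, x) \<in> T \<Longrightarrow> x \<in> D \<Longrightarrow> x \<noteq> z \<Longrightarrow> (\<phi> p, \<phi> x) \<in> E"
    and z: "cyc E (\<phi> z)"
    and edge: "(p', x) \<in> T'" "x \<in> D" "x \<noteq> z"
  shows "(\<phi> p', \<phi> x) \<in> E"
proof -
  let ?K = "cls E (\<phi> z)"
  obtain m c where col: "whirl_coloring E ?K m c" using conds(1) z unfolding cond_whirl_def by blast
  have par: "\<exists>p. (p, y) \<in> T \<and> p \<in> D" if "y \<in> D" "y \<noteq> z" for y
    using A.parent_ex[of y] D(2) D(3)[OF that(1)] that up by force
  have reach: "(\<phi> z, \<phi> y) \<in> E\<^sup>*" if "y \<in> D" for y
    using that
  proof (induction y rule: less_induct)
    case (less y)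
    show ?case
    proof (cases "y = z")
      case False
      then obtain p where p: "(p, y) \<in> T" "p \<in> D" using par less.prems by blast
      then have "(\<phi> z, \<phi> p) \<in> E\<^sup>*" using less.IH[of p] A.edgeD by blast
      then show ?thesis using hom[OF p(1) less.prems False] by (rule rtrancl_into_rtrancl)
    qed simp
  qed
  \<comment> \<open>All images in \<open>D\<close> are reachable from \<open>\<phi> z\<close>, so by
    (ii) the recurrent ones lie in a single component.\<close>
  have inK: "\<phi> y \<in> ?K" if "y \<in> D" "cyc E (\<phi> y)" for y
    using reach[OF that(1)] conds(2) z that(2) unfolding cond_sep_def cls_def by blast
  have parK: "cyc E (\<phi> p)" if "(p, y) \<in> T" "y \<in> D" "y \<noteq> z" "cyc E (\<phi> y)" for p y
  proof -
    have "(\<phi> z, \<phi> p) \<in> E\<^sup>*" using reach up that by blast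
    moreover have "(\<phi> y, \<phi> z) \<in> E\<^sup>*" using inK that unfolding cls_def by blast
    ultimately show ?thesis using hom[OF that(1-3)] by (meson cycI(1) rtrancl_trans)
  qed
  \<comment> \<open>A recurrent image forces the images of all ancestors up to \<open>z\<close> into
    the component, so the colour advances with the depth along the whole path.\<close>
  have color: "int m dvd c (\<phi> y) - c (\<phi> z) - (int (dep T y) - int (dep T z))"
    if "y \<in> D" "cyc E (\<phi> y)" for y
    using that
  proof (induction y rule: less_induct)
    case (less y)
    show ?case
    proof (cases "y = z")
      case False
      then obtain p where p: "(p, y) \<in> T" "p \<in> D" using par less.prems by blast
      have cp: "cyc E (\<phi> p)" using parK p less.prems False by blast
      have "int m dvd c (\<phi> y) - c (\<phi> p) - 1"
        using col inK[OF p(2) cp] inK[OF less.prems] hom[OF p(1) less.prems(1) False]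
        unfolding whirl_coloring_def by blast
      moreover have "int m dvd c (\<phi> p) - c (\<phi> z) - (int (dep T p) - int (dep T z))"
        using less.IH[of p] A.edgeD[OF p(1)] p(2) cp by blast
      ultimately have "int m dvd (c (\<phi> y) - c (\<phi> p) - 1) +
          (c (\<phi> p) - c (\<phi> z) - (int (dep T p) - int (dep T z)))" by (rule dvd_add)
      then show ?thesis using A.dep_edge[OF p(1)] by (simp add: algebra_simps)
    qed simp
  qed
  have zout: "z \<notin> descs T y" if "y \<in> D" "y \<noteq> z" for y
    using A.descs_le[of z y] D(3)[of y] that by auto
  have below: "descs T y \<subseteq> D" if y: "y \<in> D" "y \<noteq> z" for y
  proof
    fix x assume "x \<in> descs T y"
    then have "(y, x) \<in> T\<^sup>*" by (simp add: descs_def)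
    then show "x \<in> D"
    proof (induction rule: rtrancl_induct)
      case (step a b)
      then have "a \<noteq> z" using zout[OF y] by (auto simp: descs_def)
      then show ?case using down step by blast
    qed (fact y)
  qed
  \<comment> \<open>A vertex with nonrecurrent image belongs to a branch with top \<open>y0\<close>
    that leaves the component and never returns. A longest path of the branch, preceded by the image
    of the parent of \<open>y0\<close>, is an outlet longer than the height of the branch; (vi)
    therefore makes the branch common to both trees.\<close>
  have outside: "\<exists>y0. y0 \<in> D \<and> y0 \<noteq> z \<and> y \<in> descs T y0 \<and> subtree_eq T T' y0 \<and>
      (\<exists>p0. (p0, y0) \<in> T \<and> p0 \<in> D \<and> cyc E (\<phi> p0)) \<and> (\<forall>w\<in>descs T y0. \<not> cyc E (\<phi> w))"
    if "y \<in> D" "\<not> cyc E (\<phi> y)" for y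
    using that
  proof (induction y rule: less_induct)
    case (less y)
    then have yz: "y \<noteq> z" using z by auto
    then obtain p where p: "(p, y) \<in> T" "p \<in> D" using par less.prems by blast
    show ?case
    proof (cases "cyc E (\<phi> p)")
      case False
      then obtain y0 where "y0 \<in> D \<and> y0 \<noteq> z \<and> p \<in> descs T y0 \<and> subtree_eq T T' y0 \<and>
        (\<exists>p0. (p0, y0) \<in> T \<and> p0 \<in> D \<and> cyc E (\<phi> p0)) \<and> (\<forall>w\<in>descs T y0. \<not> cyc E (\<phi> w))"
        using less.IH[of p] p A.edgeD[OF p(1)] by blast
      then show ?thesis using A.descs_edge p by blast
    next
      case True
      have range: "1 \<le> y" "y \<le> n" using A.edgeD[OF p(1)] by auto
      have inner: "(\<phi> q, \<phi> x) \<in> E" if "q \<in> descs T y" "(q, x) \<in> T" for q x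
      proof -
        have "x \<in> descs T y" using that A.descs_edge by blast
        then show ?thesis using hom[OF that(2)] below[OF less.prems(1) yz] zout[OF less.prems(1) yz] by blast
      qed
      have reachy: "(\<phi> y, \<phi> w) \<in> E\<^sup>*" if "w \<in> descs T y" for w
      proof -
        have "(y, w) \<in> T\<^sup>*" using that by (simp add: descs_def)
        then show ?thesis
        proof (induction rule: rtrancl_induct)
          case (step a b)
          then have "(\<phi> a, \<phi> b) \<in> E" using inner by (auto simp: descs_def)
          then show ?case using step by auto
        qed simp
      qed
      have acyc: "\<not> cyc E (\<phi> w)" if w: "w \<in> descs T y" for w
      proof
        assume "cyc E (\<phi> w)"
        moreover have "w \<in> D" using below[OF less.prems(1) yz] w by blast
        ultimately have "(\<phi> w, \<phi> p) \<in> E\<^sup>*"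
          using inK[of w] inK[OF p(2) True] unfolding cls_def mem_Collect_eq by (meson rtrancl_trans)
        then have "(\<phi> y, \<phi> p) \<in> E\<^sup>*" using reachy[OF w] by (meson rtrancl_trans)
        then have "cyc E (\<phi> y)" using hom[OF p(1) less.prems(1) yz] by (meson cycI(2))
        then show False using less.prems by simp
      qed
      obtain v where v: "v 0 = \<phi> y" "walkf E (height T y) v" "\<forall>i\<le>height T y. v i \<in> \<phi> ` descs T y"
        using A.hom_height_walk[OF range, of \<phi> E] inner by blast
      have "outlet_walk E (Suc (height T y)) (case_nat (\<phi> p) v)"
        unfolding outlet_walk_def walkf_def
      proof (intro conjI allI impI)
        fix i assume "i < Suc (height T y)"
        then show "(case_nat (\<phi> p) v i, case_nat (\<phi> p) v (Suc i)) \<in> E"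
          using v hom[OF p(1) less.prems(1) yz] unfolding walkf_def by (cases i) auto
      next
        fix i assume i: "0 < i \<and> i \<le> Suc (height T y)"
        then obtain j where j: "i = Suc j" "j \<le> height T y" by (cases i) auto
        then obtain w where "w \<in> descs T y" "v j = \<phi> w" using v by blast
        then show "\<not> cyc E (case_nat (\<phi> p) v i)" using acyc j by simp
      qed (use True in simp)
      then have "subtree_eq T T' y" using conds(4) range unfolding cond_O_def by blast
      then show ?thesis using less.prems yz p True acyc by (intro exI[of _ y]) auto
    qed
  qed
  obtain p where p: "(p, x) \<in> T" "p \<in> D" using par edge by blast
  have p'D: "p' \<in> D" using up' edge by blast
  have p'x: "p' < x" using B.edgeD edge by blast
  have xr: "1 \<le> x" "x \<le> n" using A.edgeD[OF p(1)] by auto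
  show ?thesis
  proof (cases "p' = p")
    case True
    then show ?thesis using hom p edge by blast
  next
    case pp: False
    \<comment> \<open>Otherwise \<open>p'\<close> lies in a branch shared by the trees. This branch
      contains the child \<open>x\<close> of \<open>p'\<close> as a vertex other than its top, hence
      also the other parent \<open>p\<close>, whose image is recurrent.\<close>
    have p'_cyc: "cyc E (\<phi> p')" if "cyc E (\<phi> p)"
    proof (rule ccontr)
      assume "\<not> ?thesis"
      then obtain y0 where y0: "p' \<in> descs T y0" "subtree_eq T T' y0" "\<forall>w\<in>descs T y0. \<not> cyc E (\<phi> w)"
        using outside[OF p'D] by blast
      have "x \<in> descs T y0" using y0 edge subtree_eqD(1)[OF y0(2)] B.descs_edge by blast
      moreover have "x \<noteq> y0" using A.descs_le[OF y0(1)] p'x by auto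
      ultimately have "p \<in> descs T y0" using A.descs_parent p(1) by blast
      then show False using y0 that by blast
    qed
    \<comment> \<open>Both parents are one level above \<open>x\<close>, each in its own tree. By
      (iii) the depths of \<open>x\<close> and \<open>p'\<close> in \<open>T'\<close> may be
      replaced by those in \<open>T\<close>, so the two images lie in the same block.\<close>
    have same: "int m dvd c (\<phi> p) - c (\<phi> p')" if "cyc E (\<phi> p)"
    proof -
      have 1: "int m dvd c (\<phi> p) - c (\<phi> z) - (int (dep T p) - int (dep T z))" using color p that by blast
      have 2: "int m dvd c (\<phi> p') - c (\<phi> z) - (int (dep T p') - int (dep T z))"
        using color p'D p'_cyc that by blast
      have 3: "int m dvd int (dep T x) - int (dep T' x)"
        using conds(3) z col xr unfolding cond_M_def by blast
      have 4: "int m dvd int (dep T p') - int (dep T' p')"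
        using conds(3) z col B.edgeD[OF edge(1)] unfolding cond_M_def by (meson le_trans less_imp_le_nat)
      have "int m dvd (c (\<phi> p) - c (\<phi> z) - (int (dep T p) - int (dep T z))) -
          (c (\<phi> p') - c (\<phi> z) - (int (dep T p') - int (dep T z))) +
          ((int (dep T x) - int (dep T' x)) - (int (dep T p') - int (dep T' p')))"
        by (rule dvd_add[OF dvd_diff[OF 1 2] dvd_diff[OF 3 4]])
      then show ?thesis using A.dep_edge[OF p(1)] B.dep_edge[OF edge(1)] by (simp add: algebra_simps)
    qed
    show ?thesis
    proof (cases "cyc E (\<phi> x)")
      case True
      have cp: "cyc E (\<phi> p)" using parK p edge True by blast
      have K: "\<phi> p \<in> ?K" "\<phi> p' \<in> ?K" "\<phi> x \<in> ?K" using inK cp p'_cyc p p'D edge True by blast+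
      have "int m dvd c (\<phi> x) - c (\<phi> p) - 1"
        using col K hom[OF p(1) edge(2,3)] unfolding whirl_coloring_def by blast
      then have "int m dvd (c (\<phi> x) - c (\<phi> p) - 1) + (c (\<phi> p) - c (\<phi> p'))" using same cp by (intro dvd_add)
      then show ?thesis using col K unfolding whirl_coloring_def by (simp add: algebra_simps)
    next
      case False
      then obtain y0 where y0: "y0 \<in> D" "y0 \<noteq> z" "x \<in> descs T y0" "subtree_eq T T' y0"
        "\<exists>p0. (p0, y0) \<in> T \<and> p0 \<in> D \<and> cyc E (\<phi> p0)"
        "\<forall>w\<in>descs T y0. \<not> cyc E (\<phi> w)"
        using outside[OF edge(2)] by blast
      \<comment> \<open>Below the top of the shared branch \<open>y0\<close>, the edge belongs to
        \<open>T\<close> as well. If \<open>x\<close> is the top, the branch as a whole moves from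
        \<open>p\<close> to \<open>p'\<close>; by (vii) vertices of the same block admit the same
        branches of this height.\<close>
      show ?thesis
      proof (cases "x = y0")
        case False
        then have "p' \<in> descs T y0"
          using B.descs_parent[OF _ _ edge(1)] y0(3) subtree_eqD(1)[OF y0(4)] by blast
        then have "(p', x) \<in> T" using subtree_eqD(2)[OF y0(4)] edge by blast
        then show ?thesis using hom edge by blast
      next
        case True
        then have cp: "cyc E (\<phi> p)" using y0(5) p(1) A.parent_unique by blast
        have K: "\<phi> p \<in> ?K" "\<phi> p' \<in> ?K" using inK cp p'_cyc p p'D by blast+
        have inner: "(\<phi> q, \<phi> y) \<in> E" if "q \<in> descs T x" "(q, y) \<in> T" for q y
          using hom[OF that(2)] below[OF edge(2,3)] zout[OF edge(2,3)] A.descs_edge[OF that] by blast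
        obtain v where v: "v 0 = \<phi> x" "walkf E (height T x) v"
          using A.hom_height_walk[OF xr, of \<phi> E] inner by blast
        have "(\<phi> p, v 0) \<in> E" using v hom p edge by simp
        then show ?thesis
          using conds(5) z col K same[OF cp] v y0(4) True p(1) edge(1) pp
          unfolding cond_Z_def by (metis less_irrefl)
      qed
    qed
  qed
qed

lemma hom_transfer:
  assumes conds: "conds E n T T' L" and hom: "hom E T \<phi>"
  shows "hom E T' \<phi>"
proof -
  have C: "cond_whirl E" "cond_sep E" "cond_M E n T T'" "cond_O E n T T'" "cond_Z E T T'"
    using conds unfolding conds_def by blast+
  have edge: "(\<phi> p, \<phi> x) \<in> E" if "(p, x) \<in> T" for p x using hom that unfolding hom_def by blast
  have path: "\<exists>v. v 0 = \<phi> a \<and> v k = \<phi> b \<and> walkf E k v \<and> (\<forall>i\<le>k. v i \<in> \<phi> ` descs T a)"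
    if "(a, b) \<in> T ^^ k" for a b k
    using A.hom_relpow_walk[OF that] edge by blast
  have reach: "(\<phi> a, \<phi> b) \<in> E\<^sup>*" if "b \<in> descs T a" for a b
  proof -
    have "(a, b) \<in> T\<^sup>*" using that by (simp add: descs_def)
    then show ?thesis by (induction rule: rtrancl_induct) (auto dest: edge)
  qed
  show ?thesis
    unfolding hom_def
  proof safe
    fix p' x assume e': "(p', x) \<in> T'"
    then obtain p where p: "(p, x) \<in> T" using A.parent_ex[of x] B.edgeD[OF e'] by auto
    show "(\<phi> p', \<phi> x) \<in> E"
    proof (cases "p = p'")
      case True
      then show ?thesis using edge p by blast
    next
      case False
      note deep = different_parents_deep[OF p e' False]
      have x: "1 \<le> x" "x \<le> n" using A.edgeD[OF p] by auto
      txt \<open>The ancestor \<open>z\<close> of \<open>x\<close> at depth \<open>L\<close> is the same in both trees.\<close>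
      obtain z where z: "1 \<le> z" "z \<le> n" "dep T z = L" "x \<in> descs T z"
        using A.ancestor_at_depth[OF x, of L] deep by auto
      \<comment> \<open>Any proper ancestor of \<open>x\<close> has \<open>p\<close> below it, so
        equal subtrees there would make \<open>p\<close> the parent of \<open>x\<close> in
        \<open>T'\<close> too.\<close>
      have not_eq: "\<not> subtree_eq T T' y" if "x \<in> descs T y" "x \<noteq> y" for y
      proof
        assume s: "subtree_eq T T' y"
        have "p \<in> descs T y" using A.descs_parent that p by blast
        then have "(p, x) \<in> T'" using subtree_eqD(2)[OF s] p by blast
        then show False using B.parent_unique e' False by blast
      qed
      show ?thesis
      proof (cases "\<exists>y. 1 \<le> y \<and> z \<in> descs T y \<and> cyc E (\<phi> y)")
        case True
        then obtain y where y: "1 \<le> y" "z \<in> descs T y" "cyc E (\<phi> y)" by blast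
        have yn: "y \<le> n" using A.descs_le[OF y(2)] z by simp
        have dy: "dep T y \<le> L" using A.descs_dep[OF y(2)] z by simp
        have eq: "descs T y = descs T' y" using shallow_descs y yn dy by blast
        show ?thesis
        proof (rule transfer_below_cyc[OF C, of y "descs T y"])
          show "\<And>x. x \<in> descs T y \<Longrightarrow> y \<le> x \<and> x \<le> n" using A.descs_le A.descs_range y yn by blast
          show "\<And>p x. (p, x) \<in> T \<Longrightarrow> x \<in> descs T y \<Longrightarrow> x \<noteq> y \<Longrightarrow> p \<in> descs T y"
            using A.descs_parent by blast
          show "\<And>p x. (p, x) \<in> T' \<Longrightarrow> x \<in> descs T y \<Longrightarrow> x \<noteq> y \<Longrightarrow> p \<in> descs T y"
            using B.descs_parent eq by blast
          show "\<And>p x. (p, x) \<in> T \<Longrightarrow> p \<in> descs T y \<Longrightarrow> p \<noteq> y \<Longrightarrow> x \<in> descs T y"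
            using A.descs_edge by blast
          show "x \<in> descs T y" using A.descs_trans y z by blast
          show "x \<noteq> y" using dy deep by auto
        qed (use y e' edge in auto)
      next
        case nocyc: False
        \<comment> \<open>Otherwise a longest path from the root is mapped to a nonrecurrent walk as
          long as the height of \<open>T\<close>, against (iv).\<close>
        have "\<exists>y. 1 \<le> y \<and> y \<le> n \<and> cyc E (\<phi> y)"
        proof (rule ccontr)
          assume no: "\<not> ?thesis"
          obtain v where v: "walkf E (height T 1) v" "\<forall>i\<le>height T 1. v i \<in> \<phi> ` descs T 1"
            using A.hom_height_walk[of 1 \<phi> E] edge x by auto
          have "\<forall>i\<le>height T 1. \<not> cyc E (v i)"
          proof (intro allI impI)
            fix i assume "i \<le> height T 1"
            then obtain a where a: "a \<in> descs T 1" "v i = \<phi> a" using v(2) by blast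
            then have "1 \<le> a \<and> a \<le> n" using A.descs_range[of a 1] x by simp
            then show "\<not> cyc E (v i)" using no a by simp
          qed
          then show False using conds v(1) unfolding conds_def cond_P_def by blast
        qed
        then obtain y1 where y1: "1 \<le> y1" "y1 \<le> n" "cyc E (\<phi> y1)" by blast
        txt \<open>\<open>v\<close> is the deepest ancestor of \<open>z\<close> with a recurrent vertex below it. If \<open>v \<noteq> z\<close>, the
          branches of the tree at \<open>v\<close> towards this vertex and towards \<open>x\<close> violate (ix).\<close>
        define S where "S = {v. 1 \<le> v \<and> z \<in> descs T v \<and> (\<exists>w\<in>descs T v. cyc E (\<phi> w))}"
        have fS: "finite S" unfolding S_def using A.descs_le by (auto intro!: finite_subset[of _ "{..z}"])
        have "1 \<in> S" unfolding S_def using A.descs_root y1 z by blast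
        define v where "v = Max S"
        have "v \<in> S" unfolding v_def using fS \<open>1 \<in> S\<close> by (intro Max_in) auto
        then have v: "1 \<le> v" "z \<in> descs T v" "\<exists>w\<in>descs T v. cyc E (\<phi> w)" unfolding S_def by auto
        have vmax: "v' \<le> v" if "v' \<in> S" for v' unfolding v_def using fS that by (rule Max_ge)
        have vn: "v \<le> n" using A.descs_le[OF v(2)] z by simp
        \<comment> \<open>Taking the least number ensures that no proper ancestor of
          \<open>y\<close> has a recurrent image: those between \<open>v\<close> and
          \<open>y\<close> are excluded by minimality, those from \<open>v\<close> upwards by
          \<open>nocyc\<close>. Thus the path to \<open>y\<close> is an entry walk.\<close>
        define y where "y = (LEAST w. w \<in> descs T v \<and> cyc E (\<phi> w))"
        have y: "y \<in> descs T v" "cyc E (\<phi> y)"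
          unfolding y_def using LeastI_ex[of "\<lambda>w. w \<in> descs T v \<and> cyc E (\<phi> w)"] v(3) by blast+
        have ymin: "y \<le> w" if "w \<in> descs T v" "cyc E (\<phi> w)" for w
          unfolding y_def by (rule Least_le) (use that in blast)
        have yr: "1 \<le> y" "y \<le> n" using A.descs_range[OF y(1)] v vn by auto
        have above: "\<not> cyc E (\<phi> a)" if a: "1 \<le> a" "y \<in> descs T a" "a \<noteq> y" for a
        proof (cases "a \<le> v")
          case True
          then have "v \<in> descs T a" using A.descs_linear[OF a(2) y(1)] a yr by blast
          then show ?thesis using nocyc a v A.descs_trans by blast
        next
          case False
          then have "a \<in> descs T v" using A.descs_linear[OF y(1) a(2)] v yr by auto
          moreover have "a < y" using A.descs_le[OF a(2)] a by simp
          ultimately show ?thesis using ymin[of a] by auto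
        qed
        obtain f where f: "f 0 = 1" "f (dep T y) = y" "\<And>i. i < dep T y \<Longrightarrow> (f i, f (Suc i)) \<in> T"
          "\<And>i. i \<le> dep T y \<Longrightarrow> y \<in> descs T (f i) \<and> dep T (f i) = i \<and> 1 \<le> f i \<and> f i \<le> n"
          using A.root_path[OF yr] by blast
        have fy: "f i \<noteq> y" if "i < dep T y" for i using f(4)[of i] that by auto
        have entry: "entry_walk E (dep T y) (\<phi> \<circ> f)"
          unfolding entry_walk_def walkf_def using f edge above fy y by auto
        then have dyL: "dep T y \<le> Suc L" using conds unfolding conds_def cond_E_def by blast
        obtain F where F: "F 0 = \<phi> y" "\<And>i. F i \<in> cls E (\<phi> y)" "\<And>i. (F i, F (Suc i)) \<in> E"
          using cyc_forward_walk[OF y(2) self_cls] by metis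
        \<comment> \<open>The path to \<open>y\<close>, prolonged inside the component of
          \<open>\<phi> y\<close> to length \<open>L + 1\<close>, serves as the first walk in all
          uses of (ix) below.\<close>
        define vv where "vv = (\<lambda>i. if i \<le> dep T y then (\<phi> \<circ> f) i else F (i - dep T y))"
        have "walkf E (dep T y + (Suc L - dep T y)) vv"
          unfolding vv_def using entry F f(2)
          by (intro walkf_append) (auto simp: entry_walk_def walkf_def)
        then have vv: "walkf E (Suc L) vv" using dyL by simp
        have cycvv: "cyc E (vv (Suc L))"
          using y(2) f(2) dyL cyc_cls[OF y(2) F(2)] unfolding vv_def by (cases "dep T y = Suc L") auto
        have omega: "m < dep T a + height T a"
          if "1 \<le> r" "r \<le> Suc L" "r - 1 \<le> dep T y" "Suc L \<le> m" "v' (r - 1) = \<phi> (f (r - 1))"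
             "\<And>i. r - 1 \<le> i \<Longrightarrow> i < m \<Longrightarrow> (v' i, v' (Suc i)) \<in> E" "\<not> cyc E (v' (Suc L))"
             "1 \<le> a" "a \<le> n" "\<not> subtree_eq T T' a" "dep T a \<le> r" for r m v' a
        proof -
          have "v' (r - 1) = vv (r - 1)" using that unfolding vv_def by simp
          then show ?thesis
            using conds that vv cycvv unfolding conds_def cond_omega_def by blast
        qed
        show ?thesis
        proof (cases "v = z")
          case vz: False
          have dv: "dep T v < L" using A.descs_dep_less[OF v(2)] vz z by auto
          define s where "s = dep T v"
          obtain v' where v': "1 \<le> v'" "v' \<le> n" "dep T v' = Suc s" "z \<in> descs T v'"
            using A.ancestor_at_depth[OF z(1,2), of "Suc s"] dv z unfolding s_def by auto
          have "v < v'"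
          proof (rule ccontr)
            assume "\<not> v < v'"
            then have "v \<in> descs T v'" using A.descs_linear[OF v'(4) v(2)] v' z by auto
            then show False using A.descs_dep[of v v'] v'(3) unfolding s_def by simp
          qed
          then have none: "\<not> cyc E (\<phi> a)" if "a \<in> descs T v'" for a
            using vmax[of v'] that v' unfolding S_def by auto
          obtain W where W: "W 0 = \<phi> v'" "walkf E (height T v') W"
            "\<forall>i\<le>height T v'. W i \<in> \<phi> ` descs T v'"
            using A.hom_height_walk[of v' \<phi> E] edge v' by auto
          have parent: "(v, v') \<in> T"
          proof -
            obtain q where q: "(q, v') \<in> T" using A.parent_ex[of v'] \<open>v < v'\<close> v v' by auto
            have "v' \<in> descs T q" using q by (auto simp: descs_def)
            then have "z \<in> descs T q" using A.descs_trans v'(4) by blast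
            moreover have "dep T q = dep T v" using A.dep_edge[OF q] v'(3) unfolding s_def by simp
            ultimately have "q = v" using A.descs_same_dep[of z q v] v z A.edgeD[OF q] by blast
            then show ?thesis using q by simp
          qed
          have sy: "s \<le> dep T y" unfolding s_def using A.descs_dep y by blast
          have fs: "f s = v"
            using A.descs_same_dep[of y "f s" v] f(4)[OF sy] y v yr unfolding s_def by auto
          have xv': "x \<in> descs T v'" using A.descs_trans v' z by blast
          \<comment> \<open>The fork is at \<open>v\<close>, with \<open>r = s + 1\<close> the depth
            of \<open>v'\<close>: from there \<open>v2\<close> follows a longest path below
            \<open>v'\<close>, where nothing is recurrent by the choice of \<open>v\<close>.
            Positions before \<open>s\<close> are irrelevant. Since \<open>m\<close> is exactly
            depth plus height of \<open>v'\<close>, (ix) for the vertex \<open>v'\<close> reads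
            \<open>m < m\<close>.\<close>
          define v2 where "v2 = (\<lambda>i. if i \<le> s then \<phi> v else W (i - Suc s))"
          define m where "m = dep T v' + height T v'"
          have m: "Suc L \<le> m"
            unfolding m_def using A.dep_le_height[OF xv' v'(1,2)] deep by simp
          have "m < dep T v' + height T v'"
          proof (rule omega[of "Suc s" m v2])
            show "(v2 i, v2 (Suc i)) \<in> E" if "Suc s - 1 \<le> i" "i < m" for i
            proof (cases "i = s")
              case True
              then show ?thesis unfolding v2_def using W(1) edge[OF parent] by simp
            next
              case False
              then have "(W (i - Suc s), W (Suc (i - Suc s))) \<in> E"
                using W(2) that v'(3) unfolding walkf_def m_def by auto
              then show ?thesis unfolding v2_def using False that by (simp add: Suc_diff_Suc)
            qed
            have "W (L - s) \<in> \<phi> ` descs T v'" using W(3) m v'(3) unfolding m_def by auto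
            then show "\<not> cyc E (v2 (Suc L))" unfolding v2_def using none dv s_def by auto
            have "x \<noteq> v'" using A.descs_dep[OF v'(4)] z deep by auto
            then show "\<not> subtree_eq T T' v'" using not_eq[OF xv'] by blast
          qed (use dv s_def m v' sy fs in \<open>auto simp: v2_def\<close>)
          then show ?thesis unfolding m_def by simp
        next
          case vz: True
          \<comment> \<open>Here recurrence begins exactly one level below \<open>z\<close>:
            \<open>y\<close> is a child of \<open>z\<close> at depth \<open>L + 1\<close>, and
            \<open>\<phi> z\<close> is the last vertex but one of an entry walk of the greatest
            length allowed by (v).\<close>
          have yz: "y \<noteq> z" using nocyc y vz v by auto
          have dy: "dep T y = Suc L" using A.descs_dep_less[of y z] y vz yz z dyL by auto
          have fL: "f L = z"
            using A.descs_same_dep[of y "f L" z] f(4)[of L] dy y vz z yr by auto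
          have zy: "(z, y) \<in> T" using f(3)[of L] f(2) dy fL by auto
          obtain w where w: "w \<in> cls E (\<phi> y)" "(w, \<phi> y) \<in> E" using cyc_predecessor[OF y(2)] by blast
          \<comment> \<open>Condition (x) as an equivalence: \<open>w\<close> and
            \<open>\<phi> z\<close> have the same out-neighbours among the starting points of walks
            at least as long as both heights of some vertex in \<open>tt_Lambda\<close>.\<close>
          have lambda: "((w, u 0) \<in> E) = ((\<phi> z, u 0) \<in> E)"
            if "walkf E k u" "1 \<le> a" "a \<le> n" "dep T a \<noteq> dep T' a" "dep T a = Suc L \<or> dep T' a = Suc L"
              "max (height T a) (height T' a) \<le> k" for k u a
          proof (rule ccontr)
            assume ne: "\<not> ?thesis"
            have entry': "entry_walk E (Suc L) (\<phi> \<circ> f)" using entry dy by simp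
            have fs: "(\<phi> \<circ> f) (Suc L) = \<phi> y" "(\<phi> \<circ> f) L = \<phi> z" using f(2) dy fL by auto
            have "cond_lambda E n T T' L" using conds unfolding conds_def by blast
            then have "k < max (height T a) (height T' a)"
              using cond_lambdaD[OF _ entry', of n T T' w k u a] w that(1-5) ne unfolding fs by blast
            then show False using that by simp
          qed
          \<comment> \<open>If \<open>\<phi> y'\<close> were recurrent, walks of any length would
            start there, against (x). So (ix) with \<open>r = L + 1\<close> applies and the subtree
            of \<open>y'\<close> is shared. If its depths differed, \<open>y'\<close> would belong
            to \<open>tt_Lambda\<close> and its own branch would contradict (x) again; equal depths
            at level \<open>L + 1\<close> give equal parents.\<close>
          have dropped: "(z, y') \<in> T' \<and> subtree_eq T T' y'" if y': "(z, y') \<in> T" "(w, \<phi> y') \<notin> E" for y'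
          proof -
            have r: "1 \<le> y'" "y' \<le> n" using A.edgeD[OF y'(1)] by auto
            have d: "dep T y' = Suc L" using A.dep_edge[OF y'(1)] z by simp
            have nc: "\<not> cyc E (\<phi> y')"
            proof
              assume c: "cyc E (\<phi> y')"
              obtain u where u: "u 0 = \<phi> y'" "\<And>i. (u i, u (Suc i)) \<in> E"
                using cyc_forward_walk[OF c self_cls] by metis
              obtain a where a: "1 \<le> a" "a \<le> n" "dep T a \<noteq> dep T' a" "dep T a = Suc L \<or> dep T' a = Suc L"
                using differ by blast
              have "walkf E (max (height T a) (height T' a)) u" using u by (simp add: walkf_def)
              from lambda[OF this a order_refl] show False using u(1) y' edge[OF y'(1)] by simp
            qed
            obtain W where W: "W 0 = \<phi> y'" "walkf E (height T y') W"
              using A.hom_height_walk[of y' \<phi> E] edge r by auto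
            define v2 where "v2 = (\<lambda>i. if i \<le> L then \<phi> z else W (i - Suc L))"
            have s: "subtree_eq T T' y'"
            proof (rule ccontr)
              assume ns: "\<not> subtree_eq T T' y'"
              have "Suc L + height T y' < dep T y' + height T y'"
              proof (rule omega[of "Suc L" _ v2])
                show "(v2 i, v2 (Suc i)) \<in> E" if "Suc L - 1 \<le> i" "i < Suc L + height T y'" for i
                proof (cases "i = L")
                  case True
                  then show ?thesis unfolding v2_def using W(1) edge[OF y'(1)] by simp
                next
                  case False
                  then have "(W (i - Suc L), W (Suc (i - Suc L))) \<in> E"
                    using W(2) that unfolding walkf_def by auto
                  then show ?thesis unfolding v2_def using False that by (simp add: Suc_diff_Suc)
                qed
              qed (use r ns nc W d dy fL in \<open>auto simp: v2_def\<close>)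
              then show False using d by simp
            qed
            have "dep T' y' = Suc L"
            proof (rule ccontr)
              assume "dep T' y' \<noteq> Suc L"
              then show False
                using lambda[OF W(2) r] d W(1) y' edge[OF y'(1)] height_subtree_eq[OF s] by simp
            qed
            then show ?thesis using same_parent[OF y'(1) d] s by simp
          qed
          txt \<open>By (x), \<open>\<phi> z\<close> may be replaced by \<open>w\<close>, after discarding the branches at \<open>z\<close> that the two
            trees share; this reduces the situation to one below a recurrent vertex.\<close>
          define D where "D = {a \<in> descs T z. \<forall>y'. (z, y') \<in> T \<longrightarrow> (w, \<phi> y') \<notin> E \<longrightarrow> a \<notin> descs T y'}"
          have eqz: "descs T z = descs T' z" using shallow_descs z by simp
          have up: "q \<in> D" if "(q, a) \<in> T" "a \<in> D" "a \<noteq> z" for q a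
            using that A.descs_parent[of a z q] A.descs_edge[of q _ a] unfolding D_def by blast
          have up': "q \<in> D" if "(q, a) \<in> T'" "a \<in> D" "a \<noteq> z" for q a
          proof -
            have "q \<in> descs T z" using B.descs_parent[of a z q] that eqz unfolding D_def by blast
            moreover have "q \<notin> descs T y'" if "(z, y') \<in> T" "(w, \<phi> y') \<notin> E" for y'
              using B.descs_edge[of q y' a] \<open>(q, a) \<in> T'\<close> \<open>a \<in> D\<close> subtree_eqD(1)[of T T' y'] dropped[OF that] that
              unfolding D_def by blast
            ultimately show ?thesis unfolding D_def by blast
          qed
          have down: "a \<in> D" if "(q, a) \<in> T" "q \<in> D" "q \<noteq> z" for q a
          proof -
            have "a \<in> descs T z" using that A.descs_edge unfolding D_def by blast
            moreover have "a \<notin> descs T y'" if "(z, y') \<in> T" "(w, \<phi> y') \<notin> E" for y'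
              using A.descs_parent[of a y' q] \<open>(q, a) \<in> T\<close> \<open>q \<in> D\<close> \<open>q \<noteq> z\<close> A.parent_unique that
              unfolding D_def by blast
            ultimately show ?thesis unfolding D_def by blast
          qed
          have down': "a \<in> D" if "(q, a) \<in> T'" "q \<in> D" "q \<noteq> z" for q a
          proof -
            have "a \<in> descs T z" using that B.descs_edge eqz unfolding D_def by blast
            moreover have "a \<notin> descs T y'" if "(z, y') \<in> T" "(w, \<phi> y') \<notin> E" for y'
              using B.descs_parent[of a y' q] \<open>(q, a) \<in> T'\<close> \<open>q \<in> D\<close> \<open>q \<noteq> z\<close> B.parent_unique that
                dropped[OF that] subtree_eqD(1)[of T T' y']
              unfolding D_def by blast
            ultimately show ?thesis unfolding D_def by blast
          qed
          have zD: "z \<in> D" unfolding D_def using A.edgeD A.descs_le by fastforce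
          have rangeD: "z \<le> a \<and> a \<le> n" if "a \<in> D" for a
            using that A.descs_le A.descs_range z unfolding D_def by blast
          define \<psi> where "\<psi> = \<phi>(z := w)"
          have cycw: "cyc E (\<psi> z)" unfolding \<psi>_def using cyc_cls[OF y(2) w(1)] by simp
          have edge\<psi>: "(\<psi> q, \<psi> a) \<in> E" if "(q, a) \<in> T" "a \<in> D" "a \<noteq> z" for q a
            using that edge[OF that(1)] unfolding \<psi>_def D_def by auto
          have edge': "(\<psi> q, \<psi> a) \<in> E" if "(q, a) \<in> T'" "a \<in> D" "a \<noteq> z" for q a
          proof (rule transfer_below_cyc[OF C, of z D \<psi>])
          qed (use zD z(1) rangeD up up' down edge\<psi> cycw that in blast)+
          have xz: "x \<noteq> z" using deep z by auto
          have xD: "x \<in> D"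
          proof (rule ccontr)
            assume "x \<notin> D"
            then obtain y' where y': "(z, y') \<in> T" "(w, \<phi> y') \<notin> E" "x \<in> descs T y'"
              using z unfolding D_def by blast
            note d = dropped[OF y'(1,2)]
            then have "x = y'" using not_eq[OF y'(3)] by blast
            then show False using d y' p e' False A.parent_unique B.parent_unique by blast
          qed
          show ?thesis
          proof (cases "p' = z")
            case False
            then show ?thesis using edge'[OF e' xD xz] xz unfolding \<psi>_def by simp
          next
            case True
            have wx: "(w, \<phi> x) \<in> E" using edge'[OF e' xD xz] xz True unfolding \<psi>_def by simp
            have d'x: "dep T' x = Suc L"
              using B.dep_edge[OF e'] True z agree[of z] by simp
            have dx: "dep T x \<noteq> dep T' x"
              using same_parent[OF p] d'x B.parent_unique[OF e'] False by metis
            obtain W where W: "W 0 = \<phi> x" "walkf E (height T x) W"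
              using A.hom_height_walk[of x \<phi> E] edge x by auto
            \<comment> \<open>Condition (x) leads back from \<open>w\<close> to
              \<open>\<phi> z\<close> but asks for a walk from \<open>\<phi> x\<close> as long as
              the larger of the two heights of \<open>x\<close>. The one of length
              \<open>height T' x\<close> uses edges of \<open>T'\<close> below \<open>x\<close>;
              these stay in \<open>D\<close>, where they are already known to be preserved.\<close>
            have inD: "a \<in> D \<and> a \<noteq> z" if "a \<in> descs T' x" for a
            proof -
              have "(x, a) \<in> T'\<^sup>*" using that by (simp add: descs_def)
              then show ?thesis
              proof (induction rule: rtrancl_induct)
                case (step a b)
                then show ?case using down'[of a b] B.edgeD[OF step(2)] rangeD[of a] by auto
              qed (use xD xz in auto)
            qed
            have "\<exists>v. v 0 = \<psi> x \<and> walkf E (height T' x) v \<and> (\<forall>i\<le>height T' x. v i \<in> \<psi> ` descs T' x)"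
            proof (rule B.hom_height_walk[OF x])
              fix q a assume "q \<in> descs T' x" "(q, a) \<in> T'"
              then show "(\<psi> q, \<psi> a) \<in> E" using edge' inD B.descs_edge by blast
            qed
            then obtain W' where W': "W' 0 = \<phi> x" "walkf E (height T' x) W'"
              using xz unfolding \<psi>_def by auto
            show ?thesis
            proof (cases "height T x \<le> height T' x")
              case le: True
              show ?thesis using lambda[OF W'(2) x dx] d'x W'(1) le wx True by simp
            next
              case le: False
              show ?thesis using lambda[OF W(2) x dx] d'x W(1) le wx True by simp
            qed
          qed
        qed
      qed
    qed
  qed
qed

end

section \<open>Necessity\<close>

lemma dvd_plus_eq: "(m::int) dvd a \<Longrightarrow> m dvd b \<Longrightarrow> c = a + b \<Longrightarrow> m dvd c"
  by simp

lemma dvd_minus_eq: "(m::int) dvd a \<Longrightarrow> m dvd b \<Longrightarrow> c = a - b \<Longrightarrow> m dvd c"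
  by simp

lemma dvd_diff_cong: "(m::int) dvd x - y \<Longrightarrow> m dvd x \<longleftrightarrow> m dvd y"
  using dvd_add_right_iff[of m "x - y" y] by simp

lemma cls_between:
  assumes "a \<in> cls E u" "b \<in> cls E u" "(a, w) \<in> E\<^sup>*" "(w, b) \<in> E\<^sup>*"
  shows "w \<in> cls E u"
  using assms unfolding cls_def mem_Collect_eq by (meson rtrancl_trans)

lemma cls_converse: "cls (E\<inverse>) u = cls E u"
  by (auto simp: cls_def rtrancl_converse)

lemma forward_extend:
  assumes "walkf E k w" "cyc E (w k)"
  obtains W where "\<And>i. (W i, W (Suc i)) \<in> E" "\<And>i. i \<le> k \<Longrightarrow> W i = w i"
    "\<And>i. k \<le> i \<Longrightarrow> W i \<in> cls E (w k)"
proof -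
  obtain F where F: "F 0 = w k" "\<And>i. F i \<in> cls E (w k)" "\<And>i. (F i, F (Suc i)) \<in> E"
    using cyc_forward_walk[OF assms(2) self_cls] by metis
  define W where "W = (\<lambda>i. if i \<le> k then w i else F (i - k))"
  have "(W i, W (Suc i)) \<in> E" for i
  proof -
    have "walkf E (k + Suc i) W"
      unfolding W_def using assms F by (intro walkf_append) (auto simp: walkf_def)
    then show ?thesis unfolding walkf_def by simp
  qed
  moreover have "W i \<in> cls E (w k)" if "k \<le> i" for i
    using that F unfolding W_def by (cases "i = k") auto
  ultimately show ?thesis using that[of W] unfolding W_def by simp
qed

text \<open>Two-sided because \<open>hom_level_int\<close> lays such a walk over a tree with an
  arbitrary shift. The part before 0 is a forward walk of the converse relation.\<close>

lemma int_extend: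
  assumes "walkf E k w" "cyc E (w k)" "cyc E (w 0)"
  obtains f :: "int \<Rightarrow> 'v" where "\<And>i. (f i, f (i + 1)) \<in> E" "\<And>i. i \<le> k \<Longrightarrow> f (int i) = w i"
    "\<And>i. i \<le> 0 \<Longrightarrow> f i \<in> cls E (w 0)"
proof -
  obtain W where W: "\<And>i. (W i, W (Suc i)) \<in> E" "\<And>i. i \<le> k \<Longrightarrow> W i = w i"
    using forward_extend[OF assms(1,2)] by metis
  have "cyc (E\<inverse>) (w 0)" using assms(3) by (simp add: trancl_converse)
  from cyc_forward_walk[OF this self_cls] obtain g
    where g: "g 0 = w 0" "\<And>i. g i \<in> cls E (w 0)" "\<And>i. (g (Suc i), g i) \<in> E"
    unfolding cls_converse by auto
  define f where "f = (\<lambda>i::int. if i \<le> 0 then g (nat (- i)) else W (nat i))"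
  have "(f i, f (i + 1)) \<in> E" for i
  proof -
    consider "i < 0" | "i = 0" | "0 < i" by linarith
    then show ?thesis
    proof cases
      case 1
      then have "nat (- i) = Suc (nat (- (i + 1)))" by linarith
      then show ?thesis using 1 g(3)[of "nat (- (i + 1))"] unfolding f_def by simp
    next
      case 2
      then show ?thesis using g(1) W(1)[of 0] W(2)[of 0] unfolding f_def by simp
    next
      case 3
      then have "nat (i + 1) = Suc (nat i)" by linarith
      then show ?thesis using 3 W(1)[of "nat i"] unfolding f_def by simp
    qed
  qed
  moreover have "f (int i) = w i" if "i \<le> k" for i
    using g(1) W(2)[OF that] unfolding f_def by auto
  moreover have "f i \<in> cls E (w 0)" if "i \<le> 0" for i using g that unfolding f_def by simp
  ultimately show ?thesis using that by blast
qed

lemma forward_relpow: "(\<And>i. (f i, f (Suc i)) \<in> E) \<Longrightarrow> (f 0, f i) \<in> E ^^ i"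
  by (induction i) auto

text \<open>If every walk of length \<open>\<delta> + 1\<close> inside a class has a shortcut edge, then adjacency only depends on
  walk lengths modulo \<open>\<delta>\<close>; the number of blocks is the least positive residue of a closed walk.\<close>
lemma whirl_of_shortcuts:
  assumes u: "cyc E u" and \<delta>: "1 \<le> \<delta>"
    and short: "\<And>x y. x \<in> cls E u \<Longrightarrow> y \<in> cls E u \<Longrightarrow> (x, y) \<in> E ^^ Suc \<delta> \<Longrightarrow> (x, y) \<in> E"
  shows "\<exists>m c. whirl_coloring E (cls E u) m c"
proof -
  let ?K = "cls E u"
  \<comment> \<open>Walk lengths modulo \<open>\<delta>\<close>. Such residues can be added and, by
    going round closed walks, negated, so those of closed walks at \<open>u\<close> form a subgroup
    of the integers.\<close>
  define R where "R = (\<lambda>x y (k::int). \<exists>l\<ge>1. (x, y) \<in> E ^^ l \<and> int \<delta> dvd int l - k)"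
  have R_ex: "\<exists>k. R x y k" if "x \<in> ?K" "y \<in> ?K" for x y
  proof -
    have "(x, y) \<in> E\<^sup>*" using that unfolding cls_def mem_Collect_eq by (meson rtrancl_trans)
    then have "(x, y) \<in> E\<^sup>+" by (rule trancl_rtrancl_trancl[OF cyc_cls[OF u that(1)]])
    then obtain l where "0 < l" "(x, y) \<in> E ^^ l" using trancl_power by metis
    then have "R x y (int l)" unfolding R_def by (intro exI[of _ l]) auto
    then show ?thesis by blast
  qed
  have R_mod: "R x y k'" if R: "R x y k" "int \<delta> dvd k - k'" for x y k k'
  proof -
    obtain l where l: "l \<ge> 1" "(x, y) \<in> E ^^ l" "int \<delta> dvd int l - k" using R(1) unfolding R_def by blast
    have "int \<delta> dvd int l - k'" by (rule dvd_plus_eq[OF l(3) R(2)]) simp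
    then show ?thesis using l unfolding R_def by blast
  qed
  have R_add: "R x z (k + l)" if R: "R x y k" "R y z l" for x y z k l
  proof -
    obtain i where i: "i \<ge> 1" "(x, y) \<in> E ^^ i" "int \<delta> dvd int i - k" using R(1) unfolding R_def by auto
    obtain j where j: "j \<ge> 1" "(y, z) \<in> E ^^ j" "int \<delta> dvd int j - l" using R(2) unfolding R_def by auto
    have "(x, z) \<in> E ^^ (i + j)" unfolding relpow_add using i j by blast
    moreover have "int \<delta> dvd int (i + j) - (k + l)" by (rule dvd_plus_eq[OF i(3) j(3)]) simp
    ultimately show ?thesis using i(1) unfolding R_def by (intro exI[of _ "i + j"]) auto
  qed
  have R_neg: "R y x (- k)" if K: "x \<in> ?K" "y \<in> ?K" and R: "R x y k" for x y k
  proof -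
    obtain l where l: "R y x l" using R_ex[OF K(2,1)] by blast
    have "R y x (l + int j * (k + l))" for j
    proof (induction j)
      case (Suc j)
      then have "R y x ((l + int j * (k + l)) + (k + l))" using R_add R l by blast
      then show ?case by (simp add: algebra_simps)
    qed (use l in simp)
    \<comment> \<open>The number \<open>\<delta> - 1\<close> of rounds is chosen so that the total
      exceeds \<open>- k\<close> by \<open>\<delta> * (k + l)\<close>.\<close>
    then have "R y x (l + int (\<delta> - 1) * (k + l))" .
    then show ?thesis by (rule R_mod) (use \<delta> in \<open>simp add: of_nat_diff algebra_simps\<close>)
  qed
  have R_zero: "R x x 0" if "x \<in> ?K" for x
    using R_ex[OF that that] R_neg[OF that that] R_add by (metis add.right_inverse)
  \<comment> \<open>Each shortcut removes \<open>\<delta>\<close> steps at the beginning of the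
    walk, until a single edge is left.\<close>
  have reduce: "(x, y) \<in> E" if "x \<in> ?K" "y \<in> ?K" "(x, y) \<in> E ^^ (1 + j * \<delta>)" for x y j
    using that(3)
  proof (induction j)
    case (Suc j)
    have "1 + Suc j * \<delta> = Suc \<delta> + j * \<delta>" by simp
    then obtain w where w: "(x, w) \<in> E ^^ Suc \<delta>" "(w, y) \<in> E ^^ (j * \<delta>)"
      using Suc.prems by (metis relcompE relpow_add prod.inject)
    have "w \<in> ?K" using cls_between[OF that(1,2)] w relpow_imp_rtrancl by metis
    then have "(x, w) \<in> E ^^ 1" using short[OF that(1) _ w(1)] by simp
    then have "(x, y) \<in> E ^^ (1 + j * \<delta>)" unfolding relpow_add using w(2) by blast
    then show ?case using Suc.IH by blast
  qed simp
  have edge: "(x, y) \<in> E \<longleftrightarrow> R x y 1" if "x \<in> ?K" "y \<in> ?K" for x y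
  proof
    assume "(x, y) \<in> E"
    then show "R x y 1" unfolding R_def by (intro exI[of _ 1]) auto
  next
    assume "R x y 1"
    then obtain l where l: "l \<ge> 1" "(x, y) \<in> E ^^ l" "int \<delta> dvd int l - 1" unfolding R_def by auto
    then have "int \<delta> dvd int (l - 1)" by (simp add: of_nat_diff)
    then have "\<delta> dvd l - 1" by (simp only: int_dvd_int_iff)
    then obtain j where "l = 1 + j * \<delta>" using l(1) by (metis dvd_def le_add_diff_inverse mult.commute)
    then show "(x, y) \<in> E" using reduce that l by blast
  qed
  have uK: "u \<in> ?K" by simp
  have "R u u (int \<delta>)" using R_mod[OF R_zero[OF uK], of "int \<delta>"] by simp
  then have ex: "\<exists>m. 1 \<le> m \<and> R u u (int m)" using \<delta> by blast
  \<comment> \<open>The positive generator of the subgroup is the number of blocks.\<close>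
  define m where "m = (LEAST m. 1 \<le> m \<and> R u u (int m))"
  have m: "1 \<le> m" "R u u (int m)" unfolding m_def using LeastI_ex[OF ex] by blast+
  have m_min: "m \<le> k" if "1 \<le> k" "R u u (int k)" for k unfolding m_def by (rule Least_le) (use that in blast)
  have mult_nat: "R u u (int j * k)" if "R u u k" for j k
  proof (induction j)
    case (Suc j)
    then show ?case using R_add[OF that Suc] by (simp add: algebra_simps)
  qed (use R_zero[OF uK] in simp)
  have mult: "R u u (q * int m)" for q :: int
  proof (cases "0 \<le> q")
    case True
    then show ?thesis using mult_nat[OF m(2), of "nat q"] by simp
  next
    case False
    then show ?thesis using R_neg[OF uK uK mult_nat[OF m(2), of "nat (- q)"]] by simp
  qed
  have closed: "int m dvd k" if "R u u k" for k
  proof -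
    have "R u u (k + - (k div int m) * int m)" using R_add[OF that mult] .
    moreover have "k + - (k div int m) * int m = k mod int m" by (simp add: minus_div_mult_eq_mod [symmetric])
    ultimately have "R u u (int (nat (k mod int m)))" using m(1) by simp
    moreover have "nat (k mod int m) < m" using m(1) by (simp add: nat_less_iff)
    ultimately have "\<not> 1 \<le> nat (k mod int m)" using m_min[of "nat (k mod int m)"] by linarith
    moreover have "0 \<le> k mod int m" using m(1) by simp
    ultimately have "k mod int m = 0" by linarith
    then show ?thesis by auto
  qed
  have closed': "R u u k" if "int m dvd k" for k
    using that mult by (metis dvd_def mult.commute)
  \<comment> \<open>Any residue of a walk from \<open>u\<close> to \<open>v\<close> serves as
    colour: two of them differ by one of a closed walk, hence by a multiple of
    \<open>m\<close>.\<close>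
  define c where "c = (\<lambda>v. SOME k. R u v k)"
  have c: "R u v (c v)" if "v \<in> ?K" for v unfolding c_def by (rule someI_ex) (use R_ex uK that in blast)
  have "(a, b) \<in> E \<longleftrightarrow> int m dvd c b - c a - 1" if K: "a \<in> ?K" "b \<in> ?K" for a b
  proof
    assume "(a, b) \<in> E"
    then have "R a b 1" using edge K by blast
    then have "R u u (c a + 1 + - c b)"
      by (rule R_add[OF R_add[OF c[OF K(1)]] R_neg[OF uK K(2) c[OF K(2)]]])
    then have "int m dvd c a + 1 + - c b" by (rule closed)
    then have "int m dvd - (c a + 1 + - c b)" by (simp only: dvd_minus_iff)
    then show "int m dvd c b - c a - 1" by (simp add: algebra_simps)
  next
    assume "int m dvd c b - c a - 1"
    then have "int m dvd - (c b - c a - 1)" by (simp only: dvd_minus_iff)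
    then have "R u u (- (c b - c a - 1))" by (rule closed')
    then have "R a b (- c a + - (c b - c a - 1) + c b)"
      by (rule R_add[OF R_add[OF R_neg[OF uK K(1) c[OF K(1)]]] c[OF K(2)]])
    then show "(a, b) \<in> E" using edge K by simp
  qed
  moreover have "\<exists>a\<in>?K. int m dvd c a - i" for i
  proof -
    obtain f where f: "f 0 = u" "\<And>i. f i \<in> ?K" "\<And>i. (f i, f (Suc i)) \<in> E"
      using cyc_forward_walk[OF u uK] by metis
    \<comment> \<open>The summand \<open>m\<close> keeps the walk length positive, as
      \<open>R\<close> demands, without changing its class modulo \<open>m\<close>.\<close>
    define j where "j = nat (i mod int m) + m"
    have "R u (f j) (int j)"
      using forward_relpow[of f, OF f(3), of j] f(1) m(1) unfolding R_def j_def by (intro exI[of _ j]) (auto simp: j_def)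
    then have "R u u (c (f j) + - int j)" by (rule R_add[OF c[OF f(2)] R_neg[OF uK f(2)]])
    then have 1: "int m dvd c (f j) + - int j" by (rule closed)
    have "int j = i mod int m + int m" unfolding j_def using m(1) by simp
    then have "int j - i = int m - i div int m * int m" using minus_div_mult_eq_mod[of i "int m"] by simp
    then have 2: "int m dvd int j - i" by simp
    have "int m dvd c (f j) - i" by (rule dvd_plus_eq[OF 1 2]) simp
    then show ?thesis using f(2) by blast
  qed
  ultimately have "whirl_coloring E ?K m c" unfolding whirl_coloring_def using m(1) by blast
  then show ?thesis by blast
qed

section \<open>Homomorphisms assembled from walks, and comparison of subtrees\<close>

definition graft :: "(nat \<times> nat) set \<Rightarrow> nat \<Rightarrow> (nat \<Rightarrow> 'v) \<Rightarrow> (nat \<Rightarrow> 'v) \<Rightarrow> nat \<Rightarrow> 'v" where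
  "graft T x A C y = (if y \<in> descs T x then A (dep T y - dep T x) else C y)"

context dfs_tree
begin

lemma hom_level:
  assumes "walkf E (height T 1) v"
  shows "hom E T (\<lambda>x. v (dep T x))"
  unfolding hom_def
proof safe
  fix p x assume e: "(p, x) \<in> T"
  then have "dep T x \<le> height T 1" using dep_le_height[of x 1] descs_root[of x] edgeD[OF e] by simp
  then show "(v (dep T p), v (dep T x)) \<in> E" using assms dep_edge[OF e] unfolding walkf_def by simp
qed

lemma hom_level_int:
  assumes "\<And>i. (f i, f (i + 1)) \<in> E"
  shows "hom E T (\<lambda>x. f (int (dep T x) + s))"
  unfolding hom_def
proof safe
  fix p x assume "(p, x) \<in> T"
  then have "int (dep T x) + s = int (dep T p) + s + 1" using dep_edge by simp
  then show "(f (int (dep T p) + s), f (int (dep T x) + s)) \<in> E" using assms by metis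
qed

lemma hom_graft:
  assumes x: "1 \<le> x" "x \<le> n"
    and A: "walkf E (height T x) A"
    and C: "\<And>p y. (p, y) \<in> T \<Longrightarrow> y \<notin> descs T x \<Longrightarrow> p \<notin> descs T x \<Longrightarrow> (C p, C y) \<in> E"
    and link: "\<And>p. (p, x) \<in> T \<Longrightarrow> (C p, A 0) \<in> E"
  shows "hom E T (graft T x A C)"
  unfolding hom_def
proof safe
  fix p y assume e: "(p, y) \<in> T"
  show "(graft T x A C p, graft T x A C y) \<in> E"
  proof (cases "p \<in> descs T x")
    case True
    then have y: "y \<in> descs T x" using descs_edge e by blast
    have "dep T y \<le> dep T x + height T x" using dep_le_height[OF y x] .
    moreover have "dep T x \<le> dep T p" using descs_dep True by blast
    ultimately show ?thesis
      using True y A dep_edge[OF e] unfolding graft_def walkf_def by (auto simp: Suc_diff_le)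
  next
    case p: False
    show ?thesis
    proof (cases "y \<in> descs T x")
      case True
      then have "y = x" using descs_parent e p by blast
      then show ?thesis using link e p unfolding graft_def by simp
    next
      case False
      then show ?thesis using C e p unfolding graft_def by simp
    qed
  qed
qed

end

text \<open>What a homomorphism on \<open>T\<close> with nonrecurrent images below \<open>x\<close>
  reveals about \<open>T'\<close>: an edge of \<open>T'\<close> starting in the subtree neither
  leaves it nor fails to descend.\<close>

definition shrinks :: "(nat \<times> nat) set \<Rightarrow> (nat \<times> nat) set \<Rightarrow> nat \<Rightarrow> bool" where
  "shrinks T T' x \<longleftrightarrow> (\<forall>q y. (q, y) \<in> T' \<longrightarrow> q \<in> descs T x \<longrightarrow> y \<in> descs T x \<and> dep T q < dep T y)"

context tree_pair
begin

lemma shrinks_descs: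
  assumes "shrinks T T' x" "y \<in> descs T' x"
  shows "y \<in> descs T x \<and> dep T' y + dep T x \<le> dep T y + dep T' x"
proof -
  have "(x, y) \<in> T'\<^sup>*" using assms(2) by (simp add: descs_def)
  then show ?thesis
  proof (induction rule: rtrancl_induct)
    case (step a b)
    then show ?case using assms(1) B.dep_edge[OF step(2)] unfolding shrinks_def by fastforce
  qed simp
qed

lemma shrinks_height:
  assumes "shrinks T T' x" "1 \<le> x" "x \<le> n"
  shows "height T' x \<le> height T x"
proof -
  obtain y where y: "(x, y) \<in> T' ^^ height T' x" using B.height_attained assms by blast
  then have "y \<in> descs T' x" by (simp add: descs_def relpow_imp_rtrancl)
  then show ?thesis
    using shrinks_descs[OF assms(1)] A.dep_le_height[of y x] B.dep_relpow_add[OF y] assms by fastforce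
qed

text \<open>Shrinking both ways makes the depths below \<open>x\<close> in the two trees differ by a
  constant. As the descendants form an interval, \<open>edge_iff\<close> only compares depths inside
  it, and such comparisons are insensitive to the constant.\<close>

lemma subtree_eq_of_shrinks:
  assumes "shrinks T T' x" "shrinks T' T x" "1 \<le> x" "x \<le> n"
  shows "subtree_eq T T' x"
proof -
  interpret S: tree_pair n T' T L by (rule tree_pair_sym) unfold_locales
  have eq: "descs T x = descs T' x" using shrinks_descs S.shrinks_descs assms by blast
  have d: "dep T' y + dep T x = dep T y + dep T' x" if "y \<in> descs T x" for y
    using shrinks_descs[OF assms(1)] S.shrinks_descs[OF assms(2)] that eq by fastforce
  have "(q, y) \<in> T \<longleftrightarrow> (q, y) \<in> T'" if qy: "q \<in> descs T x" "y \<in> descs T x" for q y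
  proof (cases "q < y")
    case True
    have mid: "z \<in> descs T x" if "q < z" "z < y" for z
    proof -
      have "x < z" using A.descs_le[OF qy(1)] that by simp
      moreover have "dep T x < dep T w" if "x < w" "w \<le> z" for w
        using A.descs_interval[OF qy(2)] that \<open>z < y\<close> by simp
      moreover have "z \<le> n" using A.descs_range[OF qy(2)] assms that by simp
      ultimately show ?thesis using A.descs_iff[of x z] assms(3) by simp
    qed
    have "dep T q < dep T y \<longleftrightarrow> dep T' q < dep T' y" using d[OF qy(1)] d[OF qy(2)] by linarith
    moreover have "dep T y \<le> dep T z \<longleftrightarrow> dep T' y \<le> dep T' z" if "q < z" "z < y" for z
      using d[OF qy(2)] d[OF mid[OF that]] by linarith
    ultimately show ?thesis unfolding A.edge_iff B.edge_iff by auto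
  qed (use A.edgeD B.edgeD in blast)
  then show ?thesis unfolding subtree_eq_def using eq by auto
qed

lemma root_not_eq: "\<not> subtree_eq T T' 1"
proof
  assume s: "subtree_eq T T' 1"
  obtain x where x: "1 \<le> x" "x \<le> n" "dep T x \<noteq> dep T' x" using differ by blast
  have "(1, x) \<in> T ^^ dep T x" using A.dep_relpow x by blast
  then have "(1, x) \<in> T' ^^ dep T x" using relpow_subtree_eq[OF s] by blast
  then show False using B.dep_eqI x by simp
qed

text \<open>The least number is taken, not the least depth: both parents of this vertex then come
  before it and have the same depth in either tree.\<close>

lemma first_difference:
  obtains x p p' where "1 \<le> x" "x \<le> n" "(p, x) \<in> T" "(p', x) \<in> T'" "dep T x \<noteq> dep T' x"
    "dep T p = dep T' p" "dep T p' = dep T' p'"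
proof -
  define x where "x = (LEAST x. 1 \<le> x \<and> x \<le> n \<and> dep T x \<noteq> dep T' x)"
  have "\<exists>x. 1 \<le> x \<and> x \<le> n \<and> dep T x \<noteq> dep T' x" using differ by blast
  then have x: "1 \<le> x" "x \<le> n" "dep T x \<noteq> dep T' x"
    unfolding x_def by (metis (mono_tags, lifting) LeastI)+
  have below: "dep T y = dep T' y" if "1 \<le> y" "y < x" for y
    using not_less_Least[of y "\<lambda>x. 1 \<le> x \<and> x \<le> n \<and> dep T x \<noteq> dep T' x"] that x(2) unfolding x_def by auto
  have "x \<noteq> 1" using x(3) by auto
  then obtain p p' where p: "(p, x) \<in> T" "(p', x) \<in> T'"
    using A.parent_ex[of x] B.parent_ex[of x] x by auto
  have "dep T p = dep T' p" "dep T p' = dep T' p'"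
    using below A.edgeD[OF p(1)] B.edgeD[OF p(2)] by blast+
  then show ?thesis using that x p by blast
qed

end

section \<open>Consequences of equal homomorphisms\<close>

locale tree_pair_same = tree_pair n T T' L for n T T' L +
  fixes E :: "('v \<times> 'v) set"
  assumes same: "hom E T \<phi> \<longleftrightarrow> hom E T' \<phi>"

lemma tree_pair_same_sym: "tree_pair_same n T T' L E \<Longrightarrow> tree_pair_same n T' T L E"
  unfolding tree_pair_same_def tree_pair_same_axioms_def using tree_pair_sym by blast

context tree_pair_same
begin

lemma same_edge: "hom E T \<phi> \<Longrightarrow> (p, x) \<in> T' \<Longrightarrow> (\<phi> p, \<phi> x) \<in> E"
  using same unfolding hom_def by blast

text \<open>Here \<open>\<delta>\<close> is the difference of the two depths of the vertex in
  \<open>first_difference\<close>; laying \<open>f\<close> over one tree by depth and reading off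
  the edge of the other tree at this vertex gives one jump each. The long forward jump is the
  shortcut for (i), the jump to position 1 is the return edge for (ii).\<close>

lemma jump:
  obtains \<delta> :: nat where "1 \<le> \<delta>"
    "\<And>f. (\<And>i. (f i, f (i + 1)) \<in> E) \<Longrightarrow> (f (int \<delta>), f 1) \<in> E \<and> (f 0, f (int \<delta> + 1)) \<in> E"
proof -
  obtain x p p' where x: "1 \<le> x" "x \<le> n" "(p, x) \<in> T" "(p', x) \<in> T'" "dep T x \<noteq> dep T' x"
    "dep T p = dep T' p" "dep T p' = dep T' p'" using first_difference by blast
  define a where "a = int (dep T x)"
  define b where "b = int (dep T' x)"
  have p: "int (dep T p) = a - 1" "int (dep T' p) = a - 1" "int (dep T' p') = b - 1" "int (dep T p') = b - 1"
    using A.dep_edge[OF x(3)] B.dep_edge[OF x(4)] x(6,7) unfolding a_def b_def by auto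
  have *: "(f (b - 1 + s), f (a + s)) \<in> E" "(f (a - 1 + s), f (b + s)) \<in> E"
    if f: "\<And>i. (f i, f (i + 1)) \<in> E" for f s
  proof -
    show "(f (b - 1 + s), f (a + s)) \<in> E"
      using same_edge[OF A.hom_level_int[of f E s, OF f] x(4)] p a_def by simp
    have "hom E T (\<lambda>x. f (int (dep T' x) + s))" using B.hom_level_int[of f E s, OF f] same by blast
    then show "(f (a - 1 + s), f (b + s)) \<in> E" using x(3) p b_def unfolding hom_def by fastforce
  qed
  show ?thesis
  proof (cases "a < b")
    case True
    show ?thesis
    proof (rule that[of "nat (b - a)"])
      fix f :: "int \<Rightarrow> 'v" assume "\<And>i. (f i, f (i + 1)) \<in> E"
      from *[where f = f and s = "1 - a", OF this]
      show "(f (int (nat (b - a))), f 1) \<in> E \<and> (f 0, f (int (nat (b - a)) + 1)) \<in> E"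
        using True by (simp add: algebra_simps)
    qed (use True in simp)
  next
    case False
    then have "b < a" using x(5) a_def b_def by simp
    show ?thesis
    proof (rule that[of "nat (a - b)"])
      fix f :: "int \<Rightarrow> 'v" assume "\<And>i. (f i, f (i + 1)) \<in> E"
      from *[where f = f and s = "1 - b", OF this]
      show "(f (int (nat (a - b))), f 1) \<in> E \<and> (f 0, f (int (nat (a - b)) + 1)) \<in> E"
        using \<open>b < a\<close> by (simp add: algebra_simps)
    qed (use \<open>b < a\<close> in simp)
  qed
qed

lemma whirls: "cond_whirl E"
  unfolding cond_whirl_def
proof (intro allI impI)
  fix u assume u: "cyc E u"
  obtain \<delta> :: nat where \<delta>: "1 \<le> \<delta>"
    "\<And>f. (\<And>i. (f i, f (i + 1)) \<in> E) \<Longrightarrow> (f (int \<delta>), f 1) \<in> E \<and> (f 0, f (int \<delta> + 1)) \<in> E"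
    using jump by blast
  show "\<exists>m c. whirl_coloring E (cls E u) m c"
  proof (rule whirl_of_shortcuts[OF u \<delta>(1)])
    fix x y assume K: "x \<in> cls E u" "y \<in> cls E u" and "(x, y) \<in> E ^^ Suc \<delta>"
    then obtain w where w: "w 0 = x" "w (Suc \<delta>) = y" "walkf E (Suc \<delta>) w"
      unfolding relpow_fun_conv walkf_def by blast
    have "cyc E (w (Suc \<delta>))" "cyc E (w 0)" using w K cyc_cls[OF u] by auto
    then obtain f :: "int \<Rightarrow> 'v" where f: "\<And>i. (f i, f (i + 1)) \<in> E"
      "\<And>i. i \<le> Suc \<delta> \<Longrightarrow> f (int i) = w i"
      using int_extend[OF w(3)] by metis
    have "(f 0, f (int \<delta> + 1)) \<in> E" using \<delta>(2)[of f, OF f(1)] by blast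
    then show "(x, y) \<in> E" using f(2)[of 0] f(2)[of "Suc \<delta>"] w by (simp add: add.commute)
  qed
qed

text \<open>Treats \<open>\<delta> = 1\<close>, where \<open>jump\<close> yields nothing but loops.
  Since \<open>x\<close> is too high in \<open>T\<close> to lie below \<open>p'\<close>, the edge
  from \<open>p'\<close> to \<open>x\<close> in \<open>T'\<close> runs from the part mapped to
  \<open>v\<close> to the part mapped to \<open>u\<close>.\<close>

lemma loops_back_aux:
  assumes loops: "(u, u) \<in> E" "(v, v) \<in> E" "(u, v) \<in> E"
    and x: "(p', x) \<in> T'" "dep T p' = dep T' p'" "dep T x < dep T' x"
  shows "(v, u) \<in> E"
proof -
  let ?\<phi> = "\<lambda>z. if z \<in> descs T p' then v else u"
  have "hom E T ?\<phi>" unfolding hom_def using loops A.descs_edge by auto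
  then have "(?\<phi> p', ?\<phi> x) \<in> E" using same_edge x by blast
  moreover have "x \<notin> descs T p'"
  proof
    assume "x \<in> descs T p'"
    then have "dep T p' < dep T x" using A.descs_dep_less B.edgeD[OF x(1)] by blast
    then show False using x B.dep_edge[OF x(1)] by simp
  qed
  ultimately show ?thesis by simp
qed

lemma loops_back:
  assumes loops: "(u, u) \<in> E" "(v, v) \<in> E" "(u, v) \<in> E"
  shows "(v, u) \<in> E"
proof -
  interpret S: tree_pair_same n T' T L E by (rule tree_pair_same_sym) unfold_locales
  obtain x p p' where x: "1 \<le> x" "x \<le> n" "(p, x) \<in> T" "(p', x) \<in> T'" "dep T x \<noteq> dep T' x"
    "dep T p = dep T' p" "dep T p' = dep T' p'" using first_difference by blast
  show ?thesis
  proof (cases "dep T x < dep T' x")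
    case True
    then show ?thesis using loops_back_aux[OF loops x(4)] x by simp
  next
    case False
    then show ?thesis using S.loops_back_aux[OF loops x(3)] x by simp
  qed
qed

lemma separated: "cond_sep E"
  unfolding cond_sep_def
proof (intro allI impI)
  fix u v assume uv: "cyc E u" "cyc E v" "(u, v) \<in> E\<^sup>*"
  show "(v, u) \<in> E\<^sup>*"
  proof (rule ccontr)
    assume "(v, u) \<notin> E\<^sup>*"
    then have "v \<notin> cls E u" by (simp add: cls_def)
    with uv(3) have "\<exists>a b. a \<in> cls E u \<and> (a, b) \<in> E \<and> b \<notin> cls E u \<and> (b, v) \<in> E\<^sup>*"
    proof (induction rule: rtrancl_induct)
      case (step y z)
      then show ?case by (cases "y \<in> cls E u") (blast intro: rtrancl_into_rtrancl)+
    qed simp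
    then obtain a b where ab: "a \<in> cls E u" "(a, b) \<in> E" "b \<notin> cls E u" "(b, v) \<in> E\<^sup>*" by blast
    obtain k w where w: "walkf E (Suc k) w" "w 0 = a" "w 1 = b" "w (Suc k) = v"
    proof -
      obtain k where "(b, v) \<in> E ^^ k" using ab(4) rtrancl_imp_relpow by blast
      then obtain g where g: "g 0 = b" "g k = v" "\<forall>i<k. (g i, g (Suc i)) \<in> E"
        unfolding relpow_fun_conv by blast
      have "walkf E (Suc k) (case_nat a g)"
        unfolding walkf_def using g ab by (auto split: nat.splits)
      then show ?thesis using that[of k "case_nat a g"] g by simp
    qed
    have "cyc E (w (Suc k))" "cyc E (w 0)" using w uv ab cyc_cls[OF uv(1)] by auto
    then obtain f :: "int \<Rightarrow> 'v" where f: "\<And>i. (f i, f (i + 1)) \<in> E"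
      "\<And>i. i \<le> Suc k \<Longrightarrow> f (int i) = w i"
      using int_extend[OF w(1)] by metis
    have f01: "f 0 = a" "f 1 = b" using f(2)[of 0] f(2)[of 1] w by auto
    have no_back: False if "(b, a) \<in> E\<^sup>*"
      using cls_between[OF ab(1,1) r_into_rtrancl[OF ab(2)] that] ab(3) by blast
    obtain \<delta> :: nat where \<delta>: "1 \<le> \<delta>"
      "\<And>f. (\<And>i. (f i, f (i + 1)) \<in> E) \<Longrightarrow> (f (int \<delta>), f 1) \<in> E \<and> (f 0, f (int \<delta> + 1)) \<in> E"
      using jump by blast
    \<comment> \<open>The walk is shifted by one so that the jump ends at \<open>a\<close>, just
      before the edge that leaves the component. For \<open>\<delta> \<ge> 2\<close> it starts at
      \<open>b\<close> or later, so it leads back into the component.\<close>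
    have j: "(f (int \<delta> - 1), f 0) \<in> E"
      using \<delta>(2)[of "\<lambda>i. f (i - 1)"] f(1) by (metis add_diff_cancel_right' add.commute diff_add_cancel diff_self)
    show False
    proof (cases "\<delta> = 1")
      case True
      then have "(a, a) \<in> E" using j f01 by simp
      moreover have "(b, b) \<in> E" using \<delta>(2)[of f, OF f(1)] True f01 by simp
      ultimately show False using loops_back ab(2) no_back by blast
    next
      case False
      have "(f 1, f (1 + int i)) \<in> E\<^sup>*" for i
      proof (induction i)
        case (Suc i)
        then show ?case using f(1)[of "1 + int i"] by (simp add: add.assoc add.commute)
      qed simp
      from this[of "\<delta> - 2"] have "(b, f (int \<delta> - 1)) \<in> E\<^sup>*"
        using False \<delta>(1) f01 by (simp add: of_nat_diff)
      then have "(b, a) \<in> E\<^sup>*" using j f01 by simp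
      then show False by (rule no_back)
    qed
  qed
qed

text \<open>With one vertex chosen for each residue, the depth in \<open>T\<close> becomes a
  homomorphism into the whirl. Being one on \<open>T'\<close> as well, it shows that the depth in
  \<open>T\<close> grows by 1 modulo \<open>m\<close> along the edges of \<open>T'\<close>.\<close>

lemma periods: "cond_M E n T T'"
  unfolding cond_M_def
proof (intro allI impI)
  fix u m c x assume col: "whirl_coloring E (cls E u) m c" and "1 \<le> x" "x \<le> n"
  have "\<exists>b. \<forall>i. b i \<in> cls E u \<and> int m dvd c (b i) - i"
    using col unfolding whirl_coloring_def by metis
  then obtain b where b: "\<And>i. b i \<in> cls E u" "\<And>i. int m dvd c (b i) - i" by blast
  have step: "(b i, b j) \<in> E \<longleftrightarrow> int m dvd j - i - 1" for i j
  proof -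
    have "(b i, b j) \<in> E \<longleftrightarrow> int m dvd c (b j) - c (b i) - 1"
      using col b(1) unfolding whirl_coloring_def by blast
    moreover have "int m dvd (c (b j) - j) - (c (b i) - i)" by (rule dvd_diff[OF b(2) b(2)])
    then have D: "int m dvd (c (b j) - c (b i) - 1) - (j - i - 1)" by (simp add: algebra_simps)
    ultimately show ?thesis using dvd_diff_cong[OF D] by simp
  qed
  have "hom E T (\<lambda>x. b (int (dep T x) + 0))"
    by (rule A.hom_level_int) (use step in simp)
  then have h: "hom E T (\<lambda>x. b (int (dep T x)))" by simp
  show "int m dvd int (dep T x) - int (dep T' x)"
    using \<open>1 \<le> x\<close> \<open>x \<le> n\<close>
  proof (induction x rule: less_induct)
    case (less x)
    show ?case
    proof (cases "x = 1")
      case False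
      then obtain p where p: "(p, x) \<in> T'" using B.parent_ex[of x] less.prems by auto
      have "int m dvd int (dep T x) - int (dep T p) - 1" using same_edge[OF h p] step by simp
      moreover have "int m dvd int (dep T p) - int (dep T' p)" using less.IH[of p] B.edgeD[OF p] by simp
      ultimately show ?thesis by (rule dvd_plus_eq) (use B.dep_edge[OF p] in simp)
    qed simp
  qed
qed

text \<open>Map the two parents of \<open>x\<close> to \<open>a\<close> and \<open>b\<close>, the
  subtree of \<open>x\<close> along \<open>v\<close>, and all else into the whirl by depth. By (iii)
  the parents have congruent depths in \<open>T\<close>, so this is a homomorphism on
  \<open>T\<close>, and the edge from \<open>p'\<close> to \<open>x\<close> is the claim.\<close>

lemma same_block:
  assumes u: "cyc E u" "whirl_coloring E (cls E u) m c" "a \<in> cls E u" "b \<in> cls E u" "int m dvd c a - c b"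
    and v: "(a, v 0) \<in> E" "walkf E k v"
    and x: "(p, x) \<in> T" "(p', x) \<in> T'" "p \<noteq> p'" "height T x \<le> k"
  shows "(b, v 0) \<in> E"
proof -
  have "\<exists>g. \<forall>i. g i \<in> cls E u \<and> int m dvd c (g i) - i"
    using u(2) unfolding whirl_coloring_def by metis
  then obtain g where g: "\<And>i. g i \<in> cls E u" "\<And>i. int m dvd c (g i) - i" by blast
  define C where "C = (\<lambda>y. if y = p then a else if y = p' then b else g (c a + int (dep T y) - int (dep T p)))"
  have xr: "1 \<le> x" "x \<le> n" using A.edgeD[OF x(1)] by auto
  have pr: "1 \<le> p'" "p' \<le> n" using B.edgeD[OF x(2)] by auto
  have M: "int m dvd int (dep T y) - int (dep T' y)" if "1 \<le> y" "y \<le> n" for y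
    using periods u that unfolding cond_M_def by blast
  have D: "int m dvd int (dep T p') - int (dep T p)"
    by (rule dvd_minus_eq[OF M[OF pr] M[OF xr]]) (use A.dep_edge[OF x(1)] B.dep_edge[OF x(2)] in simp)
  have "int m dvd c b - (c a + int (dep T p') - int (dep T p))"
    by (subst dvd_minus_iff[symmetric]) (rule dvd_plus_eq[OF D u(5)], simp)
  then have C: "C y \<in> cls E u \<and> int m dvd c (C y) - (c a + int (dep T y) - int (dep T p))" for y
    using g u(3,4) unfolding C_def by simp
  have "hom E T (graft T x v C)"
  proof (rule A.hom_graft[OF xr])
    show "walkf E (height T x) v" using v x(4) unfolding walkf_def by simp
    show "(C q, C y) \<in> E" if "(q, y) \<in> T" for q y
    proof -
      have "int m dvd c (C y) - c (C q) - 1"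
        by (rule dvd_minus_eq[OF conjunct2[OF C[of y]] conjunct2[OF C[of q]]]) (use A.dep_edge[OF that] in simp)
      then show ?thesis using u(2) C unfolding whirl_coloring_def by blast
    qed
    show "(C q, v 0) \<in> E" if "(q, x) \<in> T" for q
      using A.parent_unique[OF that x(1)] v unfolding C_def by simp
  qed
  then have "(graft T x v C p', graft T x v C x) \<in> E" using same_edge x by blast
  moreover have "p' \<notin> descs T x" using A.descs_le B.edgeD[OF x(2)] by fastforce
  ultimately show ?thesis using x(3) unfolding graft_def C_def by simp
qed

lemma whirl_paths: "cond_Z E T T'"
  unfolding cond_Z_def using same_block not_less by metis

text \<open>With the depth in \<open>T\<close> laid along \<open>v\<close>, an edge of
  \<open>T'\<close> that does not descend would close a walk and make a vertex of \<open>v\<close>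
  recurrent.\<close>

lemma pleasant_paths_aux:
  assumes v: "walkf E k v" "\<forall>i\<le>k. \<not> cyc E (v i)" and h: "height T 1 \<le> k"
  shows "shrinks T T' 1"
  unfolding shrinks_def
proof (intro allI impI conjI)
  fix q y assume e: "(q, y) \<in> T'"
  have r: "1 \<le> q" "q \<le> n" "1 \<le> y" "y \<le> n" using B.edgeD[OF e] by auto
  show "y \<in> descs T 1" using A.descs_root r by blast
  have "walkf E (height T 1) v" using v h unfolding walkf_def by simp
  then have "(v (dep T q), v (dep T y)) \<in> E" using same_edge[OF A.hom_level e] by blast
  moreover have "dep T y \<le> k" "dep T q \<le> k"
    using A.dep_le_height[of y 1] A.dep_le_height[of q 1] A.descs_root[of y] A.descs_root[of q] r h by simp_all
  ultimately show "dep T q < dep T y"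
    using v walkf_rtrancl[OF v(1), of "dep T y" "dep T q"] by (meson cycI(1) not_less)
qed

lemma pleasant_paths: "cond_P E T T'"
  unfolding cond_P_def
proof (intro allI impI)
  interpret S: tree_pair_same n T' T L E by (rule tree_pair_same_sym) unfold_locales
  have n: "1 \<le> n" using differ by auto
  fix k v assume v: "walkf E k v" "\<forall>i\<le>k. \<not> cyc E (v i)"
  show "k < height T 1 \<and> k < height T' 1"
  proof (rule ccontr)
    assume "\<not> ?thesis"
    then have "height T 1 \<le> k \<or> height T' 1 \<le> k" by auto
    then have "shrinks T T' 1 \<and> shrinks T' T 1"
      using pleasant_paths_aux[OF v] S.pleasant_paths_aux[OF v] shrinks_height S.shrinks_height n
      by (meson le_refl le_trans)
    then show False using subtree_eq_of_shrinks n root_not_eq by auto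
  qed
qed

text \<open>Vertices of depth at most \<open>L + 1\<close> are mapped before the end of the entry
  walk, where staying or going back would create recurrence. So edges of \<open>T'\<close> into such
  vertices increase the depth in \<open>T\<close>, and their depth in \<open>T'\<close> cannot be
  the larger one.\<close>

lemma entryways_aux:
  assumes v: "entry_walk E l v" "Suc (Suc L) \<le> l"
    and x: "1 \<le> x" "x \<le> n" "dep T x = Suc L" "Suc L < dep T' x"
  shows False
proof -
  obtain W where W: "\<And>i. (W i, W (Suc i)) \<in> E" "\<And>i. i \<le> l \<Longrightarrow> W i = v i"
    using forward_extend[of E l v] v(1) unfolding entry_walk_def by metis
  have Wwalk: "walkf E k W" for k using W unfolding walkf_def by simp
  \<comment> \<open>This shift places depth \<open>L + 2\<close> on the recurrent end of the entry
    walk.\<close>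
  define s where "s = l - Suc (Suc L)"
  have h: "hom E T (\<lambda>y. W (dep T y + s))"
    unfolding hom_def using W(1) A.dep_edge by auto
  have "dep T' y \<le> dep T y" if "1 \<le> y" "y \<le> n" "dep T y \<le> Suc L" for y
    using that
  proof (induction y rule: less_induct)
    case (less y)
    show ?case
    proof (cases "y = 1")
      case False
      then obtain q where q: "(q, y) \<in> T'" using B.parent_ex[of y] less.prems by auto
      have e: "(W (dep T q + s), W (dep T y + s)) \<in> E" using same_edge[OF h q] by simp
      have "dep T y + s < l" using less.prems(3) v(2) unfolding s_def by simp
      then have "\<not> cyc E (W (dep T y + s))" using W(2) v(1) unfolding entry_walk_def by simp
      then have "dep T q < dep T y"
        using walkf_rtrancl[OF Wwalk, of "dep T y + s" "dep T q + s"] cycI(2)[OF e]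
        by (meson add_le_cancel_right not_less order_refl)
      moreover from this have "dep T' q \<le> dep T q" using less B.edgeD[OF q] by simp
      ultimately show ?thesis using B.dep_edge[OF q] by simp
    qed simp
  qed
  then show False using x by fastforce
qed

lemma entryways: "cond_E E L"
  unfolding cond_E_def
proof (intro allI impI)
  interpret S: tree_pair_same n T' T L E by (rule tree_pair_same_sym) unfold_locales
  fix k v assume v: "entry_walk E k v"
  obtain x where x: "1 \<le> x" "x \<le> n" "dep T x \<noteq> dep T' x" "dep T x = Suc L \<or> dep T' x = Suc L"
    using differ by blast
  have "L < dep T x" "L < dep T' x" using deep_iff[OF x(1,2)] x(4) by auto
  then show "k \<le> Suc L"
    using entryways_aux[OF v _ x(1,2)] S.entryways_aux[OF v _ x(1,2)] x(3,4) by force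
qed

text \<open>The subtree of \<open>x\<close> runs along the outlet, the rest of the tree inside the
  component. An edge of \<open>T'\<close> that left the subtree or failed to descend would end where
  its starting point can be reached again, and so make a vertex of the outlet recurrent.\<close>

lemma outlets_aux:
  assumes v: "outlet_walk E k v" and x: "1 \<le> x" "x \<le> n" "height T x < k"
  shows "shrinks T T' x"
proof -
  have wk: "walkf E k v" and c0: "cyc E (v 0)" and nc: "\<And>i. 0 < i \<Longrightarrow> i \<le> k \<Longrightarrow> \<not> cyc E (v i)"
    using v unfolding outlet_walk_def by auto
  obtain f :: "int \<Rightarrow> 'v" where f: "\<And>i. (f i, f (i + 1)) \<in> E" "f 0 = v 0" "\<And>i. f i \<in> cls E (v 0)"
  proof -
    obtain m c where col: "whirl_coloring E (cls E (v 0)) m c" using whirls c0 unfolding cond_whirl_def by blast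
    then have "\<exists>g. \<forall>i. g i \<in> cls E (v 0) \<and> int m dvd c (g i) - i"
      unfolding whirl_coloring_def by metis
    then obtain g where g: "\<And>i. g i \<in> cls E (v 0)" "\<And>i. int m dvd c (g i) - i" by blast
    define f where "f = (\<lambda>i. if i = 0 then v 0 else g (i + c (v 0)))"
    have f: "f i \<in> cls E (v 0) \<and> int m dvd c (f i) - (i + c (v 0))" for i
      using g unfolding f_def by simp
    have "(f i, f (i + 1)) \<in> E" for i
    proof -
      have "int m dvd c (f (i + 1)) - c (f i) - 1"
        by (rule dvd_minus_eq[OF conjunct2[OF f[of "i + 1"]] conjunct2[OF f[of i]]]) simp
      then show ?thesis using col f unfolding whirl_coloring_def by blast
    qed
    then show ?thesis using that[of f] f unfolding f_def by simp
  qed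
  \<comment> \<open>The offset 1 puts the parent of \<open>x\<close> on \<open>v 0\<close>, so that
    the branch at \<open>x\<close> starts with \<open>v 1\<close>.\<close>
  define C where "C = (\<lambda>y. f (int (dep T y) - int (dep T x) + 1))"
  let ?\<phi> = "graft T x (\<lambda>i. v (Suc i)) C"
  have "hom E T ?\<phi>"
  proof (rule A.hom_graft[OF x(1,2)])
    show "walkf E (height T x) (\<lambda>i. v (Suc i))" using wk x(3) unfolding walkf_def by simp
    show "(C q, C y) \<in> E" if "(q, y) \<in> T" for q y
      using f(1)[of "int (dep T q) - int (dep T x) + 1"] A.dep_edge[OF that] unfolding C_def
      by (simp add: algebra_simps)
    show "(C q, v (Suc 0)) \<in> E" if "(q, x) \<in> T" for q
      using A.dep_edge[OF that] f(2) wk x(3) unfolding C_def walkf_def by simp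
  qed
  then have e: "(?\<phi> q, ?\<phi> y) \<in> E" if "(q, y) \<in> T'" for q y using same_edge that by blast
  show ?thesis
    unfolding shrinks_def
  proof (intro allI impI)
    fix q y assume q: "(q, y) \<in> T'" "q \<in> descs T x"
    have ind: "Suc (dep T z - dep T x) \<le> k" if "z \<in> descs T x" for z
      using A.dep_le_height[OF that x(1,2)] x(3) by simp
    have \<phi>q: "?\<phi> q = v (Suc (dep T q - dep T x))" using q unfolding graft_def by simp
    have ncq: "\<not> cyc E (?\<phi> q)" using nc ind[OF q(2)] \<phi>q by simp
    have y: "y \<in> descs T x"
    proof (rule ccontr)
      assume "y \<notin> descs T x"
      then have "?\<phi> y \<in> cls E (v 0)" using f(3) unfolding graft_def C_def by simp
      then have "(?\<phi> y, v 0) \<in> E\<^sup>*" by (simp add: cls_def)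
      moreover have "(v 0, ?\<phi> q) \<in> E\<^sup>*" using walkf_rtrancl[OF wk] ind[OF q(2)] \<phi>q by simp
      ultimately show False using cycI(1)[OF e[OF q(1)]] ncq by (meson rtrancl_trans)
    qed
    have \<phi>y: "?\<phi> y = v (Suc (dep T y - dep T x))" using y unfolding graft_def by simp
    have "dep T q < dep T y"
    proof (rule ccontr)
      assume "\<not> ?thesis"
      then have "(?\<phi> y, ?\<phi> q) \<in> E\<^sup>*" using walkf_rtrancl[OF wk] ind[OF q(2)] \<phi>q \<phi>y by simp
      then show False using cycI(1)[OF e[OF q(1)]] ncq by blast
    qed
    then show "y \<in> descs T x \<and> dep T q < dep T y" using y by blast
  qed
qed

lemma outlets: "cond_O E n T T'"
  unfolding cond_O_def
proof (intro allI impI)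
  interpret S: tree_pair_same n T' T L E by (rule tree_pair_same_sym) unfold_locales
  fix k v x assume v: "outlet_walk E k v" and x: "1 \<le> x" "x \<le> n" and "height T x < k \<or> height T' x < k"
  then have "shrinks T T' x \<and> shrinks T' T x"
    using outlets_aux[OF v x] S.outlets_aux[OF v x] shrinks_height S.shrinks_height x
    by (meson le_less_trans)
  then show "subtree_eq T T' x" using subtree_eq_of_shrinks x by blast
qed

end

section \<open>The conditions (x), (ix) and (viii)\<close>

lemma walk_color:
  assumes "whirl_coloring E K m c" "\<And>i. s \<le> i \<Longrightarrow> W i \<in> K" "\<And>i. (W i, W (Suc i)) \<in> E" "s \<le> j"
  shows "int m dvd c (W j) - c (W s) - (int j - int s)"
  using assms(4)
proof (induction j rule: dec_induct)
  case (step j)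
  have "int m dvd c (W (Suc j)) - c (W j) - 1"
    using assms(1,3) assms(2)[of j] assms(2)[of "Suc j"] step unfolding whirl_coloring_def by auto
  from dvd_plus_eq[OF this step.IH] show ?case by (simp add: algebra_simps)
qed simp

text \<open>The configuration counted by \<open>graph_omega\<close>. Both walks are indexed by
  absolute position, so \<open>v'\<close> is meaningful only from \<open>r - 1\<close> on.\<close>

definition fork :: "('v \<times> 'v) set \<Rightarrow> nat \<Rightarrow> nat \<Rightarrow> nat \<Rightarrow> (nat \<Rightarrow> 'v) \<Rightarrow> (nat \<Rightarrow> 'v) \<Rightarrow> bool" where
  "fork E l r m v v' \<longleftrightarrow> 1 \<le> r \<and> r \<le> l \<and> walkf E l v \<and> cyc E (v l) \<and> l \<le> m \<and> v' (r - 1) = v (r - 1) \<and>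
     (\<forall>i. r - 1 \<le> i \<and> i < m \<longrightarrow> (v' i, v' (Suc i)) \<in> E) \<and> \<not> cyc E (v' l)"

context tree_pair_same
begin

text \<open>The parent of \<open>x\<close> in \<open>T\<close> has depth \<open>L\<close> and goes
  to \<open>u L\<close>, while the parent in \<open>T'\<close> is deeper and goes into the block of
  \<open>w\<close>. If only \<open>u L\<close> is adjacent to \<open>v 0\<close>, a homomorphism on
  \<open>T\<close> with \<open>v\<close> below \<open>x\<close> carries the adjacency to that block
  and \<open>same_block\<close> to \<open>w\<close>; if only \<open>w\<close> is, the same works
  backwards from \<open>T'\<close>.\<close>

lemma lambda_aux:
  assumes u: "entry_walk E (Suc L) u" and w: "w \<in> cls E (u (Suc L))" "(w, u (Suc L)) \<in> E"
    and v: "walkf E k v" "((w, v 0) \<in> E) \<noteq> ((u L, v 0) \<in> E)"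
    and x: "1 \<le> x" "x \<le> n" "dep T x = Suc L" "Suc L < dep T' x"
    and k: "height T x \<le> k" "height T' x \<le> k"
  shows False
proof -
  let ?K = "cls E (u (Suc L))"
  have c: "cyc E (u (Suc L))" using u unfolding entry_walk_def by blast
  obtain m c where col: "whirl_coloring E ?K m c" using whirls c unfolding cond_whirl_def by blast
  obtain W where W: "\<And>i. (W i, W (Suc i)) \<in> E" "\<And>i. i \<le> Suc L \<Longrightarrow> W i = u i" "\<And>i. Suc L \<le> i \<Longrightarrow> W i \<in> ?K"
    using forward_extend[of E "Suc L" u] u unfolding entry_walk_def by metis
  obtain p p' where p: "(p, x) \<in> T" "(p', x) \<in> T'"
    using A.parent_ex[of x] B.parent_ex[of x] x by (cases "x = 1") auto
  have pr: "1 \<le> p" "p \<le> n" "1 \<le> p'" "p' \<le> n" "p < x" "p' < x" using A.edgeD[OF p(1)] B.edgeD[OF p(2)] by auto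
  have dp: "dep T p = L" "dep T' p = L" using A.dep_edge[OF p(1)] x(3) agree[of p] pr by auto
  have dp': "Suc (dep T' p') = dep T' x" "L < dep T' p'" "L < dep T p'"
    using B.dep_edge[OF p(2)] x(4) deep_iff[of p'] pr by auto
  have pp: "p \<noteq> p'" using dp dp' by auto
  have M: "int m dvd int (dep T y) - int (dep T' y)" if "1 \<le> y" "y \<le> n" for y
    using periods c col that unfolding cond_M_def by blast
  have cw: "int m dvd c (u (Suc L)) - c w - 1"
    using col w unfolding whirl_coloring_def by simp
  have block: "int m dvd c (W j) - c w" if "Suc L \<le> j" "int m dvd int j - int L" for j
  proof -
    have "int m dvd c (W j) - c (W (Suc L)) - (int j - int (Suc L))"
      by (rule walk_color[OF col]) (use W that in auto)
    then have "int m dvd c (W j) - c (u (Suc L)) - (int j - int (Suc L))" using W(2) by simp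
    from dvd_plus_eq[OF this cw] have "int m dvd c (W j) - c w - (int j - int L)"
      by (simp add: algebra_simps)
    from dvd_plus_eq[OF this that(2)] show ?thesis by simp
  qed
  have d1: "int m dvd int (dep T' p') - int L"
    by (rule dvd_minus_eq[OF dvd_0_right M[OF x(1,2)]]) (use dp' x(3) in simp)
  have d2: "int m dvd int (dep T p') - int L"
    by (rule dvd_plus_eq[OF M[OF pr(3,4)] d1]) simp
  show False
  proof (cases "(u L, v 0) \<in> E")
    case True
    then have wv: "(w, v 0) \<notin> E" using v by blast
    let ?\<phi> = "graft T x v (\<lambda>y. W (dep T y))"
    have "hom E T ?\<phi>"
    proof (rule A.hom_graft[OF x(1,2)])
      show "walkf E (height T x) v" using v k unfolding walkf_def by simp
      show "(W (dep T q), W (dep T y)) \<in> E" if "(q, y) \<in> T" for q y using W(1) A.dep_edge[OF that] by simp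
      show "(W (dep T q), v 0) \<in> E" if "(q, x) \<in> T" for q
        using True W(2) A.dep_edge[OF that] x(3) by simp
    qed
    then have "(?\<phi> p', ?\<phi> x) \<in> E" using same_edge p by blast
    moreover have "p' \<notin> descs T x" using A.descs_le pr by fastforce
    ultimately have "(W (dep T p'), v 0) \<in> E" unfolding graft_def by simp
    then show False
      using same_block[OF c col _ w(1) _ _ v(1) p pp k(1), of "W (dep T p')"] W(3) block d2 dp' wv by simp
  next
    case False
    then have wv: "(w, v 0) \<in> E" using v by blast
    let ?\<phi> = "graft T' x v (\<lambda>y. W (dep T' y))"
    have "hom E T' ?\<phi>"
    proof (rule B.hom_graft[OF x(1,2)])
      show "walkf E (height T' x) v" using v k unfolding walkf_def by simp
      show "(W (dep T' q), W (dep T' y)) \<in> E" if "(q, y) \<in> T'" for q y using W(1) B.dep_edge[OF that] by simp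
      show "(W (dep T' q), v 0) \<in> E" if "(q, x) \<in> T'" for q
      proof -
        have q: "q = p'" using B.parent_unique that p by blast
        have "int m dvd c (W (dep T' p')) - c w" using block d1 dp' by simp
        then have "int m dvd c w - c (W (dep T' p'))" by (simp only: dvd_diff_commute)
        then show ?thesis
          using same_block[OF c col w(1) _ _ wv v(1) p pp k(1), of "W (dep T' p')"] W(3) dp' q by simp
      qed
    qed
    then have "(?\<phi> p, ?\<phi> x) \<in> E" using same p unfolding hom_def by blast
    moreover have "p \<notin> descs T' x" using B.descs_le pr by fastforce
    ultimately have "(u L, v 0) \<in> E" using dp W(2) unfolding graft_def by simp
    then show False using False by blast
  qed
qed

lemma lambda_walks: "cond_lambda E n T T' L"
  unfolding cond_lambda_def
proof (intro allI impI)
  interpret S: tree_pair_same n T' T L E by (rule tree_pair_same_sym) unfold_locales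
  fix u w k v x
  assume u: "entry_walk E (Suc L) u" "w \<in> cls E (u (Suc L))" "(w, u (Suc L)) \<in> E"
    "walkf E k v" "((w, v 0) \<in> E) \<noteq> ((u L, v 0) \<in> E)"
    and x: "1 \<le> x" "x \<le> n" "dep T x \<noteq> dep T' x" "dep T x = Suc L \<or> dep T' x = Suc L"
  have "L < dep T x" "L < dep T' x" using deep_iff[OF x(1,2)] x(4) by auto
  then have d: "dep T x = Suc L \<and> Suc L < dep T' x \<or> dep T' x = Suc L \<and> Suc L < dep T x"
    using x(3,4) by linarith
  show "k < max (height T x) (height T' x)"
  proof (rule ccontr)
    assume "\<not> ?thesis"
    then have k: "height T x \<le> k" "height T' x \<le> k" by auto
    show False
      using d lambda_aux[OF u x(1,2)] S.lambda_aux[OF u x(1,2)] k by blast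
  qed
qed

text \<open>Outside the subtree of \<open>x\<close> the tree follows the recurrent walk of the fork,
  inside it the other one. As \<open>x\<close> has depth at most \<open>r\<close>, its parent is
  still on the common part.\<close>

lemma fork_hom:
  assumes fork: "fork E (Suc L) r m v v'"
    and x: "1 \<le> x" "x \<le> n" "dep T x \<le> r" "dep T x + height T x \<le> m"
  obtains \<phi> w where "hom E T \<phi>" "walkf E m w" "\<And>y. y \<in> descs T x \<Longrightarrow> \<phi> y = w (dep T y)"
    "\<And>y. y \<notin> descs T x \<Longrightarrow> L < dep T y \<Longrightarrow> cyc E (\<phi> y)"
    "\<And>i s. Suc L \<le> i \<Longrightarrow> i \<le> m \<Longrightarrow> (w i, s) \<in> E\<^sup>* \<Longrightarrow> \<not> cyc E s"
proof -
  have r: "1 \<le> r" "r \<le> Suc L" and v: "walkf E (Suc L) v" "cyc E (v (Suc L))" and m: "Suc L \<le> m"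
    and v': "v' (r - 1) = v (r - 1)" "\<And>i. r - 1 \<le> i \<Longrightarrow> i < m \<Longrightarrow> (v' i, v' (Suc i)) \<in> E"
    and nc: "\<not> cyc E (v' (Suc L))"
    using fork unfolding fork_def by auto
  define w where "w = (\<lambda>i. if i < r then v i else v' i)"
  have w: "walkf E m w"
    unfolding walkf_def
  proof (intro allI impI)
    fix i assume i: "i < m"
    consider "Suc i < r" | "Suc i = r" | "r \<le> i" by linarith
    then show "(w i, w (Suc i)) \<in> E"
    proof cases
      case 1
      then show ?thesis using v r unfolding w_def walkf_def by simp
    next
      case 2
      then show ?thesis using v'(1) v'(2)[of i] i unfolding w_def by auto
    next
      case 3
      then show ?thesis using v'(2)[of i] i unfolding w_def by simp
    qed
  qed
  have wL: "\<not> cyc E (w (Suc L))" using nc r unfolding w_def by simp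
  \<comment> \<open>If recurrence were reachable from position \<open>L + 1\<close> or later, then
    either some earlier vertex is recurrent and by (ii) so is position \<open>L + 1\<close>, or the
    walk extends to an entry walk too long for (v).\<close>
  have dead: "\<not> cyc E s" if i: "Suc L \<le> i" "i \<le> m" "(w i, s) \<in> E\<^sup>*" for i s
  proof
    assume s: "cyc E s"
    have ws: "(w (Suc L), s) \<in> E\<^sup>*" using walkf_rtrancl[OF w i(1,2)] i(3) by (rule rtrancl_trans)
    have "\<not> cyc E (w j)" if "j \<le> Suc L" for j
    proof
      assume "cyc E (w j)"
      moreover have jL: "(w j, w (Suc L)) \<in> E\<^sup>*" using walkf_rtrancl[OF w that m] .
      ultimately have "(s, w j) \<in> E\<^sup>*" using separated s ws unfolding cond_sep_def by (meson rtrancl_trans)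
      then have "(s, w (Suc L)) \<in> E\<^sup>*" using jL by (rule rtrancl_trans)
      then have "cyc E (w (Suc L))" using ws s by (meson rtrancl_trancl_trancl trancl_rtrancl_trancl)
      then show False using wL by blast
    qed
    moreover have "walkf E (Suc L) w" using w m unfolding walkf_def by simp
    ultimately obtain k e where "Suc L < k" "entry_walk E k e"
      using entry_walk_extend[of E "Suc L" w s] ws s by blast
    then show False using entryways unfolding cond_E_def by fastforce
  qed
  obtain W where W: "\<And>i. (W i, W (Suc i)) \<in> E" "\<And>i. i \<le> Suc L \<Longrightarrow> W i = v i"
    "\<And>i. Suc L \<le> i \<Longrightarrow> W i \<in> cls E (v (Suc L))"
    using forward_extend[OF v] by metis
  let ?\<phi> = "graft T x (\<lambda>i. w (dep T x + i)) (\<lambda>y. W (dep T y))"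
  have "hom E T ?\<phi>"
  proof (rule A.hom_graft[OF x(1,2)])
    show "walkf E (height T x) (\<lambda>i. w (dep T x + i))" using w x(4) unfolding walkf_def by simp
    show "(W (dep T q), W (dep T y)) \<in> E" if "(q, y) \<in> T" for q y using W(1) A.dep_edge[OF that] by simp
    show "(W (dep T q), w (dep T x + 0)) \<in> E" if "(q, x) \<in> T" for q
    proof -
      have d: "dep T x = Suc (dep T q)" using A.dep_edge[OF that] .
      then have "W (dep T q) = w (dep T q)" using W(2) x(3) r unfolding w_def by simp
      then show ?thesis using w d x(4) unfolding walkf_def by simp
    qed
  qed
  moreover have "?\<phi> y = w (dep T y)" if "y \<in> descs T x" for y
    using that A.descs_dep[OF that] unfolding graft_def by simp
  moreover have "cyc E (?\<phi> y)" if "y \<notin> descs T x" "L < dep T y" for y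
    using that W(3)[of "dep T y"] cyc_cls[OF v(2)] unfolding graft_def by simp
  ultimately show ?thesis using that w dead by blast
qed

text \<open>Deep vertices outside the subtree have recurrent images, which cannot be reached from
  deep vertices inside; an edge of \<open>T'\<close> between deep vertices that does not descend
  would create recurrence. Up to depth \<open>L\<close> the trees agree anyway.\<close>

lemma fork_shrinks:
  assumes fork: "fork E (Suc L) r m v v'"
    and x: "1 \<le> x" "x \<le> n" "dep T x \<le> r" "dep T x + height T x \<le> m"
  shows "shrinks T T' x"
proof -
  have r: "r \<le> Suc L" using fork unfolding fork_def by blast
  obtain \<phi> w where \<phi>: "hom E T \<phi>" and w: "walkf E m w" and in_x: "\<And>y. y \<in> descs T x \<Longrightarrow> \<phi> y = w (dep T y)"
    and out_x: "\<And>y. y \<notin> descs T x \<Longrightarrow> L < dep T y \<Longrightarrow> cyc E (\<phi> y)"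
    and dead: "\<And>i s. Suc L \<le> i \<Longrightarrow> i \<le> m \<Longrightarrow> (w i, s) \<in> E\<^sup>* \<Longrightarrow> \<not> cyc E s"
    using fork_hom[OF fork x] by blast
  show ?thesis
    unfolding shrinks_def
  proof (intro allI impI)
    fix q y assume q: "(q, y) \<in> T'" "q \<in> descs T x"
    have e: "(\<phi> q, \<phi> y) \<in> E" using same_edge[OF \<phi> q(1)] .
    have range: "1 \<le> q" "q \<le> n" "1 \<le> y" "y \<le> n" using B.edgeD[OF q(1)] by auto
    have bound: "dep T z \<le> m" if "z \<in> descs T x" for z
      using A.dep_le_height[OF that x(1,2)] x(4) by simp
    have y: "y \<in> descs T x"
    proof (cases "dep T x \<le> L")
      case True
      then show ?thesis using shallow_descs[OF x(1,2)] B.descs_edge q by blast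
    next
      case False
      then have dq: "L < dep T q" using A.descs_dep[OF q(2)] by simp
      then have dy: "L < dep T y" using deep_iff range B.dep_edge[OF q(1)] by simp
      show ?thesis
      proof (rule ccontr)
        assume "y \<notin> descs T x"
        then have "cyc E (\<phi> y)" using out_x dy by blast
        moreover have "\<phi> q = w (dep T q)" using in_x q by blast
        ultimately show False using dead[of "dep T q" "\<phi> y"] dq bound[OF q(2)] e by auto
      qed
    qed
    have "dep T q < dep T y"
    proof (rule ccontr)
      assume le: "\<not> dep T q < dep T y"
      show False
      proof (cases "dep T' y \<le> L")
        case True
        then show False using le agree[of q] agree[of y] range B.dep_edge[OF q(1)] by simp
      next
        case False
        then have dy: "L < dep T y" using deep_iff range by simp
        have "(\<phi> y, \<phi> q) \<in> E\<^sup>*"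
          using walkf_rtrancl[OF w, of "dep T y" "dep T q"] le bound[OF q(2)] in_x y q by simp
        then have "cyc E (\<phi> q)" using cycI(1)[OF e] by blast
        then show False using dead[of "dep T q" "\<phi> q"] in_x[OF q(2)] bound[OF q(2)] le dy by simp
      qed
    qed
    then show "y \<in> descs T x \<and> dep T q < dep T y" using y by blast
  qed
qed

text \<open>Here the bound on depth plus height does not carry over to \<open>T'\<close>. But the
  parent of \<open>x\<close> in \<open>T'\<close> is deep and has a recurrent image, so the
  nonrecurrent walk from position \<open>L + 1\<close> on completes to an outlet of length
  \<open>m - L\<close>, and (vi) applies.\<close>

lemma fork_outlet:
  assumes fork: "fork E (Suc L) r m v v'"
    and x: "1 \<le> x" "x \<le> n" "dep T x \<le> r" "dep T x + height T x \<le> m" "dep T x = Suc L" "Suc L < dep T' x"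
  shows "subtree_eq T T' x"
proof -
  obtain \<phi> w where \<phi>: "hom E T \<phi>" and w: "walkf E m w" and in_x: "\<And>y. y \<in> descs T x \<Longrightarrow> \<phi> y = w (dep T y)"
    and out_x: "\<And>y. y \<notin> descs T x \<Longrightarrow> L < dep T y \<Longrightarrow> cyc E (\<phi> y)"
    and dead: "\<And>i s. Suc L \<le> i \<Longrightarrow> i \<le> m \<Longrightarrow> (w i, s) \<in> E\<^sup>* \<Longrightarrow> \<not> cyc E s"
    using fork_hom[OF fork x(1-4)] by blast
  obtain p where p: "(p, x) \<in> T'" using B.parent_ex[of x] x by (cases "x = 1") auto
  have "p \<notin> descs T x" using A.descs_le[of p x] B.edgeD[OF p] by auto
  moreover have "L < dep T p" using B.dep_edge[OF p] x(6) deep_iff[of p] B.edgeD[OF p] by simp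
  ultimately have cp: "cyc E (\<phi> p)" using out_x by blast
  have e: "(\<phi> p, w (Suc L)) \<in> E" using same_edge[OF \<phi> p] in_x[of x] x(5) by simp
  have "outlet_walk E (m - L) (case_nat (\<phi> p) (\<lambda>i. w (Suc L + i)))"
    unfolding outlet_walk_def walkf_def
  proof (intro conjI allI impI)
    fix i assume "i < m - L"
    then show "(case_nat (\<phi> p) (\<lambda>i. w (Suc L + i)) i, case_nat (\<phi> p) (\<lambda>i. w (Suc L + i)) (Suc i)) \<in> E"
      using e w unfolding walkf_def by (cases i) auto
  next
    fix i assume "0 < i \<and> i \<le> m - L"
    then obtain j where "i = Suc j" "Suc L + j \<le> m" by (cases i) auto
    then show "\<not> cyc E (case_nat (\<phi> p) (\<lambda>i. w (Suc L + i)) i)" using dead[of "Suc L + j"] by simp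
  qed (use cp in simp)
  moreover have "height T x < m - L" using x(4,5) by simp
  ultimately show ?thesis using outlets x(1,2) unfolding cond_O_def by blast
qed

text \<open>Unless \<open>fork_outlet\<close> applies, \<open>x\<close> has the same depth in both
  trees. By \<open>shrinks_height\<close> the bound on depth plus height then holds in
  \<open>T'\<close> as well, and shrinking follows in the other direction.\<close>

lemma fork_subtree_eq:
  assumes fork: "fork E (Suc L) r m v v'"
    and x: "1 \<le> x" "x \<le> n" "dep T x \<le> r" "dep T x + height T x \<le> m"
  shows "subtree_eq T T' x"
proof -
  interpret S: tree_pair_same n T' T L E by (rule tree_pair_same_sym) unfold_locales
  have r: "r \<le> Suc L" using fork unfolding fork_def by blast
  show ?thesis
  proof (cases "dep T x = Suc L \<and> Suc L < dep T' x")
    case True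
    then show ?thesis using fork_outlet[OF fork x] by blast
  next
    case False
    then have d: "dep T' x = dep T x"
      using agree[OF x(1,2)] deep_iff[OF x(1,2)] x(3) r by (cases "dep T x \<le> L") auto
    have s: "shrinks T T' x" by (rule fork_shrinks[OF fork x])
    have "shrinks T' T x"
      by (rule S.fork_shrinks[OF fork x(1,2)]) (use d x(3,4) shrinks_height[OF s x(1,2)] in auto)
    then show ?thesis using subtree_eq_of_shrinks s x by blast
  qed
qed

lemma omega_walks: "cond_omega E n T T' L"
  unfolding cond_omega_def
proof (intro allI impI)
  interpret S: tree_pair_same n T' T L E by (rule tree_pair_same_sym) unfold_locales
  fix r m v v' x
  assume "1 \<le> r" "r \<le> Suc L" "walkf E (Suc L) v" "cyc E (v (Suc L))" "Suc L \<le> m" "v' (r - 1) = v (r - 1)"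
    "\<forall>i. r - 1 \<le> i \<and> i < m \<longrightarrow> (v' i, v' (Suc i)) \<in> E" "\<not> cyc E (v' (Suc L))"
  then have fork: "fork E (Suc L) r m v v'" unfolding fork_def by blast
  assume x: "1 \<le> x" "x \<le> n" "\<not> subtree_eq T T' x"
  then show "(dep T x \<le> r \<longrightarrow> m < dep T x + height T x) \<and> (dep T' x \<le> r \<longrightarrow> m < dep T' x + height T' x)"
    using fork_subtree_eq[OF fork x(1,2)] S.fork_subtree_eq[OF fork x(1,2)] subtree_eq_sym not_less by metis
qed

text \<open>Followed by \<open>a\<close>, the walk is an entry walk, so \<open>m \<le> L\<close> by
  (v). In the case \<open>m = L\<close>, walks of any length start at \<open>b\<close>, which is
  adjacent from \<open>v L\<close> but, by (ii), not from a predecessor of \<open>a\<close> in its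
  component; this violates (x).\<close>

lemma branches: "cond_B E L"
  unfolding cond_B_def
proof (intro allI impI)
  fix m v a b
  assume v: "walkf E m v" "(v m, a) \<in> E" "(v m, b) \<in> E" and ab: "cyc E a" "cyc E b" "(a, b) \<notin> E\<^sup>* \<or> (b, a) \<notin> E\<^sup>*"
  have sep: "(q, p) \<in> E\<^sup>*" if "cyc E p" "cyc E q" "(p, q) \<in> E\<^sup>*" for p q
    using separated that unfolding cond_sep_def by blast
  have nc: "\<not> cyc E (v i)" if "i \<le> m" for i
  proof
    assume c: "cyc E (v i)"
    have "(v i, a) \<in> E\<^sup>*" "(v i, b) \<in> E\<^sup>*" using walkf_rtrancl[OF v(1) that order_refl] v(2,3) by auto
    then show False using sep[OF c] ab by (meson rtrancl_trans)
  qed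
  show "m < L"
  proof (rule ccontr)
    assume "\<not> m < L"
    have e: "entry_walk E (Suc m) (v(Suc m := a))"
      using v nc ab unfolding entry_walk_def walkf_def by (auto simp: less_Suc_eq)
    then have "Suc m \<le> Suc L" using entryways unfolding cond_E_def by blast
    then have m: "m = L" using \<open>\<not> m < L\<close> by simp
    obtain w where w: "w \<in> cls E a" "(w, a) \<in> E" using cyc_predecessor[OF ab(1)] by blast
    obtain F where F: "F 0 = b" "\<And>i. (F i, F (Suc i)) \<in> E" using cyc_forward_walk[OF ab(2) self_cls] by metis
    obtain x where x: "1 \<le> x" "x \<le> n" "dep T x \<noteq> dep T' x" "dep T x = Suc L \<or> dep T' x = Suc L"
      using differ by blast
    have "(w, b) \<notin> E"
    proof
      assume "(w, b) \<in> E"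
      then have "(a, b) \<in> E\<^sup>*" using w(1) unfolding cls_def by auto
      then show False using sep[OF ab(1,2)] ab(3) by blast
    qed
    moreover have "walkf E (max (height T x) (height T' x)) F" using F unfolding walkf_def by simp
    ultimately have "max (height T x) (height T' x) < max (height T x) (height T' x)"
      using cond_lambdaD[OF lambda_walks e[unfolded m], of w _ F x] w x F v(3) m by auto
    then show False by simp
  qed
qed

lemma all_conds: "conds E n T T' L"
  unfolding conds_def
  using whirls separated periods pleasant_paths entryways outlets whirl_paths omega_walks lambda_walks by blast

end

theorem (in tree_pair) same_homs_iff:
  "(\<forall>\<phi>. hom E T \<phi> \<longleftrightarrow> hom E T' \<phi>) \<longleftrightarrow> conds E n T T' L \<and> cond_B E L"
proof
  assume "\<forall>\<phi>. hom E T \<phi> \<longleftrightarrow> hom E T' \<phi>"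
  then interpret tree_pair_same n T T' L E by unfold_locales blast
  show "conds E n T T' L \<and> cond_B E L" using all_conds branches by blast
next
  interpret S: tree_pair n T' T L by (rule tree_pair_sym) unfold_locales
  assume "conds E n T T' L \<and> cond_B E L"
  then show "\<forall>\<phi>. hom E T \<phi> \<longleftrightarrow> hom E T' \<phi>"
    using hom_transfer S.hom_transfer conds_sym by blast
qed

section \<open>Graph algebras and list walks\<close>

text \<open>\<open>L + 1\<close> is the least depth taken by a vertex whose depths differ; it is
  positive because only the root has depth 0.\<close>

lemma dfs_trees_pair:
  assumes "dfs_tree n T" "dfs_tree n T'" "T \<noteq> T'"
  obtains L where "tree_pair n T T' L"
proof -
  interpret A: dfs_tree n T by fact
  interpret B: dfs_tree n T' by fact
  define Q where "Q = (\<lambda>l. \<exists>x. 1 \<le> x \<and> x \<le> n \<and> dep T x \<noteq> dep T' x \<and> (dep T x = l \<or> dep T' x = l))"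
  have "\<exists>x. 1 \<le> x \<and> x \<le> n \<and> dep T x \<noteq> dep T' x"
    using dfs_tree_dep_eqI[OF assms(1,2)] assms(3) by blast
  then have ex: "\<exists>l. Q l" unfolding Q_def by blast
  define l where "l = (LEAST l. Q l)"
  have l: "Q l" unfolding l_def using ex by (rule LeastI_ex)
  have "l \<noteq> 0"
  proof
    assume "l = 0"
    then obtain x where x: "1 \<le> x" "x \<le> n" "dep T x \<noteq> dep T' x" "dep T x = 0 \<or> dep T' x = 0"
      using l unfolding Q_def by blast
    then have "x = 1" using A.dep_pos[of x] B.dep_pos[of x] by (cases "x = 1") auto
    then show False using x by simp
  qed
  then obtain L where L: "l = Suc L" by (cases l) auto
  have "tree_pair n T T' L"
  proof
    show "dep T x = dep T' x" if "1 \<le> x" "x \<le> n" "dep T x \<le> L \<or> dep T' x \<le> L" for x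
    proof (rule ccontr)
      assume ne: "dep T x \<noteq> dep T' x"
      then have "Q (dep T x)" "Q (dep T' x)" using that unfolding Q_def by blast+
      then have "l \<le> dep T x" "l \<le> dep T' x" unfolding l_def by (simp_all add: Least_le)
      then show False using that L by simp
    qed
    show "\<exists>x. 1 \<le> x \<and> x \<le> n \<and> dep T x \<noteq> dep T' x \<and> (dep T x = Suc L \<or> dep T' x = Suc L)"
      using l L unfolding Q_def by simp
  qed
  then show ?thesis using that by blast
qed

lemma lmv_in_leaves: "lmv t \<in> set (leaves t)"
  by (induction t) auto

text \<open>A product equals its left factor or \<open>None\<close>. So the only possible value is
  that of the leftmost variable, and each product contributes the test of one tree edge.\<close>

lemma ga_eval_eq:
  assumes "E \<subseteq> V \<times> V" "\<And>i. f i \<in> insert None (Some ` V)"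
  shows "ga_eval V E f t = (if (\<forall>i\<in>set (leaves t). f i \<noteq> None) \<and>
     (\<forall>(p, x)\<in>tedges t. (the (f p), the (f x)) \<in> E) then f (lmv t) else None)"
proof (induction t)
  case (App a b)
  let ?P = "\<lambda>t. (\<forall>i\<in>set (leaves t). f i \<noteq> None) \<and> (\<forall>(p, x)\<in>tedges t. (the (f p), the (f x)) \<in> E)"
  show ?case
  proof (cases "?P a \<and> ?P b")
    case True
    then obtain x y where "f (lmv a) = Some x" "f (lmv b) = Some y" using lmv_in_leaves by blast
    then show ?thesis using App True assms(1) by (auto simp: ga_mult_def)
  next
    case False
    then have "\<not> ?P (App a b)" by auto
    moreover have "ga_eval V E f a = None \<or> ga_eval V E f b = None" using App False by auto
    then have "ga_eval V E f (App a b) = None" by (auto simp: ga_mult_def split: option.splits)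
    ultimately show ?thesis by (simp only: if_False)
  qed
qed auto

lemma ga_satisfies_iff:
  assumes E: "E \<subseteq> V \<times> V" and t: "t \<in> bracketings n" "t' \<in> bracketings n" and n: "2 \<le> n"
  shows "ga_satisfies V E t t' \<longleftrightarrow> (\<forall>\<phi>. hom E (tedges t) \<phi> \<longleftrightarrow> hom E (tedges t') \<phi>)"
proof -
  have leaves: "leaves t = [1..<Suc n]" "leaves t' = [1..<Suc n]" using t by (auto simp: bracketings_def)
  have set_leaves: "set (leaves t) = {1..n}" "set (leaves t') = {1..n}" using leaves by auto
  have lmv: "lmv t = 1" "lmv t' = 1" using leaves n by (auto simp: lmv_leaves upt_rec)
  have eval: "ga_eval V E f s = (if (\<forall>i\<in>{1..n}. f i \<noteq> None) \<and> hom E (tedges s) (\<lambda>i. the (f i)) then f 1 else None)"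
    if "\<And>i. f i \<in> insert None (Some ` V)" "s = t \<or> s = t'" for f s
  proof -
    have "set (leaves s) = {1..n}" "lmv s = 1" using that(2) set_leaves lmv by auto
    then show ?thesis using ga_eval_eq[OF E, of f s] that(1) by (simp only: hom_def)
  qed
  \<comment> \<open>For \<open>2 \<le> n\<close> every variable is incident with an edge, so on
    \<open>{1..n}\<close> a homomorphism automatically takes values in \<open>V\<close> and is an
    assignment into the graph algebra.\<close>
  have inV: "\<phi> i \<in> V" if h: "hom E (tedges s) \<phi>" and s: "s = t \<or> s = t'" and i: "i \<in> {1..n}" for \<phi> s i
  proof -
    interpret dfs_tree n "tedges s" using s t bracketing_dfs_tree by blast
    show ?thesis
    proof (cases "i = 1")
      case True
      obtain p where p: "(p, 2) \<in> tedges s" using parent_ex[of 2] n by auto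
      then have "p = 1" using edgeD[OF p] by simp
      then show ?thesis using h p E True unfolding hom_def by auto
    next
      case False
      then obtain p where "(p, i) \<in> tedges s" using parent_ex[of i] i by auto
      then show ?thesis using h E unfolding hom_def by auto
    qed
  qed
  show ?thesis
  proof
    assume sat: "ga_satisfies V E t t'"
    have "hom E (tedges s') \<phi>"
      if h: "hom E (tedges s) \<phi>" and s: "s = t \<and> s' = t' \<or> s = t' \<and> s' = t" for s s' \<phi>
    proof -
      define f where "f = (\<lambda>i. if \<phi> i \<in> V then Some (\<phi> i) else None)"
      have f: "f i \<in> insert None (Some ` V)" for i unfolding f_def by simp
      have fi: "f i = Some (\<phi> i)" if "i \<in> {1..n}" for i using inV[OF h _ that] s unfolding f_def by auto
      have hom_f: "hom E (tedges u) (\<lambda>i. the (f i)) \<longleftrightarrow> hom E (tedges u) \<phi>" if "u = t \<or> u = t'" for u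
      proof -
        have "p \<in> {1..n} \<and> x \<in> {1..n}" if "(p, x) \<in> tedges u" for p x
          using tedges_leaves[OF that] \<open>u = t \<or> u = t'\<close> set_leaves by auto
        then show ?thesis unfolding hom_def using fi by fastforce
      qed
      have "ga_eval V E f s = ga_eval V E f s'" using sat f s unfolding ga_satisfies_def by metis
      moreover have "ga_eval V E f s = f 1" using eval[OF f, of s] s hom_f[of s] h fi by auto
      ultimately have "ga_eval V E f s' \<noteq> None" using fi[of 1] n by simp
      then show ?thesis using eval[OF f, of s'] s hom_f[of s'] by (auto split: if_splits)
    qed
    then show "\<forall>\<phi>. hom E (tedges t) \<phi> \<longleftrightarrow> hom E (tedges t') \<phi>" by blast
  next
    assume "\<forall>\<phi>. hom E (tedges t) \<phi> \<longleftrightarrow> hom E (tedges t') \<phi>"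
    then show "ga_satisfies V E t t'" unfolding ga_satisfies_def using eval by auto
  qed
qed

section \<open>Block partitions and colourings\<close>

lemma whirl_coloring_of_is_whirl:
  assumes "is_whirl E K m B"
  shows "\<exists>c. whirl_coloring E K m c \<and> (\<forall>i<m. \<forall>a\<in>B i. c a = int i)"
proof -
  have m: "1 \<le> m" and ne: "\<And>i. i < m \<Longrightarrow> B i \<noteq> {}"
    and disj: "\<And>i j. i < m \<Longrightarrow> j < m \<Longrightarrow> i \<noteq> j \<Longrightarrow> B i \<inter> B j = {}"
    and un: "(\<Union>i<m. B i) = K" and edges: "Restr E K = (\<Union>i<m. B i \<times> B (Suc i mod m))"
    using assms unfolding is_whirl_def by auto
  define c where "c = (\<lambda>a. int (SOME i. i < m \<and> a \<in> B i))"
  have c: "c a = int i" if "i < m" "a \<in> B i" for a i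
  proof -
    have "(SOME i. i < m \<and> a \<in> B i) = i" by (rule some_equality) (use that disj in blast)+
    then show ?thesis unfolding c_def by simp
  qed
  have "(a, b) \<in> E \<longleftrightarrow> int m dvd c b - c a - 1" if K: "a \<in> K" "b \<in> K" for a b
  proof -
    obtain i j where i: "i < m" "a \<in> B i" and j: "j < m" "b \<in> B j" using K un by blast
    have "(a, b) \<in> E \<longleftrightarrow> (a, b) \<in> Restr E K" using K by blast
    also have "\<dots> \<longleftrightarrow> b \<in> B (Suc i mod m)" unfolding edges using i disj by fastforce
    also have "\<dots> \<longleftrightarrow> j = Suc i mod m" using j disj[OF j(1), of "Suc i mod m"] m by (auto simp: Suc_le_eq)
    also have "\<dots> \<longleftrightarrow> j mod m = Suc i mod m" using j by simp
    also have "\<dots> \<longleftrightarrow> int j mod int m = int (Suc i) mod int m"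
      by (simp only: zmod_int[symmetric] of_nat_eq_iff)
    also have "\<dots> \<longleftrightarrow> int m dvd int j - int (Suc i)" by (rule mod_eq_dvd_iff)
    also have "\<dots> \<longleftrightarrow> int m dvd c b - c a - 1" using c i j by (simp add: algebra_simps)
    finally show ?thesis .
  qed
  moreover have "\<exists>a\<in>K. int m dvd c a - i" for i
  proof -
    let ?j = "nat (i mod int m)"
    have j: "?j < m" "int ?j = i mod int m" using m by (auto simp: nat_less_iff)
    then obtain a where a: "a \<in> B ?j" using ne by blast
    have "int m dvd i mod int m - i" by (simp add: mod_eq_dvd_iff[symmetric])
    moreover have "a \<in> K" using a j(1) un by blast
    ultimately show ?thesis using c[OF j(1) a] j(2) by (intro bexI[of _ a]) simp_all
  qed
  ultimately have "whirl_coloring E K m c" unfolding whirl_coloring_def using m by blast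
  then show ?thesis using c by blast
qed

lemma is_whirl_of_whirl_coloring:
  assumes "whirl_coloring E K m c"
  shows "is_whirl E K m (\<lambda>i. {a \<in> K. int m dvd c a - int i})"
proof -
  have m: "1 \<le> m" and edge: "\<And>a b. a \<in> K \<Longrightarrow> b \<in> K \<Longrightarrow> (a, b) \<in> E \<longleftrightarrow> int m dvd c b - c a - 1"
    and ex: "\<And>i. \<exists>a\<in>K. int m dvd c a - i"
    using assms unfolding whirl_coloring_def by auto
  have dvd: "int m dvd c a - int i \<longleftrightarrow> c a mod int m = int i mod int m" for a i
    by (simp only: mod_eq_dvd_iff)
  have block: "c a mod int m = int i mod int m \<longleftrightarrow> i = nat (c a mod int m)" if "i < m" for a i
    using that m by auto
  have nat_less: "nat (c a mod int m) < m" for a using m by (simp add: nat_less_iff)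
  have "Restr E K = (\<Union>i<m. {a \<in> K. int m dvd c a - int i} \<times> {a \<in> K. int m dvd c a - int (Suc i mod m)})"
  proof -
    have "(a, b) \<in> E \<longleftrightarrow> (\<exists>i<m. int m dvd c a - int i \<and> int m dvd c b - int (Suc i mod m))"
      if K: "a \<in> K" "b \<in> K" for a b
    proof -
      let ?i = "nat (c a mod int m)"
      have i: "int ?i = c a mod int m" using m by simp
      have "(\<exists>i<m. int m dvd c a - int i \<and> int m dvd c b - int (Suc i mod m)) \<longleftrightarrow>
          int m dvd c b - int (Suc ?i mod m)"
        unfolding dvd using block nat_less by metis
      also have "\<dots> \<longleftrightarrow> c b mod int m = (1 + c a) mod int m"
        unfolding dvd by (simp only: zmod_int of_nat_Suc i mod_mod_trivial mod_add_right_eq)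
      also have "\<dots> \<longleftrightarrow> int m dvd c b - (1 + c a)" by (rule mod_eq_dvd_iff)
      also have "\<dots> \<longleftrightarrow> (a, b) \<in> E" using edge[OF K] by (simp add: algebra_simps)
      finally show ?thesis by simp
    qed
    then show ?thesis by auto
  qed
  moreover have "(\<Union>i<m. {a \<in> K. int m dvd c a - int i}) = K"
    unfolding dvd using block nat_less by auto
  moreover have "{a \<in> K. int m dvd c a - int i} \<inter> {a \<in> K. int m dvd c a - int j} = {}"
    if "i < m" "j < m" "i \<noteq> j" for i j
    unfolding dvd using block that by auto
  moreover have "{a \<in> K. int m dvd c a - int i} \<noteq> {}" for i using ex by auto
  ultimately show ?thesis unfolding is_whirl_def using m by auto
qed

lemma whirl_iff: "whirl E K \<longleftrightarrow> (\<exists>m c. whirl_coloring E K m c)"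
  unfolding whirl_def using whirl_coloring_of_is_whirl is_whirl_of_whirl_coloring by blast

lemma cls_eq: "v \<in> cls E u \<Longrightarrow> cls E v = cls E u"
  unfolding cls_def by (auto intro: rtrancl_trans)

text \<open>A whirl has inner edges while a trivial component has none, so the whirls entering
  \<open>graph_M\<close> and \<open>graph_Z\<close> are nontrivial components.\<close>

lemma cyc_of_whirl_coloring:
  assumes "whirl_coloring E (cls E u) m c"
  shows "cyc E u"
proof -
  obtain b where b: "b \<in> cls E u" "int m dvd c b - (c u + 1)" using assms unfolding whirl_coloring_def by blast
  then have "(u, b) \<in> E" using assms unfolding whirl_coloring_def by (simp add: algebra_simps)
  then show ?thesis using b(1) unfolding cls_def by auto
qed

section \<open>Components, entryways and outlets as lists and as functions\<close>

locale digraph =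
  fixes V :: "'v set" and E :: "('v \<times> 'v) set"
  assumes E: "E \<subseteq> V \<times> V"
begin

lemma rtrancl_V: "(u, v) \<in> E\<^sup>* \<Longrightarrow> u \<in> V \<Longrightarrow> v \<in> V"
  by (induction rule: rtrancl_induct) (use E in auto)

lemma cyc_V: "cyc E v \<Longrightarrow> v \<in> V"
  using E by (auto dest: tranclD)

lemma scc_of_eq: "u \<in> V \<Longrightarrow> scc_of V E u = cls E u"
  unfolding scc_of_def cls_def using rtrancl_V by auto

lemma trivial_iff:
  assumes "u \<in> V"
  shows "trivial_comp E (scc_of V E u) \<longleftrightarrow> \<not> cyc E u"
proof
  assume "trivial_comp E (scc_of V E u)"
  then obtain w where w: "cls E u = {w}" "(w, w) \<notin> E" unfolding trivial_comp_def scc_of_eq[OF assms] by blast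
  then have wu: "w = u" using self_cls[of u E] by simp
  show "\<not> cyc E u"
  proof
    assume "cyc E u"
    then obtain y where "y \<in> cls E u" "(y, u) \<in> E" using cyc_predecessor by metis
    then show False using w wu by auto
  qed
next
  assume nc: "\<not> cyc E u"
  have "x = u" if "x \<in> cls E u" for x
  proof (rule ccontr)
    assume "x \<noteq> u"
    then have "(u, x) \<in> E\<^sup>+" "(x, u) \<in> E\<^sup>*" using that by (auto simp: cls_def rtrancl_eq_or_trancl)
    then show False using nc by (meson trancl_rtrancl_trancl)
  qed
  then have "cls E u = {u}" by auto
  moreover have "(u, u) \<notin> E" using nc by auto
  ultimately show "trivial_comp E (scc_of V E u)" unfolding trivial_comp_def scc_of_eq[OF assms] by blast
qed

lemma in_trivial_iff: "in_trivial V E v \<longleftrightarrow> v \<in> V \<and> \<not> cyc E v"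
  unfolding in_trivial_def using trivial_iff by blast

lemma in_nontrivial_iff: "in_nontrivial V E v \<longleftrightarrow> cyc E v"
  unfolding in_nontrivial_def using trivial_iff cyc_V by blast

lemma nontrivial_scc_iff: "nontrivial_scc V E K \<longleftrightarrow> (\<exists>u. cyc E u \<and> K = cls E u)"
  unfolding nontrivial_scc_def is_scc_def using trivial_iff scc_of_eq cyc_V by metis

lemma nontrivial_scc_member: "nontrivial_scc V E K \<Longrightarrow> v \<in> K \<Longrightarrow> cyc E v \<and> K = cls E v"
  unfolding nontrivial_scc_iff using cls_eq cyc_cls by metis

lemma whirl_scc_iff:
  "is_scc V E K \<and> whirl_coloring E K m c \<longleftrightarrow> (\<exists>u. cyc E u \<and> K = cls E u \<and> whirl_coloring E (cls E u) m c)"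
  unfolding is_scc_def using scc_of_eq cyc_V cyc_of_whirl_coloring by metis

lemma walk_nth: "walk V E p \<Longrightarrow> walkf E (length p - 1) (\<lambda>i. p ! i)"
  unfolding walk_def walkf_def by auto

lemma walkf_V:
  assumes "walkf E k v" "v 0 \<in> V" "i \<le> k"
  shows "v i \<in> V"
  using walkf_rtrancl[OF assms(1), of 0 i] assms rtrancl_V by simp

lemma walk_map:
  assumes "walkf E k v" "v 0 \<in> V"
  shows "walk V E (map v [0..<Suc k])"
  unfolding walk_def
proof (intro conjI allI impI)
  show "set (map v [0..<Suc k]) \<subseteq> V" using walkf_V[OF assms] by auto
  fix i assume "Suc i < length (map v [0..<Suc k])"
  then show "(map v [0..<Suc k] ! i, map v [0..<Suc k] ! Suc i) \<in> E"
    using assms(1) unfolding walkf_def by (simp del: upt_Suc)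
qed simp

lemma map_upt_simps:
  "length (map v [0..<Suc k]) = Suc k" "hd (map v [0..<Suc k]) = v 0" "last (map v [0..<Suc k]) = v k"
  "i \<le> k \<Longrightarrow> map v [0..<Suc k] ! i = v i" "set (map v [0..<Suc k]) = v ` {..k}"
  "wlen (map v [0..<Suc k]) = k"
  by (auto simp: hd_map last_map wlen_def less_Suc_eq_le atLeast0LessThan lessThan_Suc_atMost simp del: upt_Suc)

text \<open>A vertex occurring twice lies on a closed walk, so both of its positions would be
  recurrent.\<close>

lemma distinct_map_upt:
  assumes "walkf E k v" "\<And>i j. i < j \<Longrightarrow> j \<le> k \<Longrightarrow> \<not> cyc E (v i) \<or> \<not> cyc E (v j)"
  shows "distinct (map v [0..<Suc k])"
proof -
  have "v i \<noteq> v j" if "i < j" "j \<le> k" for i j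
    using walkf_trancl[OF assms(1) that] assms(2)[OF that] by auto
  then have "inj_on v {0..<Suc k}"
    unfolding inj_on_def by (metis atLeastLessThan_iff less_Suc_eq_le linorder_neqE_nat)
  then show ?thesis by (simp add: distinct_map del: upt_Suc)
qed

lemma entry_walk_of_entryway:
  assumes "entryway V E K p"
  shows "entry_walk E (wlen p) (\<lambda>i. p ! i)" "K = cls E (p ! wlen p)" "last p = p ! wlen p"
proof -
  have p: "walk V E p" "p \<noteq> []" and K: "nontrivial_scc V E K" "last p \<in> K" and pl: "pleasant V E (butlast p)"
    using assms unfolding entryway_def is_path_def walk_def by auto
  show l: "last p = p ! wlen p" using p by (simp add: last_conv_nth wlen_def)
  show "K = cls E (p ! wlen p)" using nontrivial_scc_member[OF K] l by simp
  have "\<not> cyc E (p ! i)" if "i < wlen p" for i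
  proof -
    have "butlast p ! i \<in> set (butlast p)" using that by (simp add: wlen_def)
    then show ?thesis using pl that unfolding pleasant_def in_trivial_iff by (simp add: nth_butlast wlen_def)
  qed
  then show "entry_walk E (wlen p) (\<lambda>i. p ! i)"
    unfolding entry_walk_def using walk_nth[OF p(1)] nontrivial_scc_member[OF K] l by (simp add: wlen_def)
qed

lemma entryway_of_entry_walk:
  assumes "entry_walk E k v"
  shows "entryway V E (cls E (v k)) (map v [0..<Suc k])"
proof -
  have v: "walkf E k v" "\<And>i. i < k \<Longrightarrow> \<not> cyc E (v i)" "cyc E (v k)" using assms unfolding entry_walk_def by auto
  have v0: "v 0 \<in> V"
  proof (cases "k = 0")
    case True
    then show ?thesis using v cyc_V by simp
  next
    case False
    then have "(v 0, v (Suc 0)) \<in> E" using v(1) unfolding walkf_def by simp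
    then show ?thesis using E by blast
  qed
  have "distinct (map v [0..<Suc k])" using distinct_map_upt[OF v(1)] v(2) by force
  moreover have "pleasant V E (butlast (map v [0..<Suc k]))"
    unfolding pleasant_def in_trivial_iff using v(2) walkf_V[OF v(1) v0] by (auto simp: map_butlast[symmetric])
  ultimately show ?thesis
    unfolding entryway_def is_path_def nontrivial_scc_iff
    using walk_map[OF v(1) v0] v(3) map_upt_simps(3)[of v k] self_cls[of "v k" E] by metis
qed

lemma outlet_walk_of_outlet:
  assumes "outlet V E K p"
  shows "outlet_walk E (wlen p) (\<lambda>i. p ! i)"
proof -
  have p: "walk V E p" "p \<noteq> []" and K: "nontrivial_scc V E K" "hd p \<in> K" and pl: "pleasant V E (tl p)"
    using assms unfolding outlet_def is_path_def walk_def by auto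
  have "\<not> cyc E (p ! i)" if "0 < i" "i \<le> wlen p" for i
  proof -
    have "tl p ! (i - 1) \<in> set (tl p)" using that p by (intro nth_mem) (auto simp: wlen_def)
    moreover have "tl p ! (i - 1) = p ! i" using that p by (simp add: nth_tl wlen_def)
    ultimately show ?thesis using pl unfolding pleasant_def in_trivial_iff by simp
  qed
  then show ?thesis
    unfolding outlet_walk_def using walk_nth[OF p(1)] nontrivial_scc_member[OF K] p
    by (simp add: wlen_def hd_conv_nth)
qed

lemma outlet_of_outlet_walk:
  assumes "outlet_walk E k v"
  shows "outlet V E (cls E (v 0)) (map v [0..<Suc k])"
proof -
  have v: "walkf E k v" "cyc E (v 0)" "\<And>i. 0 < i \<Longrightarrow> i \<le> k \<Longrightarrow> \<not> cyc E (v i)"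
    using assms unfolding outlet_walk_def by auto
  have v0: "v 0 \<in> V" using v cyc_V by simp
  have "distinct (map v [0..<Suc k])" using distinct_map_upt[OF v(1)] v(3) by (metis gr_implies_not0 neq0_conv)
  moreover have "tl (map v [0..<Suc k]) = map v [1..<Suc k]" by (simp add: map_tl[symmetric] del: upt_Suc)
  then have "pleasant V E (tl (map v [0..<Suc k]))"
    unfolding pleasant_def in_trivial_iff using v(3) walkf_V[OF v(1) v0] by auto
  ultimately show ?thesis
    unfolding outlet_def is_path_def nontrivial_scc_iff
    using walk_map[OF v(1) v0] v(2) map_upt_simps(2)[of v k] self_cls[of "v 0" E] by metis
qed

text \<open>When the new first vertex already occurs on the path, the path is cut so as to start
  there.\<close>

lemma exists_path:
  assumes "(u, v) \<in> E\<^sup>*" "v \<in> V"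
  shows "\<exists>p. is_path V E p \<and> hd p = u \<and> last p = v"
  using assms(1)
proof (induction rule: converse_rtrancl_induct)
  case base
  show ?case using assms(2) by (intro exI[of _ "[v]"]) (auto simp: is_path_def walk_def)
next
  case (step y z)
  then obtain p where p: "is_path V E p" "hd p = z" "last p = v" by blast
  have ne: "p \<noteq> []" using p unfolding is_path_def walk_def by blast
  show ?case
  proof (cases "y \<in> set p")
    case True
    then obtain a b where ab: "p = a @ y # b" by (meson split_list)
    have "(y # b) ! i = p ! (length a + i)" for i unfolding ab by (simp add: nth_append)
    moreover have "length p = length a + length (y # b)" unfolding ab by simp
    moreover have "(p ! j, p ! Suc j) \<in> E" if "Suc j < length p" for j
      using p(1) that unfolding is_path_def walk_def by blast
    ultimately have "((y # b) ! i, (y # b) ! Suc i) \<in> E" if "Suc i < length (y # b)" for i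
      using that by (metis add_Suc_right add_less_cancel_left)
    then have "is_path V E (y # b)"
      using p(1) ab unfolding is_path_def walk_def by simp
    then show ?thesis using p(3) ab by (intro exI[of _ "y # b"]) auto
  next
    case False
    have "is_path V E (y # p)"
      using p False step(1) E ne unfolding is_path_def walk_def
      by (auto simp: nth_Cons hd_conv_nth split: nat.splits)
    then show ?thesis using p(3) ne by (intro exI[of _ "y # p"]) auto
  qed
qed

end

section \<open>The parameters as suprema and infima\<close>

abbreviation ereal_nat :: "nat \<Rightarrow> ereal" where
  "ereal_nat k \<equiv> ereal (real k)"

text \<open>Naturals below \<open>l\<close> are at most \<open>l - 1\<close>, so the inequality
  stays strict for the supremum. For \<open>l = 0\<close> the set is empty and its supremum is minus
  infinity.\<close>

lemma Sup_nat_less: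
  "Sup (ereal_nat ` S) < ereal_nat l \<longleftrightarrow> (\<forall>k\<in>S. k < l)" (is "?L \<longleftrightarrow> ?R")
proof
  assume ?L
  show ?R
  proof
    fix k assume "k \<in> S"
    then have "ereal_nat k \<le> Sup (ereal_nat ` S)" by (intro Sup_upper) auto
    then have "ereal_nat k < ereal_nat l" using \<open>?L\<close> by (rule le_less_trans)
    then show "k < l" by simp
  qed
next
  assume R: ?R
  show ?L
  proof (cases l)
    case 0
    then have "S = {}" using R by auto
    then show ?thesis by (simp add: bot_ereal_def)
  next
    case (Suc j)
    then have "Sup (ereal_nat ` S) \<le> ereal_nat j" using R by (intro Sup_least) auto
    also have "\<dots> < ereal_nat l" using Suc by simp
    finally show ?thesis .
  qed
qed

lemma Inf_nat:
  assumes "S \<noteq> {}"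
  shows "Inf (ereal_nat ` S) = ereal_nat (LEAST k. k \<in> S)"
proof (rule Inf_eqI)
  show "ereal_nat (LEAST k. k \<in> S) \<le> i" if "i \<in> ereal_nat ` S" for i
    using that by (auto intro: Least_le)
  show "y \<le> ereal_nat (LEAST k. k \<in> S)" if "\<And>i. i \<in> ereal_nat ` S \<Longrightarrow> y \<le> i" for y
    using that LeastI_ex[of "\<lambda>k. k \<in> S"] assms by blast
qed

text \<open>A nonempty set of naturals attains its infimum. With \<open>S'\<close> empty the
  equivalence would fail for unbounded \<open>S\<close>.\<close>

lemma Sup_less_Inf:
  assumes "S' \<noteq> {}"
  shows "Sup (ereal_nat ` S) < Inf (ereal_nat ` S') \<longleftrightarrow> (\<forall>k\<in>S. \<forall>l\<in>S'. k < l)"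
proof -
  have "(LEAST l. l \<in> S') \<in> S'" using assms LeastI_ex[of "\<lambda>k. k \<in> S'"] by blast
  then show ?thesis
    unfolding Inf_nat[OF assms] Sup_nat_less by (meson Least_le less_le_trans)
qed

lemma Sup_nat_le_int:
  "Sup (ereal_nat ` S) \<le> ereal (real_of_int y) \<longleftrightarrow> (\<forall>k\<in>S. int k \<le> y)"
proof -
  have "ereal_nat k \<le> ereal (real_of_int y) \<longleftrightarrow> int k \<le> y" for k
    by (metis ereal_less_eq(3) of_int_le_iff of_int_of_nat_eq)
  then show ?thesis by (auto simp: Sup_le_iff)
qed

lemma Sup_int:
  assumes "\<And>m. Q m \<longleftrightarrow> m \<le> y"
  shows "Sup {ereal (real_of_int m) | m :: int. Q m} = ereal (real_of_int y)"
proof (rule Sup_eqI)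
  show "x \<le> ereal (real_of_int y)" if "x \<in> {ereal (real_of_int m) | m :: int. Q m}" for x
  proof -
    obtain m where "x = ereal (real_of_int m)" "Q m" using \<open>x \<in> _\<close> by blast
    then show ?thesis using assms[of m] by simp
  qed
  show "ereal (real_of_int y) \<le> z" if "\<And>x. x \<in> {ereal (real_of_int m) | m :: int. Q m} \<Longrightarrow> x \<le> z" for z
    by (rule that) (use assms in blast)
qed

section \<open>Parameters of the two trees\<close>

context tree_pair
begin

lemma two_le_n: "2 \<le> n"
proof -
  obtain x where x: "1 \<le> x" "x \<le> n" "dep T x \<noteq> dep T' x" using differ by blast
  then have "x \<noteq> 1" by auto
  then show ?thesis using x by simp
qed

lemma Sup_agreement:
  "Sup {ereal (real_of_int m) | m :: int. \<forall>x\<in>{1..n}.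
      (int (dep T x) \<le> m \<or> int (dep T' x) \<le> m) \<longrightarrow> dep T x = dep T' x} = ereal_nat L"
proof -
  obtain x where x: "x \<in> {1..n}" "dep T x \<noteq> dep T' x" "dep T x = Suc L \<or> dep T' x = Suc L"
    using differ by auto
  have "m \<le> int L" if "\<forall>x\<in>{1..n}. (int (dep T x) \<le> m \<or> int (dep T' x) \<le> m) \<longrightarrow> dep T x = dep T' x" for m
    using that x by (cases "m \<le> int L") auto
  moreover have "\<forall>x\<in>{1..n}. (int (dep T x) \<le> m \<or> int (dep T' x) \<le> m) \<longrightarrow> dep T x = dep T' x" if "m \<le> int L" for m
  proof (intro ballI impI)
    fix y assume "y \<in> {1..n}" "int (dep T y) \<le> m \<or> int (dep T' y) \<le> m"
    then show "dep T y = dep T' y" using agree[of y] that by (simp, linarith)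
  qed
  ultimately have "Sup {ereal (real_of_int m) | m :: int. \<forall>x\<in>{1..n}.
      (int (dep T x) \<le> m \<or> int (dep T' x) \<le> m) \<longrightarrow> dep T x = dep T' x} = ereal (real_of_int (int L))"
    by (intro Sup_int) blast
  then show ?thesis by simp
qed

text \<open>The supremum plus 1 is the least height bound at which agreement fails; the root shows
  that there is one. It may be 0, so the supremum itself may be -1, hence the integers.\<close>

lemma le_Sup_subtrees:
  "Sup (ereal_nat ` S) \<le> Sup {ereal (real_of_int m) | m :: int. \<forall>x\<in>{1..n}.
      (int (height T x) \<le> m \<or> int (height T' x) \<le> m) \<longrightarrow> subtree_eq T T' x} + 1 \<longleftrightarrow>
   (\<forall>k\<in>S. \<forall>x\<in>{1..n}. height T x < k \<or> height T' x < k \<longrightarrow> subtree_eq T T' x)"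
proof -
  define Q where "Q = (\<lambda>m::int. \<forall>x\<in>{1..n}. int (height T x) \<le> m \<or> int (height T' x) \<le> m \<longrightarrow> subtree_eq T T' x)"
  have mono: "Q l" if "Q m" "l \<le> m" for l m
    using that unfolding Q_def by (meson order_trans)
  have "\<not> Q (int (height T 1))" unfolding Q_def using root_not_eq two_le_n by fastforce
  then have ex: "\<exists>k::nat. \<not> Q (int k)" by blast
  define k where "k = (LEAST k::nat. \<not> Q (int k))"
  have k: "\<not> Q (int k)" unfolding k_def by (rule LeastI_ex[OF ex])
  have "Q (int k - 1)"
  proof (cases k)
    case 0
    then show ?thesis unfolding Q_def by simp
  next
    case (Suc j)
    then show ?thesis using not_less_Least[of j "\<lambda>k. \<not> Q (int k)"] unfolding k_def by simp
  qed
  then have Q: "Q m \<longleftrightarrow> m \<le> int k - 1" for m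
    using mono[of m "int k"] mono[of "int k - 1" m] k by (cases "m \<le> int k - 1") auto
  have "Sup {ereal (real_of_int m) | m. Q m} = ereal (real_of_int (int k - 1))"
    by (rule Sup_int) (rule Q)
  then have sup: "Sup {ereal (real_of_int m) | m. Q m} + 1 = ereal (real_of_int (int k))" by (simp add: one_ereal_def)
  have "Q (int l - 1) \<longleftrightarrow> int l \<le> int k" for l unfolding Q by linarith
  then have "Sup (ereal_nat ` S) \<le> Sup {ereal (real_of_int m) | m. Q m} + 1 \<longleftrightarrow> (\<forall>l\<in>S. Q (int l - 1))"
    unfolding sup Sup_nat_le_int by blast
  moreover have "Q (int l - 1) \<longleftrightarrow> (\<forall>x\<in>{1..n}. height T x < l \<or> height T' x < l \<longrightarrow> subtree_eq T T' x)" for l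
    unfolding Q_def by auto
  ultimately show ?thesis unfolding Q_def by simp
qed

lemma parents_eq: "(p, x) \<in> T \<Longrightarrow> (p', x) \<in> T' \<Longrightarrow> parents T x \<noteq> parents T' x \<longleftrightarrow> p \<noteq> p'"
proof -
  assume p: "(p, x) \<in> T" "(p', x) \<in> T'"
  have "parents T x = {p}" unfolding parents_def using A.parent_unique p(1) by blast
  moreover have "parents T' x = {p'}" unfolding parents_def using B.parent_unique p(2) by blast
  ultimately show ?thesis by simp
qed

lemma different_parents:
  assumes "x \<in> {1..n}" "parents T x \<noteq> parents T' x"
  shows "\<exists>p p'. (p, x) \<in> T \<and> (p', x) \<in> T' \<and> p \<noteq> p'"
proof -
  have "x \<noteq> 1" using assms(2) A.edgeD B.edgeD unfolding parents_def by fastforce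
  then obtain p p' where "(p, x) \<in> T" "(p', x) \<in> T'"
    using A.parent_ex[of x] B.parent_ex[of x] assms(1) by auto
  then show ?thesis using parents_eq assms(2) by blast
qed

text \<open>The last vertex with different parents has the same subtree in both trees.\<close>
lemma moved_subtree: "\<exists>x\<in>{1..n}. subtree_eq T T' x \<and> parents T x \<noteq> parents T' x"
proof -
  let ?S = "{x \<in> {1..n}. parents T x \<noteq> parents T' x}"
  have "T \<noteq> T'" using differ by auto
  then obtain p x where px: "(p, x) \<in> T \<longleftrightarrow> (p, x) \<notin> T'" by auto
  then have "1 \<le> x \<and> x \<le> n" using A.edgeD[of p x] B.edgeD[of p x] by linarith
  moreover have "parents T x \<noteq> parents T' x" using px unfolding parents_def by blast
  ultimately have "x \<in> ?S" by simp
  then have "?S \<noteq> {}" by blast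
  then have max: "Max ?S \<in> ?S" by (intro Max_in) auto
  define x where "x = Max ?S"
  have x: "x \<in> {1..n}" "parents T x \<noteq> parents T' x" using max unfolding x_def by auto
  have same: "(q, y) \<in> T \<longleftrightarrow> (q, y) \<in> T'" if "x < y" for q y
  proof (cases "y \<le> n")
    case True
    have "parents T y = parents T' y"
    proof (rule ccontr)
      assume "\<not> ?thesis"
      then have "y \<in> ?S" using True that x by simp
      then have "y \<le> x" unfolding x_def by (intro Max_ge) auto
      then show False using that by simp
    qed
    then show ?thesis unfolding parents_def by auto
  qed (use A.edgeD B.edgeD in blast)
  have "(x, y) \<in> T\<^sup>* \<longleftrightarrow> (x, y) \<in> T'\<^sup>*" for y
  proof
    assume "(x, y) \<in> T\<^sup>*"
    then show "(x, y) \<in> T'\<^sup>*"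
    proof (induction rule: rtrancl_induct)
      case (step a b)
      then have "x < b" using A.descs_le[of a x] A.edgeD[of a b] by (auto simp: descs_def)
      then show ?case using step same by (meson rtrancl.rtrancl_into_rtrancl)
    qed simp
  next
    assume "(x, y) \<in> T'\<^sup>*"
    then show "(x, y) \<in> T\<^sup>*"
    proof (induction rule: rtrancl_induct)
      case (step a b)
      then have "x < b" using B.descs_le[of a x] B.edgeD[of a b] by (auto simp: descs_def)
      then show ?case using step same by (meson rtrancl.rtrancl_into_rtrancl)
    qed simp
  qed
  then have eq: "descs T x = descs T' x" unfolding descs_def by simp
  have "(a, b) \<in> T \<longleftrightarrow> (a, b) \<in> T'" if "a \<in> descs T x" for a b
  proof (cases "x < b")
    case False
    then have "\<not> a < b" using A.descs_le[OF that] by simp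
    then show ?thesis using A.edgeD[of a b] B.edgeD[of a b] by blast
  qed (rule same)
  then have "subtree_eq T T' x" unfolding subtree_eq_def eq[symmetric] by auto
  then show ?thesis using x by blast
qed

end

section \<open>Parameters of the digraph\<close>

context digraph
begin

lemma ereal_nat_image: "{ereal_nat (g x) | x. P x} = ereal_nat ` {k. \<exists>x. P x \<and> g x = k}"
  by auto

lemma graph_P_eq: "graph_P V E = Sup (ereal_nat ` {k. \<exists>v. walkf E k v \<and> v 0 \<in> V \<and> (\<forall>i\<le>k. \<not> cyc E (v i))})"
proof -
  have "(\<exists>p. (is_path V E p \<and> pleasant V E p) \<and> wlen p = k) \<longleftrightarrow>
      (\<exists>v. walkf E k v \<and> v 0 \<in> V \<and> (\<forall>i\<le>k. \<not> cyc E (v i)))" (is "?L \<longleftrightarrow> ?R") for k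
  proof
    assume ?L
    then obtain p where p: "walk V E p" "pleasant V E p" "wlen p = k" unfolding is_path_def by blast
    have ne: "p \<noteq> []" using p(1) unfolding walk_def by blast
    have "p ! i \<in> V \<and> \<not> cyc E (p ! i)" if "i \<le> k" for i
      using p(2,3) ne that nth_mem[of i p] unfolding pleasant_def in_trivial_iff wlen_def
      by (cases p) auto
    then show ?R using walk_nth[OF p(1)] p(3) unfolding wlen_def by (intro exI[of _ "\<lambda>i. p ! i"]) simp
  next
    assume ?R
    then obtain v where v: "walkf E k v" "v 0 \<in> V" "\<And>i. i \<le> k \<Longrightarrow> \<not> cyc E (v i)" by blast
    have "distinct (map v [0..<Suc k])" using distinct_map_upt[OF v(1)] v(3) by blast
    moreover have "pleasant V E (map v [0..<Suc k])"
      unfolding pleasant_def in_trivial_iff map_upt_simps using v(3) walkf_V[OF v(1,2)] by auto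
    ultimately show ?L using walk_map[OF v(1,2)] map_upt_simps(6) unfolding is_path_def by blast
  qed
  then show ?thesis unfolding graph_P_def ereal_nat_image by presburger
qed

lemma graph_E_eq: "graph_E V E = Sup (ereal_nat ` {k. \<exists>v. entry_walk E k v})"
proof -
  have "(\<exists>p. (\<exists>K. entryway V E K p) \<and> wlen p = k) \<longleftrightarrow> (\<exists>v. entry_walk E k v)" for k
    using entry_walk_of_entryway(1) entryway_of_entry_walk map_upt_simps(6) by metis
  moreover have "{ereal_nat (wlen p) | p K. entryway V E K p} =
      ereal_nat ` {k. \<exists>p. (\<exists>K. entryway V E K p) \<and> wlen p = k}" by auto
  ultimately show ?thesis unfolding graph_E_def by simp
qed

lemma graph_O_eq: "graph_O V E = Sup (ereal_nat ` {k. \<exists>v. outlet_walk E k v})"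
proof -
  have "(\<exists>p. (\<exists>K. outlet V E K p) \<and> wlen p = k) \<longleftrightarrow> (\<exists>v. outlet_walk E k v)" for k
    using outlet_walk_of_outlet outlet_of_outlet_walk map_upt_simps(6) by metis
  moreover have "{ereal_nat (wlen p) | p K. outlet V E K p} =
      ereal_nat ` {k. \<exists>p. (\<exists>K. outlet V E K p) \<and> wlen p = k}" by auto
  ultimately show ?thesis unfolding graph_O_def by simp
qed

lemma list_walk_iff:
  "(\<exists>vs. walk V E vs \<and> length vs = m + 1 \<and> P (hd vs)) \<longleftrightarrow> (\<exists>v. walkf E m v \<and> v 0 \<in> V \<and> P (v 0))"
proof
  assume "\<exists>vs. walk V E vs \<and> length vs = m + 1 \<and> P (hd vs)"
  then obtain vs where vs: "walk V E vs" "length vs = m + 1" "P (hd vs)" by blast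
  then have "hd vs = vs ! 0" "vs ! 0 \<in> V" unfolding walk_def by (auto simp: hd_conv_nth)
  then show "\<exists>v. walkf E m v \<and> v 0 \<in> V \<and> P (v 0)"
    using walk_nth[OF vs(1)] vs by (intro exI[of _ "\<lambda>i. vs ! i"]) auto
next
  assume "\<exists>v. walkf E m v \<and> v 0 \<in> V \<and> P (v 0)"
  then obtain v where v: "walkf E m v" "v 0 \<in> V" "P (v 0)" by blast
  then show "\<exists>vs. walk V E vs \<and> length vs = m + 1 \<and> P (hd vs)"
    using walk_map[OF v(1,2)] map_upt_simps(1,2)[of v m] by (metis Suc_eq_plus1)
qed

lemma walk_Cons: "walk V E (u # vs) \<longleftrightarrow> u \<in> V \<and> (vs = [] \<or> walk V E vs \<and> (u, hd vs) \<in> E)"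
  unfolding walk_def by (cases vs) (auto simp: nth_Cons split: nat.splits)

lemma graph_Z_eq: "graph_Z V E = Sup (ereal_nat ` {m. \<exists>u k c a b v. cyc E u \<and> whirl_coloring E (cls E u) k c \<and>
   a \<in> cls E u \<and> b \<in> cls E u \<and> int k dvd c a - c b \<and> (a, v 0) \<in> E \<and> walkf E m v \<and> (b, v 0) \<notin> E})"
proof -
  have "(\<exists>K k B i u w vs. is_scc V E K \<and> is_whirl E K k B \<and> i < k \<and> u \<in> B i \<and> w \<in> B i \<and>
      walk V E (u # vs) \<and> length vs = m + 1 \<and> (w, hd vs) \<notin> E) \<longleftrightarrow>
    (\<exists>u k c a b v. cyc E u \<and> whirl_coloring E (cls E u) k c \<and> a \<in> cls E u \<and> b \<in> cls E u \<and>
      int k dvd c a - c b \<and> (a, v 0) \<in> E \<and> walkf E m v \<and> (b, v 0) \<notin> E)" (is "?L \<longleftrightarrow> ?R") for m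
  proof
    assume ?L
    then obtain K k B i u w vs where K: "is_scc V E K" "is_whirl E K k B" "i < k" "u \<in> B i" "w \<in> B i"
      and vs: "walk V E (u # vs)" "length vs = m + 1" "(w, hd vs) \<notin> E" by blast
    obtain c where c: "whirl_coloring E K k c" "\<And>i a. i < k \<Longrightarrow> a \<in> B i \<Longrightarrow> c a = int i"
      using whirl_coloring_of_is_whirl[OF K(2)] by blast
    obtain r where r: "cyc E r" "K = cls E r" using whirl_scc_iff[of K k c] K(1) c(1) by blast
    have "walk V E vs \<and> length vs = m + 1 \<and> (u, hd vs) \<in> E \<and> (w, hd vs) \<notin> E"
      using vs unfolding walk_Cons by auto
    then obtain v where "walkf E m v" "(u, v 0) \<in> E" "(w, v 0) \<notin> E"
      using list_walk_iff[of m "\<lambda>x. (u, x) \<in> E \<and> (w, x) \<notin> E"] by blast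
    moreover have "u \<in> K" "w \<in> K" using K unfolding is_whirl_def by blast+
    moreover have "int k dvd c u - c w" using c(2)[OF K(3,4)] c(2)[OF K(3,5)] by simp
    ultimately show ?R using r c(1) by blast
  next
    assume ?R
    then obtain u k c a b v where r: "cyc E u" "whirl_coloring E (cls E u) k c" "a \<in> cls E u" "b \<in> cls E u"
      "int k dvd c a - c b" and v: "(a, v 0) \<in> E" "walkf E m v" "(b, v 0) \<notin> E" by blast
    let ?B = "\<lambda>i. {x \<in> cls E u. int k dvd c x - int i}"
    have scc: "is_scc V E (cls E u)" using r(1,2) whirl_scc_iff by blast
    have v0: "v 0 \<in> V" using v(1) E by blast
    have "\<exists>vs. walk V E vs \<and> length vs = m + 1 \<and> ((a, hd vs) \<in> E \<and> (b, hd vs) \<notin> E)"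
      using list_walk_iff[of m "\<lambda>x. (a, x) \<in> E \<and> (b, x) \<notin> E"] v v0 by blast
    then obtain vs where vs: "walk V E vs" "length vs = m + 1" "(a, hd vs) \<in> E" "(b, hd vs) \<notin> E" by blast
    have "walk V E (a # vs)" using vs E unfolding walk_Cons by auto
    define i where "i = nat (c a mod int k)"
    have k: "1 \<le> k" using r(2) unfolding whirl_coloring_def by blast
    then have i: "i < k" "int i = c a mod int k" unfolding i_def by (auto simp: nat_less_iff)
    have a: "int k dvd c a - int i" unfolding i by (simp add: minus_mod_eq_mult_div)
    have "int k dvd c b - int i" using a r(5) by (rule dvd_minus_eq) simp
    then have "a \<in> ?B i" "b \<in> ?B i" using a r by auto
    then show ?L using scc is_whirl_of_whirl_coloring[OF r(2)] i(1) \<open>walk V E (a # vs)\<close> vs(2,4) by blast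
  qed
  then have *: "{m. \<exists>K k B i u w vs. is_scc V E K \<and> is_whirl E K k B \<and> i < k \<and> u \<in> B i \<and> w \<in> B i \<and>
      walk V E (u # vs) \<and> length vs = m + 1 \<and> (w, hd vs) \<notin> E} =
    {m. \<exists>u k c a b v. cyc E u \<and> whirl_coloring E (cls E u) k c \<and> a \<in> cls E u \<and> b \<in> cls E u \<and>
      int k dvd c a - c b \<and> (a, v 0) \<in> E \<and> walkf E m v \<and> (b, v 0) \<notin> E}" by (rule Collect_cong)
  show ?thesis unfolding graph_Z_def *[symmetric] image_Collect by (rule arg_cong[of _ _ Sup]) blast
qed

lemma graph_B_eq: "graph_B V E = Sup (ereal_nat ` {m. \<exists>v a b. walkf E m v \<and> (v m, a) \<in> E \<and> (v m, b) \<in> E \<and>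
    cyc E a \<and> cyc E b \<and> ((a, b) \<notin> E\<^sup>* \<or> (b, a) \<notin> E\<^sup>*)})"
proof -
  have sccs: "(\<exists>K K'. nontrivial_scc V E K \<and> nontrivial_scc V E K' \<and> K \<noteq> K' \<and> a \<in> K \<and> b \<in> K') \<longleftrightarrow>
      cyc E a \<and> cyc E b \<and> ((a, b) \<notin> E\<^sup>* \<or> (b, a) \<notin> E\<^sup>*)" (is "?L \<longleftrightarrow> ?R") for a b
  proof
    assume ?L
    then obtain K K' where K: "nontrivial_scc V E K" "nontrivial_scc V E K'" "K \<noteq> K'" "a \<in> K" "b \<in> K'" by blast
    have "cyc E a" "cyc E b" "cls E a \<noteq> cls E b"
      using nontrivial_scc_member[OF K(1,4)] nontrivial_scc_member[OF K(2,5)] K(3) by auto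
    then show ?R using cls_eq[of b E a] unfolding cls_def by blast
  next
    assume R: ?R
    then have "b \<notin> cls E a" unfolding cls_def by blast
    then have "cls E a \<noteq> cls E b" using self_cls[of b E] by blast
    then show ?L using R nontrivial_scc_iff self_cls by metis
  qed
  have "(\<exists>p. (\<exists>a b K K'. walk V E p \<and> (last p, a) \<in> E \<and> (last p, b) \<in> E \<and> nontrivial_scc V E K \<and>
      nontrivial_scc V E K' \<and> K \<noteq> K' \<and> a \<in> K \<and> b \<in> K') \<and> wlen p = m) \<longleftrightarrow>
    (\<exists>v a b. walkf E m v \<and> (v m, a) \<in> E \<and> (v m, b) \<in> E \<and> cyc E a \<and> cyc E b \<and> ((a, b) \<notin> E\<^sup>* \<or> (b, a) \<notin> E\<^sup>*))"
    (is "?L \<longleftrightarrow> ?R") for m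
  proof
    assume ?L
    then obtain p a b K K' where p: "walk V E p" "(last p, a) \<in> E" "(last p, b) \<in> E" "wlen p = m"
      and K: "nontrivial_scc V E K" "nontrivial_scc V E K'" "K \<noteq> K'" "a \<in> K" "b \<in> K'" by blast
    have ab: "cyc E a \<and> cyc E b \<and> ((a, b) \<notin> E\<^sup>* \<or> (b, a) \<notin> E\<^sup>*)" using sccs[of a b] K by blast
    have "last p = p ! m" using p(1,4) unfolding walk_def wlen_def by (auto simp: last_conv_nth)
    then show ?R using walk_nth[OF p(1)] p ab unfolding wlen_def
      by (intro exI[of _ "\<lambda>i. p ! i"] exI[of _ a] exI[of _ b]) simp
  next
    assume ?R
    then obtain v a b where v: "walkf E m v" "(v m, a) \<in> E" "(v m, b) \<in> E"
      and ab: "cyc E a \<and> cyc E b \<and> ((a, b) \<notin> E\<^sup>* \<or> (b, a) \<notin> E\<^sup>*)" by blast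
    have "v 0 \<in> V" using v E unfolding walkf_def by (cases m) auto
    then have "walk V E (map v [0..<Suc m])" using walk_map v(1) by blast
    moreover obtain K K' where "nontrivial_scc V E K" "nontrivial_scc V E K'" "K \<noteq> K'" "a \<in> K" "b \<in> K'"
      using sccs[of a b] ab by blast
    ultimately show ?L using v(2,3) map_upt_simps(3,6)[of v m] by metis
  qed
  then show ?thesis unfolding graph_B_def ereal_nat_image by presburger
qed

lemma graph_omega_eq:
  assumes r: "1 \<le> r" "r \<le> l"
  shows "graph_omega V E l r = Sup (ereal_nat ` {m. \<exists>v v'. fork E l r m v v'})"
proof -
  have "(\<exists>p q. walk V E p \<and> length p = l + 1 \<and> in_nontrivial V E (last p) \<and>
      walk V E q \<and> hd q = p ! (r - 1) \<and> l \<le> m \<and> length q = m - r + 2 \<and> in_trivial V E (q ! (l - r + 1))) \<longleftrightarrow>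
    (\<exists>v v'. fork E l r m v v')" (is "?L \<longleftrightarrow> ?R") for m
  proof
    assume ?L
    then obtain p q where p: "walk V E p" "length p = l + 1" "in_nontrivial V E (last p)"
      and q: "walk V E q" "hd q = p ! (r - 1)" "l \<le> m" "length q = m - r + 2" "in_trivial V E (q ! (l - r + 1))"
      by blast
    have lp: "last p = p ! l" using p by (simp add: last_conv_nth walk_def)
    have hq: "hd q = q ! 0" using q by (simp add: hd_conv_nth walk_def)
    have "(q ! (i - (r - 1)), q ! (Suc i - (r - 1))) \<in> E" if "r - 1 \<le> i" "i < m" for i
    proof -
      have "Suc (i - (r - 1)) < length q" using that q(3,4) r by linarith
      then have "(q ! (i - (r - 1)), q ! Suc (i - (r - 1))) \<in> E" using q(1) unfolding walk_def by blast
      then show ?thesis using that by (simp add: Suc_diff_le)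
    qed
    moreover have "l - (r - 1) = l - r + 1" using r by simp
    ultimately have "fork E l r m (\<lambda>i. p ! i) (\<lambda>i. q ! (i - (r - 1)))"
      unfolding fork_def using r walk_nth[OF p(1)] p lp q hq in_nontrivial_iff in_trivial_iff by simp
    then show ?R by blast
  next
    assume ?R
    then obtain v v' where f: "walkf E l v" "cyc E (v l)" "l \<le> m" "v' (r - 1) = v (r - 1)"
      "\<And>i. r - 1 \<le> i \<Longrightarrow> i < m \<Longrightarrow> (v' i, v' (Suc i)) \<in> E" "\<not> cyc E (v' l)" unfolding fork_def by blast
    have v0: "v 0 \<in> V" using f(1) r E unfolding walkf_def by fastforce
    \<comment> \<open>The list form counts from 0 where \<open>v'\<close> counts from
      \<open>r - 1\<close>.\<close>
    define w where "w = (\<lambda>j. v' (r - 1 + j))"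
    have w: "walkf E (m - r + 1) w"
      unfolding walkf_def w_def add_Suc_right by (intro allI impI f(5)) (use r f(3) in auto)
    have w0: "w 0 = v (r - 1)" using f(4) unfolding w_def by simp
    then have wV: "w 0 \<in> V" using walkf_V[OF f(1) v0] r by simp
    have lr: "l - r + 1 \<le> m - r + 1" using f(3) by simp
    have wl: "w (l - r + 1) = v' l" unfolding w_def using r by simp
    then have "in_trivial V E (w (l - r + 1))" using f(6) walkf_V[OF w wV lr] in_trivial_iff by simp
    moreover have "in_nontrivial V E (v l)" using f(2) in_nontrivial_iff by blast
    moreover have "map v [0..<Suc l] ! (r - 1) = v (r - 1)" by (rule map_upt_simps(4)) (use r in simp)
    ultimately show ?L using walk_map[OF f(1) v0] walk_map[OF w wV] f(3) w0
        map_upt_simps(1,3)[of v l] map_upt_simps(1,2)[of w "m - r + 1"] map_upt_simps(4)[OF lr, of w]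
      by (intro exI[of _ "map v [0..<Suc l]"] exI[of _ "map w [0..<Suc (m - r + 1)]"]) (simp del: upt_Suc)
  qed
  then show ?thesis unfolding graph_omega_def setcompr_eq_image by (simp only:)
qed

end

section \<open>The conditions in terms of the parameters\<close>

lemma dvd_nat_abs_iff: "m dvd nat \<bar>int a - int b\<bar> \<longleftrightarrow> int m dvd int a - int b"
  by (simp add: nat_dvd_iff int_dvd_int_iff[symmetric] del: int_dvd_int_iff)

context digraph
begin

lemma cond_sep_iff:
  "(\<nexists>K K' p. nontrivial_scc V E K \<and> nontrivial_scc V E K' \<and> K \<noteq> K' \<and> is_path V E p \<and> hd p \<in> K \<and> last p \<in> K')
   \<longleftrightarrow> cond_sep E" (is "?L \<longleftrightarrow> ?R")
proof
  assume L: ?L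
  show ?R
    unfolding cond_sep_def
  proof (intro allI impI)
    fix u v assume uv: "cyc E u" "cyc E v" "(u, v) \<in> E\<^sup>*"
    obtain p where "is_path V E p" "hd p = u" "last p = v" using exists_path[OF uv(3) cyc_V[OF uv(2)]] by blast
    moreover have "nontrivial_scc V E (cls E u)" "nontrivial_scc V E (cls E v)" using uv nontrivial_scc_iff by blast+
    ultimately have "cls E u = cls E v" using L self_cls by metis
    then show "(v, u) \<in> E\<^sup>*" using self_cls[of v E] unfolding cls_def by blast
  qed
next
  assume R: ?R
  show ?L
  proof clarify
    fix K K' p assume K: "nontrivial_scc V E K" "nontrivial_scc V E K'" "K \<noteq> K'"
      and p: "is_path V E p" "hd p \<in> K" "last p \<in> K'"
    have w: "walk V E p" "p \<noteq> []" using p(1) unfolding is_path_def walk_def by auto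
    have "(p ! 0, p ! (length p - 1)) \<in> E\<^sup>*" using walkf_rtrancl[OF walk_nth[OF w(1)]] by simp
    then have reach: "(hd p, last p) \<in> E\<^sup>*" using w(2) by (simp add: hd_conv_nth last_conv_nth)
    note h = nontrivial_scc_member[OF K(1) p(2)] and l = nontrivial_scc_member[OF K(2) p(3)]
    have "(last p, hd p) \<in> E\<^sup>*" using R h l reach unfolding cond_sep_def by blast
    then have "last p \<in> cls E (hd p)" using reach unfolding cls_def by blast
    then show False using cls_eq h l K(3) by metis
  qed
qed

end

locale bracketing_pair = digraph V E + tree_pair n "tedges t" "tedges t'" L
  for V :: "'v set" and E and n t t' L
begin

lemma tt_L_eq: "tt_L n t t' = ereal_nat L"
  unfolding tt_L_def dep_def[symmetric] by (rule Sup_agreement)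

lemma tt_L_Suc: "tt_L n t t' + 1 = ereal_nat (Suc L)"
  unfolding tt_L_eq by (simp add: one_ereal_def)

lemma cond_M_iff: "(\<exists>k. graph_M V E = enat k \<and> k dvd tt_M n t t') \<longleftrightarrow> cond_M E n (tedges t) (tedges t')"
proof -
  define W where "W = {m. \<exists>K B. is_scc V E K \<and> is_whirl E K m B}"
  have mW: "m \<in> W \<longleftrightarrow> (\<exists>u c. cyc E u \<and> whirl_coloring E (cls E u) m c)" for m
  proof -
    have "m \<in> W \<longleftrightarrow> (\<exists>K c. is_scc V E K \<and> whirl_coloring E K m c)"
      unfolding W_def using whirl_coloring_of_is_whirl is_whirl_of_whirl_coloring by blast
    then show ?thesis using whirl_scc_iff by blast
  qed
  have dvd: "m dvd tt_M n t t' \<longleftrightarrow> (\<forall>x. 1 \<le> x \<longrightarrow> x \<le> n \<longrightarrow> int m dvd int (dep (tedges t) x) - int (dep (tedges t') x))" for m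
    unfolding tt_M_def dep_def[symmetric] dvd_Gcd_iff using dvd_nat_abs_iff by auto
  have M: "cond_M E n (tedges t) (tedges t') \<longleftrightarrow> (\<forall>m\<in>W. m dvd tt_M n t t')"
    unfolding cond_M_def dvd using mW by blast
  \<comment> \<open>Since some depths differ, the gcd has only finitely many divisors; this is what
    makes \<open>graph_M\<close> finite.\<close>
  have pos: "tt_M n t t' \<noteq> 0"
  proof
    assume "tt_M n t t' = 0"
    then have "0 dvd tt_M n t t'" by simp
    then show False using dvd[of 0] differ by auto
  qed
  show ?thesis
  proof
    assume "\<exists>k. graph_M V E = enat k \<and> k dvd tt_M n t t'"
    then obtain k where k: "graph_M V E = enat k" "k dvd tt_M n t t'" by blast
    then have "Lcm W = k" unfolding graph_M_def W_def[symmetric] by (auto simp: Let_def split: if_splits)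
    then show "cond_M E n (tedges t) (tedges t')" using k(2) M by (meson Lcm_dvd_iff)
  next
    assume C: "cond_M E n (tedges t) (tedges t')"
    then have "W \<subseteq> {m. m dvd tt_M n t t'}" using M by blast
    then have "finite W" using pos finite_divisors_nat[of "tt_M n t t'"] by (meson finite_subset neq0_conv)
    then have "graph_M V E = enat (Lcm W)" unfolding graph_M_def W_def[symmetric] by (simp add: Let_def)
    then show "\<exists>k. graph_M V E = enat k \<and> k dvd tt_M n t t'" using C M by (auto intro: Lcm_least)
  qed
qed

lemma cond_P_iff: "graph_P V E < tt_H t t' \<longleftrightarrow> cond_P E (tedges t) (tedges t')"
proof -
  \<comment> \<open>With \<open>k = 0\<close>, \<open>walkf\<close> says nothing about
    \<open>v 0\<close>, which may lie outside \<open>V\<close>; positive heights take care of this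
    length.\<close>
  have pos: "0 < height (tedges t) 1" "0 < height (tedges t') 1" using A.height_pos B.height_pos two_le_n by auto
  have V: "v 0 \<in> V" if "walkf E k v" "k \<noteq> 0" for k v using that E unfolding walkf_def by blast
  show ?thesis
    unfolding graph_P_eq tt_H_def Sup_nat_less cond_P_def min_less_iff_conj
  proof (intro iffI allI impI)
    fix k v assume L: "\<forall>k\<in>{k. \<exists>v. walkf E k v \<and> v 0 \<in> V \<and> (\<forall>i\<le>k. \<not> cyc E (v i))}.
        k < height (tedges t) 1 \<and> k < height (tedges t') 1"
      and v: "walkf E k v" "\<forall>i\<le>k. \<not> cyc E (v i)"
    show "k < height (tedges t) 1 \<and> k < height (tedges t') 1"
    proof (cases "k = 0")
      case False
      then have "k \<in> {k. \<exists>v. walkf E k v \<and> v 0 \<in> V \<and> (\<forall>i\<le>k. \<not> cyc E (v i))}" using v V by blast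
      then show ?thesis using L by blast
    qed (use pos in simp)
  qed blast
qed

lemma cond_E_iff: "graph_E V E \<le> tt_L n t t' + 1 \<longleftrightarrow> cond_E E L"
  unfolding graph_E_eq tt_L_Suc cond_E_def by (auto simp: Sup_le_iff)

lemma cond_O_iff: "graph_O V E \<le> tt_Y n t t' + 1 \<longleftrightarrow> cond_O E n (tedges t) (tedges t')"
  unfolding graph_O_eq tt_Y_def le_Sup_subtrees cond_O_def by auto

lemma cond_Z_iff: "graph_Z V E < tt_Z n t t' \<longleftrightarrow> cond_Z E (tedges t) (tedges t')"
proof -
  let ?T = "tedges t" and ?T' = "tedges t'"
  let ?S = "{k. \<exists>x\<in>{1..n}. subtree_eq ?T ?T' x \<and> height ?T x = k \<and> parents ?T x \<noteq> parents ?T' x}"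
  have ne: "?S \<noteq> {}" using moved_subtree by blast
  have S: "j \<in> ?S \<longleftrightarrow> (\<exists>x p p'. subtree_eq ?T ?T' x \<and> height ?T x = j \<and> (p, x) \<in> ?T \<and> (p', x) \<in> ?T' \<and> p \<noteq> p')" for j
  proof
    assume "j \<in> ?S"
    then show "\<exists>x p p'. subtree_eq ?T ?T' x \<and> height ?T x = j \<and> (p, x) \<in> ?T \<and> (p', x) \<in> ?T' \<and> p \<noteq> p'"
      using different_parents by blast
  next
    assume "\<exists>x p p'. subtree_eq ?T ?T' x \<and> height ?T x = j \<and> (p, x) \<in> ?T \<and> (p', x) \<in> ?T' \<and> p \<noteq> p'"
    then obtain x p p' where x: "subtree_eq ?T ?T' x" "height ?T x = j" "(p, x) \<in> ?T" "(p', x) \<in> ?T'" "p \<noteq> p'" by blast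
    then show "j \<in> ?S" using parents_eq[OF x(3,4)] A.edgeD[OF x(3)] by auto
  qed
  have Z: "tt_Z n t t' = Inf (ereal_nat ` ?S)" unfolding tt_Z_def setcompr_eq_image ..
  show ?thesis
    unfolding graph_Z_eq Z Sup_less_Inf[OF ne] Ball_def S unfolding cond_Z_def mem_Collect_eq by blast
qed

lemma cond_B_iff: "graph_B V E < tt_L n t t' \<longleftrightarrow> cond_B E L"
  unfolding graph_B_eq tt_L_eq Sup_nat_less cond_B_def by blast

lemma cond_omega_r_iff:
  assumes r: "1 \<le> r" "r \<le> Suc L"
  shows "graph_omega V E (Suc L) r < tt_omega n t t' r \<longleftrightarrow>
    (\<forall>m v v' x. fork E (Suc L) r m v v' \<longrightarrow> 1 \<le> x \<longrightarrow> x \<le> n \<longrightarrow> \<not> subtree_eq (tedges t) (tedges t') x \<longrightarrow>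
     (dep (tedges t) x \<le> r \<longrightarrow> m < dep (tedges t) x + height (tedges t) x) \<and>
     (dep (tedges t') x \<le> r \<longrightarrow> m < dep (tedges t') x + height (tedges t') x))"
proof -
  let ?T = "tedges t" and ?T' = "tedges t'"
  define \<Omega> where "\<Omega> = tt_Omega n t t'"
  have \<Omega>_iff: "(d, h) \<in> \<Omega> \<longleftrightarrow> (\<exists>x. 1 \<le> x \<and> x \<le> n \<and> \<not> subtree_eq ?T ?T' x \<and>
      (d = dep ?T x \<and> h = height ?T x \<or> d = dep ?T' x \<and> h = height ?T' x))" for d h
    unfolding \<Omega>_def tt_Omega_def tt_Delta_def dep_def[symmetric] by auto
  \<comment> \<open>The root provides an entry of depth 0, so the minimum over
    \<open>d \<le> r\<close> is never over the empty set.\<close>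
  have root: "(0, height ?T 1) \<in> \<Omega>" unfolding \<Omega>_iff using root_not_eq two_le_n by (intro exI[of _ 1]) auto
  define X where "X = {k. \<exists>d h. (d, h) \<in> \<Omega> \<and> k = d + h}"
  define Xr where "Xr = {k. \<exists>d h. (d, h) \<in> \<Omega> \<and> d \<le> r \<and> k = d + h}"
  have ne: "X \<noteq> {}" "Xr \<noteq> {}" unfolding X_def Xr_def using root by blast+
  define xi where "xi = (LEAST k. k \<in> X)"
  have xi: "xi \<in> X" "\<And>k. k \<in> X \<Longrightarrow> xi \<le> k"
    unfolding xi_def using LeastI_ex[of "\<lambda>k. k \<in> X"] ne(1) by (blast, simp add: Least_le)
  have "{ereal (real (d + h)) | d h. (d, h) \<in> \<Omega>} = ereal_nat ` X" unfolding X_def by blast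
  then have "tt_xi n t t' = Inf (ereal_nat ` X)" unfolding tt_xi_def \<Omega>_def[symmetric] by simp
  then have tt_xi: "tt_xi n t t' = ereal_nat xi" unfolding xi_def Inf_nat[OF ne(1)] .
  have "{ereal (real (d + h)) | d h. (d, h) \<in> \<Omega> \<and> d \<le> r} = ereal_nat ` Xr" unfolding Xr_def by blast
  then have om: "tt_omega n t t' r = (if r < xi then Inf (ereal_nat ` Xr) else ereal_nat xi)"
    unfolding tt_omega_def tt_xi \<Omega>_def[symmetric] by simp
  let ?S = "{m. \<exists>v v'. fork E (Suc L) r m v v'}"
  have "graph_omega V E (Suc L) r < tt_omega n t t' r \<longleftrightarrow> (\<forall>m\<in>?S. \<forall>k\<in>Xr. m < k)"
  proof (cases "r < xi")
    case True
    then show ?thesis unfolding graph_omega_eq[OF r] om by (simp add: Sup_less_Inf[OF ne(2)])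
  next
    \<comment> \<open>A pair with sum \<open>xi \<le> r\<close> has first component at most
      \<open>r\<close>, so here the minimum over \<open>d \<le> r\<close> is \<open>xi\<close> and
      both branches of \<open>tt_omega\<close> express the same bound.\<close>
    case False
    obtain d h where "(d, h) \<in> \<Omega>" "xi = d + h" using xi(1) unfolding X_def by blast
    moreover from this have "d \<le> r" using False by simp
    ultimately have "xi \<in> Xr" unfolding Xr_def by blast
    moreover have "Xr \<subseteq> X" unfolding X_def Xr_def by blast
    ultimately have "(\<forall>k\<in>Xr. m < k) \<longleftrightarrow> m < xi" for m using xi(2) by (meson less_le_trans subsetD)
    then show ?thesis unfolding graph_omega_eq[OF r] om using False by (simp add: Sup_nat_less)
  qed
  also have "\<dots> \<longleftrightarrow> (\<forall>m v v' d h. fork E (Suc L) r m v v' \<longrightarrow> (d, h) \<in> \<Omega> \<longrightarrow> d \<le> r \<longrightarrow> m < d + h)"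
    unfolding Xr_def by blast
  finally show ?thesis unfolding \<Omega>_iff by blast
qed

lemma cond_omega_iff:
  "(\<forall>l :: nat. ereal (real l) = tt_L n t t' + 1 \<longrightarrow>
      (\<forall>r :: nat. 1 \<le> r \<and> r \<le> l \<longrightarrow> graph_omega V E l r < tt_omega n t t' r)) \<longleftrightarrow>
   cond_omega E n (tedges t) (tedges t') L"
proof -
  have "(\<forall>l :: nat. ereal (real l) = tt_L n t t' + 1 \<longrightarrow>
      (\<forall>r :: nat. 1 \<le> r \<and> r \<le> l \<longrightarrow> graph_omega V E l r < tt_omega n t t' r)) \<longleftrightarrow>
    (\<forall>r. 1 \<le> r \<longrightarrow> r \<le> Suc L \<longrightarrow> graph_omega V E (Suc L) r < tt_omega n t t' r)"
    unfolding tt_L_Suc ereal.inject of_nat_eq_iff by blast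
  also have "\<dots> \<longleftrightarrow> cond_omega E n (tedges t) (tedges t') L"
    using cond_omega_r_iff unfolding cond_omega_def fork_def by (smt (verit, ccfv_threshold))
  finally show ?thesis .
qed

lemma graph_lambda_eq:
  assumes "graph_E V E = ereal_nat (Suc L)"
  shows "graph_lambda V E = Sup (ereal_nat ` {m. \<exists>u w v. entry_walk E (Suc L) u \<and> w \<in> cls E (u (Suc L)) \<and>
     (w, u (Suc L)) \<in> E \<and> walkf E m v \<and> ((w, v 0) \<in> E) \<noteq> ((u L, v 0) \<in> E)})"
proof -
  have "(\<exists>K p w vs. entryway V E K p \<and> ereal (real (wlen p)) = graph_E V E \<and> length p \<ge> 2 \<and>
      w \<in> K \<and> (w, last p) \<in> E \<and> walk V E vs \<and> length vs = m + 1 \<and>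
      (((w, hd vs) \<in> E) \<noteq> ((p ! (length p - 2), hd vs) \<in> E))) \<longleftrightarrow>
    (\<exists>u w v. entry_walk E (Suc L) u \<and> w \<in> cls E (u (Suc L)) \<and>
     (w, u (Suc L)) \<in> E \<and> walkf E m v \<and> ((w, v 0) \<in> E) \<noteq> ((u L, v 0) \<in> E))" (is "?L \<longleftrightarrow> ?R") for m
  proof
    assume ?L
    then obtain K p w vs where p: "entryway V E K p" "ereal_nat (wlen p) = graph_E V E"
      and w: "w \<in> K" "(w, last p) \<in> E" and vs: "walk V E vs" "length vs = m + 1"
        "((w, hd vs) \<in> E) \<noteq> ((p ! (length p - 2), hd vs) \<in> E)" by blast
    have len: "wlen p = Suc L" using p(2) assms by simp
    then have "length p - 2 = L" unfolding wlen_def by simp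
    then obtain v where "walkf E m v" "((w, v 0) \<in> E) \<noteq> ((p ! L, v 0) \<in> E)"
      using vs list_walk_iff[of m "\<lambda>x. ((w, x) \<in> E) \<noteq> ((p ! L, x) \<in> E)"] by auto
    then show ?R using entry_walk_of_entryway[OF p(1)] w unfolding len
      by (intro exI[of _ "\<lambda>i. p ! i"] exI[of _ w] exI[of _ v]) simp
  next
    assume ?R
    then obtain u w v where u: "entry_walk E (Suc L) u" "w \<in> cls E (u (Suc L))" "(w, u (Suc L)) \<in> E"
      and v: "walkf E m v" "((w, v 0) \<in> E) \<noteq> ((u L, v 0) \<in> E)" by blast
    have "v 0 \<in> V" using v(2) E by blast
    then obtain vs where vs: "walk V E vs" "length vs = m + 1" "((w, hd vs) \<in> E) \<noteq> ((u L, hd vs) \<in> E)"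
      using v list_walk_iff[of m "\<lambda>x. ((w, x) \<in> E) \<noteq> ((u L, x) \<in> E)"] by auto
    let ?p = "map u [0..<Suc (Suc L)]"
    have "?p ! (length ?p - 2) = u L" using map_upt_simps(1)[of u "Suc L"] map_upt_simps(4)[of L "Suc L" u] by simp
    then show ?L
      using entryway_of_entry_walk[OF u(1)] u vs assms map_upt_simps(1,3,6)[of u "Suc L"]
      by (intro exI[of _ "cls E (u (Suc L))"] exI[of _ ?p] exI[of _ w] exI[of _ vs]) (simp del: upt_Suc)
  qed
  then show ?thesis unfolding graph_lambda_def setcompr_eq_image by (simp only:)
qed

lemma cond_lambda_iff:
  assumes "cond_E E L"
  shows "(graph_E V E = tt_L n t t' + 1 \<longrightarrow> graph_lambda V E < tt_lambda n t t') \<longleftrightarrow>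
    cond_lambda E n (tedges t) (tedges t') L"
proof -
  let ?T = "tedges t" and ?T' = "tedges t'"
  let ?S = "{k. \<exists>x. x \<in> tt_Lambda n t t' \<and> max (height ?T x) (height ?T' x) = k}"
  have \<Lambda>: "x \<in> tt_Lambda n t t' \<longleftrightarrow> 1 \<le> x \<and> x \<le> n \<and> dep ?T x \<noteq> dep ?T' x \<and> (dep ?T x = Suc L \<or> dep ?T' x = Suc L)" for x
    unfolding tt_Lambda_def tt_L_Suc dep_def[symmetric] by auto
  have ne: "?S \<noteq> {}" using differ \<Lambda> by auto
  have lam: "tt_lambda n t t' = Inf (ereal_nat ` ?S)" unfolding tt_lambda_def ereal_nat_image ..
  show ?thesis
  proof (cases "graph_E V E = ereal_nat (Suc L)")
    case True
    then have "(graph_E V E = tt_L n t t' + 1 \<longrightarrow> graph_lambda V E < tt_lambda n t t') \<longleftrightarrow>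
        graph_lambda V E < tt_lambda n t t'" unfolding tt_L_Suc by simp
    also have "\<dots> \<longleftrightarrow> cond_lambda E n ?T ?T' L"
      unfolding graph_lambda_eq[OF True] lam Sup_less_Inf[OF ne]
      unfolding cond_lambda_def mem_Collect_eq Ball_def \<Lambda> by blast
    finally show ?thesis .
  next
    \<comment> \<open>Given (v), an entry walk of length \<open>L + 1\<close> would make
      \<open>graph_E\<close> equal to \<open>L + 1\<close>; without one, \<open>cond_lambda\<close>
      holds vacuously.\<close>
    case False
    have "\<not> entry_walk E (Suc L) u" for u
    proof
      assume "entry_walk E (Suc L) u"
      then have "ereal_nat (Suc L) \<le> graph_E V E" unfolding graph_E_eq by (intro Sup_upper) blast
      moreover have "graph_E V E \<le> ereal_nat (Suc L)" using assms cond_E_iff tt_L_Suc by simp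
      ultimately show False using False by simp
    qed
    then show ?thesis using False unfolding tt_L_Suc cond_lambda_def by simp
  qed
qed

end

theorem theorem6p31:
  fixes V :: "'v set" and E :: "('v \<times> 'v) set" and n :: nat and t t' :: bterm
  assumes "E \<subseteq> V \<times> V"
    and "t \<in> bracketings n" and "t' \<in> bracketings n" and "t \<noteq> t'"
  shows "ga_satisfies V E t t' \<longleftrightarrow>
    ((\<forall>K. nontrivial_scc V E K \<longrightarrow> whirl E K) \<and>
     (\<nexists>K K' p. nontrivial_scc V E K \<and> nontrivial_scc V E K' \<and> K \<noteq> K' \<and>
        is_path V E p \<and> hd p \<in> K \<and> last p \<in> K') \<and>
     (\<exists>k. graph_M V E = enat k \<and> k dvd tt_M n t t') \<and>
     graph_P V E < tt_H t t' \<and>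
     graph_E V E \<le> tt_L n t t' + 1 \<and>
     graph_O V E \<le> tt_Y n t t' + 1 \<and>
     graph_Z V E < tt_Z n t t' \<and>
     graph_B V E < tt_L n t t' \<and>
     (\<forall>l :: nat. ereal (real l) = tt_L n t t' + 1 \<longrightarrow>
        (\<forall>r :: nat. 1 \<le> r \<and> r \<le> l \<longrightarrow> graph_omega V E l r < tt_omega n t t' r)) \<and>
     (graph_E V E = tt_L n t t' + 1 \<longrightarrow> graph_lambda V E < tt_lambda n t t'))"
proof -
  have leaves: "leaves t = [1..<Suc n]" "leaves t' = [1..<Suc n]" using assms(2,3) by (auto simp: bracketings_def)
  have "tedges t \<noteq> tedges t'" using tedges_inj[OF leaves] assms(4) by blast
  then obtain L where "tree_pair n (tedges t) (tedges t') L"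
    using dfs_trees_pair bracketing_dfs_tree assms(2,3) by metis
  then interpret bracketing_pair V E n t t' L
    unfolding bracketing_pair_def digraph_def using assms(1) by blast
  have whirl: "(\<forall>K. nontrivial_scc V E K \<longrightarrow> whirl E K) \<longleftrightarrow> cond_whirl E"
    unfolding cond_whirl_def nontrivial_scc_iff whirl_iff by blast
  have "ga_satisfies V E t t' \<longleftrightarrow> conds E n (tedges t) (tedges t') L \<and> cond_B E L"
    using ga_satisfies_iff[OF assms(1-3) two_le_n] same_homs_iff[of E] by simp
  \<comment> \<open>\<open>cond_lambda_iff\<close> presupposes (v), which is available as a conjunct
    on both sides.\<close>
  also have "\<dots> \<longleftrightarrow> cond_whirl E \<and> cond_sep E \<and> cond_M E n (tedges t) (tedges t') \<and>
      cond_P E (tedges t) (tedges t') \<and> cond_E E L \<and> cond_O E n (tedges t) (tedges t') \<and>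
      cond_Z E (tedges t) (tedges t') \<and> cond_B E L \<and> cond_omega E n (tedges t) (tedges t') L \<and>
      (graph_E V E = tt_L n t t' + 1 \<longrightarrow> graph_lambda V E < tt_lambda n t t')"
    unfolding conds_def using cond_lambda_iff by blast
  finally show ?thesis
    unfolding whirl cond_sep_iff cond_M_iff cond_P_iff cond_E_iff cond_O_iff cond_Z_iff cond_B_iff cond_omega_iff .
qed

end
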